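(* Let $\mu$ be a countably additive, $\sigma$-finite measure defined on a $\sigma$-algebra $\mathcal A$ of subsets of a set $X$. Then there are a countable partition $\vec P=\langle P_i\rangle$ of $X$, a fine filter $F$ over $[X]^{<\omega}$ definable from $\mu$ and $\vec P$, and a "weight function" $w:X\to\mathbb R$ that is constant on each $P_i$, such that $F$ is the smallest (with respect to inclusion) fine filter $G$ over $[X]^{<\omega}$ with the property that for every $\mu$-integrable function $f:X\to\mathbb R$, $$\int f\,d\mu=\mathrm{st}\!\int fw\,d(G,\vec P).$$ Furthermore, if $\mu(X)<\infty$, then we can take $\vec P=\langle P_i:i<\alpha\rangle$ with $\alpha\le\omega$ such that $P_0$ contains no point masses and $P_i$ is a singleton for $0<i<\alpha$.
   Context: $[X]^{<\omega}$ is the set of finite subsets of $X$. Filters are proper. A filter $G$ over $[X]^{<\omega}$ is fine if $\{z : x\in z\}\in G$ for every $x\in X$. The measure $\mu$ takes values in $[0,\infty]$. A point mass is a point $x\in X$ with $\mu(\{x\})>0$. The block $P_0$ is allowed to be empty. For a filter $G$ over a set $Z$, $\mathrm{Pow}(\mathbb R,G)$ is the set of functions $Z\to\mathbb R$ modulo agreeing on a set in $G$, with pointwise ring operations, $[g]_G<[h]_G$ iff $\{z: g(z)<h(z)\}\in G$, and $\mathbb R$ embedded via constants. For $a\in\mathrm{Pow}(\mathbb R,G)$, $\mathrm{st}^+a=\inf\{q\in\mathbb Q: a<q\}$, $\mathrm{st}^-a=\sup\{q\in\mathbb Q: q<a\}$ (conventions $\inf\emptyset=\sup\mathbb Q=\infty$,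 $\sup\emptyset=\inf\mathbb Q=-\infty$); if equal, $\mathrm{st}\,a$ is their common value. Weighted integral: for a partition $\vec P=\{P_i:i\in I\}$ of $X$, a fine filter $G$ over $[X]^{<\omega}$ and $f:X\to\mathbb R$, $$\int f\,d(G,\vec P)=\left[z\mapsto\sum_{i\in I}\ \sum_{x\in z\cap P_i}\frac{f(x)}{|z\cap P_i|}\right]_G\in\mathrm{Pow}(\mathbb R,G)$$ (only finitely many terms are present; blocks with $z\cap P_i=\emptyset$ contribute $0$). $\mathrm{st}\!\int f\,d(G,\vec P):=\mathrm{st}\left(\int f\,d(G,\vec P)\right)$ when defined. "Definable" means definable by a formula of set theory from the listed parameters. *)

theory Defs
  imports "HOL-Analysis.Analysis"
begin

section \<open>Fine filters and reduced powers of the reals\<close>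

text \<open>
  A filter over a set \<open>Z\<close> is a filter below \<^term>\<open>principal Z\<close>; its members are the sets \<open>S \<subseteq> Z\<close>
  with \<^prop>\<open>\<forall>\<^sub>F z in G. z \<in> S\<close>.  The library orders filters by \<^emph>\<open>reverse\<close> inclusion: \<^prop>\<open>G \<le> F\<close> says
  that every member of \<open>F\<close> is a member of \<open>G\<close>.
\<close>

definition fine_filter :: "'a set \<Rightarrow> 'a set filter \<Rightarrow> bool" where
  "fine_filter X G \<longleftrightarrow>
     G \<noteq> bot \<and> G \<le> principal (Fpow X) \<and> (\<forall>x\<in>X. \<forall>\<^sub>F z in G. x \<in> z)"

text \<open>
  \<open>Pow(\<real>, G)\<close> is \<^term>\<open>UNIV // pow_rel G\<close>.  Functions are total on the type; since \<open>G\<close> concentrates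
  on \<open>Z\<close>, values outside \<open>Z\<close> do not affect the class.
\<close>

definition pow_rel :: "'z filter \<Rightarrow> (('z \<Rightarrow> real) \<times> ('z \<Rightarrow> real)) set" where
  "pow_rel G = {(g, h). \<forall>\<^sub>F z in G. g z = h z}"

definition pow_class :: "'z filter \<Rightarrow> ('z \<Rightarrow> real) \<Rightarrow> ('z \<Rightarrow> real) set" where
  "pow_class G g = pow_rel G `` {g}"

definition pow_less :: "'z filter \<Rightarrow> ('z \<Rightarrow> real) set \<Rightarrow> ('z \<Rightarrow> real) set \<Rightarrow> bool" where
  "pow_less G a b \<longleftrightarrow>
     (\<exists>g h. a = pow_class G g \<and> b = pow_class G h \<and> (\<forall>\<^sub>F z in G. g z < h z))"

definition pow_const :: "'z filter \<Rightarrow> real \<Rightarrow> ('z \<Rightarrow> real) set" where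
  "pow_const G r = pow_class G (\<lambda>_. r)"

definition st_plus :: "'z filter \<Rightarrow> ('z \<Rightarrow> real) set \<Rightarrow> ereal" where
  "st_plus G a = (INF q\<in>{q :: rat. pow_less G a (pow_const G (of_rat q))}. ereal (of_rat q))"

definition st_minus :: "'z filter \<Rightarrow> ('z \<Rightarrow> real) set \<Rightarrow> ereal" where
  "st_minus G a = (SUP q\<in>{q :: rat. pow_less G (pow_const G (of_rat q)) a}. ereal (of_rat q))"

definition has_st :: "'z filter \<Rightarrow> ('z \<Rightarrow> real) set \<Rightarrow> ereal \<Rightarrow> bool" where
  "has_st G a s \<longleftrightarrow> st_plus G a = s \<and> st_minus G a = s"

lemma equiv_pow_rel: "equiv UNIV (pow_rel G)"
  by (rule equivI)
    (auto simp: pow_rel_def refl_on_def sym_def trans_def elim: eventually_mono eventually_elim2)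

lemma pow_class_eq_iff: "pow_class G g = pow_class G h \<longleftrightarrow> (\<forall>\<^sub>F z in G. g z = h z)"
  unfolding pow_class_def using eq_equiv_class_iff[OF equiv_pow_rel, of g h G]
  by (simp add: pow_rel_def)

lemma pow_less_class_iff: "pow_less G (pow_class G g) (pow_class G h) \<longleftrightarrow> (\<forall>\<^sub>F z in G. g z < h z)"
proof
  assume "pow_less G (pow_class G g) (pow_class G h)"
  then obtain g' h' where "\<forall>\<^sub>F z in G. g z = g' z" "\<forall>\<^sub>F z in G. h z = h' z" "\<forall>\<^sub>F z in G. g' z < h' z"
    unfolding pow_less_def pow_class_eq_iff by blast
  then show "\<forall>\<^sub>F z in G. g z < h z"
    by eventually_elim simp
qed (auto simp: pow_less_def)


section \<open>Countable partitions and weighted integrals\<close>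

text \<open>
  Partitions are indexed by an ordinal \<open>\<alpha> \<le> \<omega>\<close>.  The blocks need not be measurable, and only the
  block \<open>P 0\<close> may be empty.
\<close>

definition countable_partition :: "'a set \<Rightarrow> enat \<Rightarrow> (nat \<Rightarrow> 'a set) \<Rightarrow> bool" where
  "countable_partition X \<alpha> P \<longleftrightarrow>
     disjoint_family_on P {i. enat i < \<alpha>} \<and> (\<Union>i\<in>{i. enat i < \<alpha>}. P i) = X \<and>
     (\<forall>i. 0 < i \<and> enat i < \<alpha> \<longrightarrow> P i \<noteq> {})"

text \<open>
  The outer sum is restricted to the blocks that meet \<open>z\<close>: this index set is finite, whereas
  \<^const>\<open>sum\<close> over an infinite set is 0.
\<close>

definition weighted_integral ::
  "'a set filter \<Rightarrow> enat \<Rightarrow> (nat \<Rightarrow> 'a set) \<Rightarrow> ('a \<Rightarrow> real) \<Rightarrow> ('a set \<Rightarrow> real) set" where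
  "weighted_integral G \<alpha> P f =
     pow_class G (\<lambda>z. \<Sum>i | enat i < \<alpha> \<and> z \<inter> P i \<noteq> {}. \<Sum>x\<in>z \<inter> P i. f x / real (card (z \<inter> P i)))"

definition represents_integral ::
  "'a measure \<Rightarrow> enat \<Rightarrow> (nat \<Rightarrow> 'a set) \<Rightarrow> ('a \<Rightarrow> real) \<Rightarrow> 'a set filter \<Rightarrow> bool" where
  "represents_integral M \<alpha> P w G \<longleftrightarrow>
     (\<forall>f. integrable M f \<longrightarrow>
        has_st G (weighted_integral G \<alpha> P (\<lambda>x. f x * w x)) (ereal (\<integral>x. f x \<partial>M)))"

definition point_mass :: "'a measure \<Rightarrow> 'a \<Rightarrow> bool" where
  "point_mass M x \<longleftrightarrow> x \<in> space M \<and> {x} \<in> sets M \<and> emeasure M {x} > 0"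


section \<open>Definability by formulas of set theory\<close>

datatype set_fm =
    Mem nat nat
  | Equal nat nat
  | Neg set_fm
  | Conj set_fm set_fm
  | Exi nat set_fm

text \<open>
  A structure for the language of set theory is given by the map \<open>elts\<close> taking each of its objects
  to the collection of the members of that object.
\<close>

primrec sat :: "('v \<Rightarrow> 'v set) \<Rightarrow> (nat \<Rightarrow> 'v) \<Rightarrow> set_fm \<Rightarrow> bool" where
  "sat elts e (Mem i j) \<longleftrightarrow> e i \<in> elts (e j)"
| "sat elts e (Equal i j) \<longleftrightarrow> e i = e j"
| "sat elts e (Neg p) \<longleftrightarrow> \<not> sat elts e p"
| "sat elts e (Conj p q) \<longleftrightarrow> sat elts e p \<and> sat elts e q"
| "sat elts e (Exi i p) \<longleftrightarrow> (\<exists>x. sat elts (e(i := x)) p)"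

text \<open>
  The formula \<open>\<phi>\<close> defines \<open>y\<close> from the parameters \<open>ps\<close>, which are the values of the variables
  \<open>1, 2, \<dots>\<close>; variable 0 stands for the object defined.  The values of all other variables
  are arbitrary, so that they cannot serve as further parameters.
\<close>

definition fm_defines :: "('v \<Rightarrow> 'v set) \<Rightarrow> set_fm \<Rightarrow> 'v list \<Rightarrow> 'v \<Rightarrow> bool" where
  "fm_defines elts \<phi> ps y \<longleftrightarrow>
     (\<forall>e. (\<forall>i < length ps. e (Suc i) = ps ! i) \<longrightarrow> (sat elts e \<phi> \<longleftrightarrow> e 0 = y))"

text \<open>
  Universes of sets: Zermelo-Fraenkel set theory with separation and replacement for arbitrary (not
  only first-order definable) classes and class functions.  The power set axiom is left out here;
  the power sets that are needed are demanded in \<open>universe_over\<close> below.  So not only the universe of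
  all sets qualifies, but also each structure of the sets hereditarily of cardinality less than
  \<open>\<kappa>\<close>, for a large enough regular \<open>\<kappa>\<close>.
\<close>

locale set_universe =
  fixes elts :: "'v \<Rightarrow> 'v set"
  assumes extensionality: "elts x = elts y \<Longrightarrow> x = y"
    and foundation: "wf {(x, y). x \<in> elts y}"
    and pairing: "\<exists>p. elts p = {x, y}"
    and union: "\<exists>u. elts u = (\<Union>y\<in>elts x. elts y)"
    and infinity: "\<exists>x. infinite (elts x)"
    and separation: "A \<subseteq> elts x \<Longrightarrow> \<exists>y. elts y = A"
    and replacement: "\<exists>y. elts y = f ` elts x"
begin

definition is_powerset :: "'v \<Rightarrow> 'v \<Rightarrow> bool" where
  "is_powerset p x \<longleftrightarrow> elts p = {y. elts y \<subseteq> elts x}"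

text \<open>
  The points of \<open>X\<close> are objects of the universe via the injection \<open>c\<close>, and some infinite set \<open>u\<close> that
  contains them can be iterated twice under the power set operation.  This is what it takes
  for filters over \<open>[X]\<^sup><\<^sup>\<omega>\<close> to be objects of the universe.
\<close>

definition universe_over :: "('a \<Rightarrow> 'v) \<Rightarrow> 'a set \<Rightarrow> bool" where
  "universe_over c X \<longleftrightarrow>
     inj_on c X \<and>
     (\<exists>u p q. infinite (elts u) \<and> c ` X \<subseteq> elts u \<and> is_powerset p u \<and> is_powerset q p)"

definition mk :: "'v set \<Rightarrow> 'v" where
  "mk A = (THE x. elts x = A)"

definition kpair :: "'v \<Rightarrow> 'v \<Rightarrow> 'v" where
  "kpair x y = mk {mk {x}, mk {x, y}}"

primrec nat_code :: "nat \<Rightarrow> 'v" where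
  "nat_code 0 = mk {}"
| "nat_code (Suc n) = mk (insert (nat_code n) (elts (nat_code n)))"

text \<open>
  An element \<open>r\<close> of \<open>[0, \<infinity>]\<close> is the set of the pairs \<open>(m, n)\<close> with \<open>n > 0\<close> and \<open>m / n < r\<close>.  As
  \<open>\<infinity> * 0 = 0\<close>, the condition below excludes \<open>n = 0\<close> for every \<open>r\<close>.
\<close>

definition ennreal_code :: "ennreal \<Rightarrow> 'v" where
  "ennreal_code r = mk {kpair (nat_code m) (nat_code n) | m n. of_nat m < r * of_nat n}"

definition set_code :: "('a \<Rightarrow> 'v) \<Rightarrow> 'a set \<Rightarrow> 'v" where
  "set_code c A = mk (c ` A)"

definition measure_code :: "('a \<Rightarrow> 'v) \<Rightarrow> 'a measure \<Rightarrow> 'v" where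
  "measure_code c M = mk ((\<lambda>A. kpair (set_code c A) (ennreal_code (emeasure M A))) ` sets M)"

definition family_code :: "('a \<Rightarrow> 'v) \<Rightarrow> enat \<Rightarrow> (nat \<Rightarrow> 'a set) \<Rightarrow> 'v" where
  "family_code c \<alpha> P = mk ((\<lambda>i. kpair (nat_code i) (set_code c (P i))) ` {i. enat i < \<alpha>})"

definition filter_code :: "('a \<Rightarrow> 'v) \<Rightarrow> 'a set \<Rightarrow> 'a set filter \<Rightarrow> 'v" where
  "filter_code c X F =
     mk ((\<lambda>S. mk (set_code c ` S)) ` {S. S \<subseteq> Fpow X \<and> (\<forall>\<^sub>F z in F. z \<in> S)})"

definition filter_defined_by ::
  "set_fm \<Rightarrow> ('a \<Rightarrow> 'v) \<Rightarrow> 'a measure \<Rightarrow> enat \<Rightarrow> (nat \<Rightarrow> 'a set) \<Rightarrow> 'a set filter \<Rightarrow> bool" where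
  "filter_defined_by \<phi> c M \<alpha> P F \<longleftrightarrow>
     fm_defines elts \<phi> [measure_code c M, family_code c \<alpha> P] (filter_code c (space M) F)"

end

text \<open>
  The formula is required to work in every universe of sets of type \<open>'v\<close> and for every way of
  regarding the points of the space as sets.
\<close>

definition filter_definable_by ::
  "'v itself \<Rightarrow> set_fm \<Rightarrow> 'a measure \<Rightarrow> enat \<Rightarrow> (nat \<Rightarrow> 'a set) \<Rightarrow> 'a set filter \<Rightarrow> bool" where
  "filter_definable_by _ \<phi> M \<alpha> P F \<longleftrightarrow>
     (\<forall>(elts :: 'v \<Rightarrow> 'v set) (c :: 'a \<Rightarrow> 'v).
        set_universe elts \<longrightarrow> set_universe.universe_over elts c (space M) \<longrightarrow>
        set_universe.filter_defined_by elts \<phi> c M \<alpha> P F)"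

end

theory Submission
  imports Defs
begin

text \<open>
  Why the theorem holds.  The mean of a function over a large finite part of an infinite block ignores
  every finite subset of the block, so finite sets of positive measure have to be treated
  separately.  The minimal ones are atoms of the \<open>\<sigma>\<close>-algebra; there are countably many of them, and
  measurable functions are constant on each.  So every point of an atom \<open>A\<close> becomes a block of its own,
  of weight \<open>\<mu>(A) / |A|\<close>, and what is left of \<open>X\<close> is cut into countably many blocks \<open>Q\<close> of finite
  measure and of weight \<open>\<mu>(Q)\<close>, a single one if \<open>\<mu>(X)\<close> is finite; there every measurable set of positive
  measure is infinite.  This is \<open>ex_adapted_partition\<close>.

  For this partition, the fine filters that represent the integral are closed under suprema, hence
  there is a least one with respect to inclusion, provided that some proper one exists.  Both its
  existence and its definability rest on a reduction of convergence to one-sided bounds for functions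
  with natural values.  A \<^emph>\<open>test\<close> is a pair \<open>V : X \<rightarrow> \<nat>\<close>, \<open>C : \<nat> \<rightarrow> {1, 2, \<dots>}\<close> with \<open>V\<close> measurable; it stands for the
  function \<open>V / C\<^sub>j\<close> on the measurable block \<open>P\<^sub>j\<close>, already multiplied by the weight.  A fine filter represents the
  integral if and only if, for every test, a bound \<open>b < 1\<close> on the sum over \<open>j\<close> of the means of
  \<open>V / C\<^sub>j\<close> over \<open>P\<^sub>j\<close> implies that the corresponding sum of sample means over \<open>z\<close> is eventually at most 1
  (\<open>converges_of_bounds_tests\<close>, \<open>tests_bounded_of_convergence\<close>).  Indeed a nonnegative integrable
  function can be rounded up to a test at the cost of \<open>\<Sum> 1 / C\<^sub>j\<close>, so upper bounds follow; lower bounds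
  follow from upper bounds for \<open>n - min f n\<close> on sets of finite measure that exhaust \<open>X\<close>.

  \<^item> Properness: finitely many tests partition a block into countably many level cells.  Finitely many
    cells carry almost all of the measure, those of positive measure are infinite, and so one can draw
    from each cell a number of points proportional to its measure (\<open>sample_block\<close>).

  \<^item> Definability: the two sides of the condition on a test involve only natural numbers, measures
    and cardinalities of finite sets.  That a finite sum of nonnegative reals \<open>x\<^sub>p\<close> is at most 1 is
    certified, up to an arbitrarily small slack, by disjoint subsets \<open>T\<^sub>p\<close> of some \<open>{0, \<dots>, N - 1}\<close> with
    \<open>N x\<^sub>p \<le> |T\<^sub>p|\<close>; and products of cardinalities are compared by injections.  So the condition is
    a formula of set theory, with no need for real arithmetic, and the least filter satisfying it is
    definable (\<open>converges_iff_packing\<close>, \<open>least_good_filter_iff\<close>).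
\<close>


section \<open>Weighted integrals as limits of block sums\<close>

definition block_sum :: "enat \<Rightarrow> (nat \<Rightarrow> 'a set) \<Rightarrow> ('a \<Rightarrow> real) \<Rightarrow> 'a set \<Rightarrow> real" where
  "block_sum \<alpha> P f z =
     (\<Sum>i | enat i < \<alpha> \<and> z \<inter> P i \<noteq> {}. \<Sum>x\<in>z \<inter> P i. f x / real (card (z \<inter> P i)))"

lemma weighted_integral_eq: "weighted_integral G \<alpha> P f = pow_class G (block_sum \<alpha> P f)"
  by (simp add: weighted_integral_def block_sum_def[abs_def])

text \<open>
  The rationals around \<open>r\<close> squeeze the value.  Properness is what forbids rationals eventually below
  the value to exceed \<open>r\<close>.
\<close>

lemma has_st_iff_tendsto:
  assumes "G \<noteq> bot"
  shows "has_st G (pow_class G g) (ereal r) \<longleftrightarrow> (g \<longlongrightarrow> r) G"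
proof
  assume st: "has_st G (pow_class G g) (ereal r)"
  show "(g \<longlongrightarrow> r) G"
  proof (rule order_tendstoI)
    fix a assume "a < r"
    then have "ereal a < st_minus G (pow_class G g)" using st by (simp add: has_st_def)
    then obtain q :: rat where "\<forall>\<^sub>F z in G. of_rat q < g z" "a < of_rat q"
      unfolding st_minus_def less_SUP_iff by (auto simp: pow_const_def pow_less_class_iff)
    then show "\<forall>\<^sub>F z in G. a < g z" by (auto elim: eventually_mono)
  next
    fix a assume "r < a"
    then have "st_plus G (pow_class G g) < ereal a" using st by (simp add: has_st_def)
    then obtain q :: rat where "\<forall>\<^sub>F z in G. g z < of_rat q" "of_rat q < a"
      unfolding st_plus_def INF_less_iff by (auto simp: pow_const_def pow_less_class_iff)
    then show "\<forall>\<^sub>F z in G. g z < a" by (auto elim: eventually_mono)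
  qed
next
  assume lim: "(g \<longlongrightarrow> r) G"
  have "st_plus G (pow_class G g) = ereal r"
  proof (rule antisym)
    show "st_plus G (pow_class G g) \<le> ereal r"
    proof (rule dense_ge)
      fix y assume "ereal r < y"
      then obtain s where s: "r < s" "ereal s \<le> y"
        using ereal_dense2 by (metis less_ereal.simps(1) less_imp_le)
      obtain q where q: "r < of_rat q" "of_rat q < s" using of_rat_dense[OF s(1)] by blast
      have "\<forall>\<^sub>F z in G. g z < of_rat q" using lim q(1) by (rule order_tendstoD)
      then have "st_plus G (pow_class G g) \<le> ereal (of_rat q)"
        unfolding st_plus_def by (intro INF_lower) (simp add: pow_const_def pow_less_class_iff)
      also have "\<dots> \<le> y" using q s by (metis ereal_less_eq(3) less_imp_le order_trans)
      finally show "st_plus G (pow_class G g) \<le> y" .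
    qed
    show "ereal r \<le> st_plus G (pow_class G g)"
      unfolding st_plus_def
    proof (rule INF_greatest)
      fix q assume "q \<in> {q. pow_less G (pow_class G g) (pow_const G (of_rat q))}"
      then have *: "\<forall>\<^sub>F z in G. g z < of_rat q" by (simp add: pow_const_def pow_less_class_iff)
      have "r \<le> of_rat q"
        by (rule tendsto_upperbound[OF lim _ assms]) (use * in \<open>auto elim: eventually_mono\<close>)
      then show "ereal r \<le> ereal (of_rat q)" by simp
    qed
  qed
  moreover have "st_minus G (pow_class G g) = ereal r"
  proof (rule antisym)
    show "ereal r \<le> st_minus G (pow_class G g)"
    proof (rule dense_le)
      fix y assume "y < ereal r"
      then obtain s where s: "s < r" "y \<le> ereal s"
        using ereal_dense2 by (metis less_ereal.simps(1) less_imp_le)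
      obtain q where q: "s < of_rat q" "of_rat q < r" using of_rat_dense[OF s(1)] by blast
      have "\<forall>\<^sub>F z in G. of_rat q < g z" using lim q(2) by (rule order_tendstoD)
      then have "ereal (of_rat q) \<le> st_minus G (pow_class G g)"
        unfolding st_minus_def by (intro SUP_upper) (simp add: pow_const_def pow_less_class_iff)
      moreover have "y \<le> ereal (of_rat q)" using q s by (metis ereal_less_eq(3) less_imp_le order_trans)
      ultimately show "y \<le> st_minus G (pow_class G g)" by (rule order_trans[rotated])
    qed
    show "st_minus G (pow_class G g) \<le> ereal r"
      unfolding st_minus_def
    proof (rule SUP_least)
      fix q assume "q \<in> {q. pow_less G (pow_const G (of_rat q)) (pow_class G g)}"
      then have *: "\<forall>\<^sub>F z in G. of_rat q < g z" by (simp add: pow_const_def pow_less_class_iff)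
      have "of_rat q \<le> r"
        by (rule tendsto_lowerbound[OF lim _ assms]) (use * in \<open>auto elim: eventually_mono\<close>)
      then show "ereal (of_rat q) \<le> ereal r" by simp
    qed
  qed
  ultimately show "has_st G (pow_class G g) (ereal r)" by (simp add: has_st_def)
qed

text \<open>
  Unlike \<open>represents_integral\<close>, this is satisfied by the improper filter, and so it is inherited by
  arbitrary suprema of filters.
\<close>

definition converges_to_integral ::
  "'a measure \<Rightarrow> enat \<Rightarrow> (nat \<Rightarrow> 'a set) \<Rightarrow> ('a \<Rightarrow> real) \<Rightarrow> 'a set filter \<Rightarrow> bool" where
  "converges_to_integral M \<alpha> P w G \<longleftrightarrow>
     (\<forall>f. integrable M f \<longrightarrow> (block_sum \<alpha> P (\<lambda>x. f x * w x) \<longlongrightarrow> (\<integral>x. f x \<partial>M)) G)"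

lemma represents_integral_iff:
  "G \<noteq> bot \<Longrightarrow> represents_integral M \<alpha> P w G \<longleftrightarrow> converges_to_integral M \<alpha> P w G"
  by (simp add: represents_integral_def converges_to_integral_def weighted_integral_eq
      has_st_iff_tendsto)

locale partitioned_space =
  fixes M :: "'a measure" and \<alpha> :: enat and P :: "nat \<Rightarrow> 'a set"
  assumes partition: "countable_partition (space M) \<alpha> P"
begin

definition block_index :: "'a \<Rightarrow> nat" where
  "block_index x = (THE i. enat i < \<alpha> \<and> x \<in> P i)"

abbreviation block :: "'a \<Rightarrow> 'a set" where
  "block x \<equiv> P (block_index x)"

text \<open>
  These are the blocks whose weight has to be their measure.  All other blocks are going to be null
  sets, of weight 0, or singletons.
\<close>

definition heavy :: "nat set" where
  "heavy = {i. enat i < \<alpha> \<and> P i \<in> sets M \<and> emeasure M (P i) > 0}"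

definition heavy_part :: "'a set" where
  "heavy_part = (\<Union>i\<in>heavy. P i)"

lemma block_index_eq: "enat i < \<alpha> \<Longrightarrow> x \<in> P i \<Longrightarrow> block_index x = i"
  unfolding block_index_def
  by (rule the_equality)
    (use partition in \<open>auto simp: countable_partition_def disjoint_family_on_def\<close>)

lemma block_subset_space: "enat i < \<alpha> \<Longrightarrow> P i \<subseteq> space M"
  using partition by (auto simp: countable_partition_def)

lemma block_index_less: "x \<in> space M \<Longrightarrow> enat (block_index x) < \<alpha>"
  and mem_block: "x \<in> space M \<Longrightarrow> x \<in> block x"
proof -
  assume "x \<in> space M"
  then obtain i where "enat i < \<alpha>" "x \<in> P i"
    using partition by (auto simp: countable_partition_def)
  then show "enat (block_index x) < \<alpha>" "x \<in> block x" by (simp_all add: block_index_eq)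
qed

lemma mem_block_iff: "x \<in> space M \<Longrightarrow> enat i < \<alpha> \<Longrightarrow> x \<in> P i \<longleftrightarrow> block_index x = i"
  using block_index_eq mem_block by blast

lemma heavyD: "i \<in> heavy \<Longrightarrow> enat i < \<alpha>" "i \<in> heavy \<Longrightarrow> P i \<in> sets M"
  "i \<in> heavy \<Longrightarrow> emeasure M (P i) > 0"
  by (auto simp: heavy_def)

lemma heavy_part_sets [measurable]: "heavy_part \<in> sets M"
  unfolding heavy_part_def by (intro sets.countable_UN') (auto simp: heavyD)

lemma heavy_part_subset: "heavy_part \<subseteq> space M"
  by (rule sets.sets_into_space) simp

lemma mem_heavy_part_iff: "x \<in> space M \<Longrightarrow> x \<in> heavy_part \<longleftrightarrow> block_index x \<in> heavy"
  unfolding heavy_part_def using mem_block_iff heavyD(1) mem_block by blast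

text \<open>
  As a single sum over the points of \<open>z\<close>, a block sum is visibly linear and monotone in \<open>f\<close>.
\<close>

lemma block_sum_eq:
  assumes z: "z \<in> Fpow (space M)"
  shows "block_sum \<alpha> P f z = (\<Sum>x\<in>z. f x / real (card (z \<inter> block x)))"
proof -
  have z: "finite z" "\<And>x. x \<in> z \<Longrightarrow> x \<in> space M" using z by (auto simp: Fpow_def)
  have "{i. enat i < \<alpha> \<and> z \<inter> P i \<noteq> {}} = block_index ` z"
    using block_index_less[OF z(2)] mem_block[OF z(2)] block_index_eq by blast
  moreover have "z \<inter> P (block_index y) = {x \<in> z. block_index x = block_index y}" if "y \<in> z" for y
    using z(2) that by (auto simp: mem_block_iff block_index_less)
  ultimately have "block_sum \<alpha> P f z =
      (\<Sum>i\<in>block_index ` z. \<Sum>x | x \<in> z \<and> block_index x = i. f x / real (card (z \<inter> block x)))"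
    unfolding block_sum_def by (intro sum.cong) auto
  also have "\<dots> = (\<Sum>x\<in>z. f x / real (card (z \<inter> block x)))"
    using sum.image_gen[OF z(1)] by (rule sym)
  finally show ?thesis .
qed

lemma block_sum_add: "z \<in> Fpow (space M) \<Longrightarrow>
    block_sum \<alpha> P (\<lambda>x. f x + g x) z = block_sum \<alpha> P f z + block_sum \<alpha> P g z"
  by (simp add: block_sum_eq add_divide_distrib sum.distrib)

lemma block_sum_diff: "z \<in> Fpow (space M) \<Longrightarrow>
    block_sum \<alpha> P (\<lambda>x. f x - g x) z = block_sum \<alpha> P f z - block_sum \<alpha> P g z"
  by (simp add: block_sum_eq diff_divide_distrib sum_subtractf)

lemma block_sum_scale: "z \<in> Fpow (space M) \<Longrightarrow>
    block_sum \<alpha> P (\<lambda>x. c * f x) z = c * block_sum \<alpha> P f z"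
  by (simp add: block_sum_eq sum_distrib_left)

lemma block_sum_mono: "z \<in> Fpow (space M) \<Longrightarrow> (\<And>x. x \<in> z \<Longrightarrow> f x \<le> g x) \<Longrightarrow>
    block_sum \<alpha> P f z \<le> block_sum \<alpha> P g z"
  by (simp add: block_sum_eq sum_mono divide_right_mono)

text \<open>
  A test \<open>(V, C)\<close> stands for the function that is \<open>V / C j\<close> on the heavy block \<open>P j\<close>.  The
  denominators make it possible to round a real function up to a test with total error
  \<open>\<Sum>j. 1 / C j\<close>, even if there are infinitely many blocks.
\<close>

definition valid_test :: "('a \<Rightarrow> nat) \<Rightarrow> (nat \<Rightarrow> nat) \<Rightarrow> bool" where
  "valid_test V C \<longleftrightarrow> (\<forall>j. C j > 0) \<and> (\<forall>j\<in>heavy. \<forall>k. {x \<in> P j. V x = k} \<in> sets M)"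

text \<open>
  With \<open>\<nu>\<close> the measure, these are the partial sums of the means of a test over the heavy
  blocks; with \<open>\<nu>\<close> the number of points in \<open>z\<close>, they are partial sums of the block sum at \<open>z\<close>.  The weights
  have cancelled, and the same finite expression describes both sides.
\<close>

definition test_sum :: "('a set \<Rightarrow> real) \<Rightarrow> ('a \<Rightarrow> nat) \<Rightarrow> (nat \<Rightarrow> nat) \<Rightarrow> nat \<Rightarrow> real" where
  "test_sum \<nu> V C n =
     (\<Sum>j\<in>heavy \<inter> {..<n}. \<Sum>k<n. real k / real (C j) * (\<nu> {x \<in> P j. V x = k} / \<nu> (P j)))"

abbreviation count_in :: "'a set \<Rightarrow> 'a set \<Rightarrow> real" where
  "count_in z A \<equiv> real (card (z \<inter> A))"

definition heavy_test :: "('a \<Rightarrow> nat) \<Rightarrow> (nat \<Rightarrow> nat) \<Rightarrow> 'a \<Rightarrow> real" where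
  "heavy_test V C x = (if x \<in> heavy_part then real (V x) / real (C (block_index x)) else 0)"

lemma heavy_test_nonneg: "heavy_test V C x \<ge> 0"
  by (simp add: heavy_test_def)

lemma test_sum_count_eq:
  assumes z: "z \<in> Fpow (space M)"
  shows "test_sum (count_in z) V C n =
    (\<Sum>x | x \<in> z \<and> x \<in> heavy_part \<and> block_index x < n \<and> V x < n.
       heavy_test V C x / real (card (z \<inter> block x)))"
    (is "_ = sum ?g ?Z")
proof -
  have z: "finite z" "\<And>x. x \<in> z \<Longrightarrow> x \<in> space M" using z by (auto simp: Fpow_def)
  have inner: "(\<Sum>k<n. real k / real (C j) * (count_in z {x \<in> P j. V x = k} / count_in z (P j))) =
      (\<Sum>x | x \<in> ?Z \<and> block_index x = j. ?g x)" if j: "j \<in> heavy \<inter> {..<n}" for j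
  proof -
    have eq: "{x \<in> ?Z. block_index x = j} = {x \<in> z \<inter> P j. V x < n}"
      using j z(2) by (auto simp: mem_heavy_part_iff mem_block_iff heavyD)
    have "(\<Sum>x | x \<in> ?Z \<and> block_index x = j. ?g x) =
        (\<Sum>x\<in>{x \<in> z \<inter> P j. V x < n}. real (V x) / real (C j) / count_in z (P j))"
      unfolding eq[symmetric] by (rule sum.cong) (auto simp: heavy_test_def)
    also have "\<dots> = (\<Sum>k<n. \<Sum>x\<in>{x \<in> {x \<in> z \<inter> P j. V x < n}. V x = k}.
        real (V x) / real (C j) / count_in z (P j))"
      by (rule sum.group[symmetric]) (use z in auto)
    also have "\<dots> = (\<Sum>k<n. \<Sum>x\<in>z \<inter> {x \<in> P j. V x = k}. real k / real (C j) / count_in z (P j))"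
      by (intro sum.cong) auto
    also have "\<dots> = (\<Sum>k<n. real k / real (C j) * (count_in z {x \<in> P j. V x = k} / count_in z (P j)))"
      by (intro sum.cong) auto
    finally show ?thesis by (rule sym)
  qed
  have "test_sum (count_in z) V C n = (\<Sum>j\<in>heavy \<inter> {..<n}. \<Sum>x | x \<in> ?Z \<and> block_index x = j. ?g x)"
    unfolding test_sum_def by (intro sum.cong refl inner)
  also have "\<dots> = sum ?g ?Z"
    by (rule sum.group) (use z in \<open>auto simp: mem_heavy_part_iff\<close>)
  finally show ?thesis .
qed

text \<open>
  The partial sums are eventually equal to the block sum, since \<open>z\<close> meets finitely many blocks and \<open>V\<close>
  is bounded on \<open>z\<close>.
\<close>

lemma test_sum_count_le_iff:
  assumes z: "z \<in> Fpow (space M)"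
  shows "(\<forall>n. test_sum (count_in z) V C n \<le> b) \<longleftrightarrow> block_sum \<alpha> P (heavy_test V C) z \<le> b"
proof -
  have fin: "finite z" using z by (auto simp: Fpow_def)
  have le: "test_sum (count_in z) V C n \<le> block_sum \<alpha> P (heavy_test V C) z" for n
    unfolding test_sum_count_eq[OF z] block_sum_eq[OF z]
    by (rule sum_mono2) (use fin in \<open>auto simp: heavy_test_nonneg\<close>)
  define n where "n = Suc (Max (insert 0 (block_index ` z \<union> V ` z)))"
  have n: "block_index x < n" "V x < n" if "x \<in> z" for x
    unfolding n_def less_Suc_eq_le by (rule Max_ge; simp add: fin that)+
  have "test_sum (count_in z) V C n = block_sum \<alpha> P (heavy_test V C) z"
    unfolding test_sum_count_eq[OF z] block_sum_eq[OF z]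
    by (rule sum.mono_neutral_left) (use fin n in \<open>auto simp: heavy_test_def\<close>)
  then have "block_sum \<alpha> P (heavy_test V C) z \<le> b" if "\<forall>n. test_sum (count_in z) V C n \<le> b"
    using that[rule_format, of n] by simp
  then show ?thesis using order_trans[OF le] by blast
qed

end


section \<open>Representing the integral by one-sided bounds on tests\<close>

context partitioned_space
begin

definition exactly_weighed :: "('a \<Rightarrow> real) \<Rightarrow> 'a set \<Rightarrow> bool" where
  "exactly_weighed w A \<longleftrightarrow> A \<in> sets M \<and> emeasure M A < \<infinity> \<and>
     (\<exists>s\<in>Fpow (space M). \<forall>z\<in>Fpow (space M). s \<subseteq> z \<longrightarrow>
        block_sum \<alpha> P (\<lambda>x. indicator A x * w x) z = measure M A)"

end

text \<open>
  The properties of a partition and its weights that make the block sums approximate integrals.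
  Condition \<open>heavy_rich\<close> leaves room for sampling: a finite set of positive measure would get lost among
  the points of an infinite block.  Conditions \<open>light_bound\<close> and \<open>exhaustion\<close> take care of the points
  outside of the heavy blocks, whose blocks need not be measurable: the first bounds their
  contribution from above, and the second gives sets of finite measure on which an upper
  bound for one function can be turned into a lower bound for another.
\<close>

locale adapted_partition = partitioned_space M \<alpha> P
  for M :: "'a measure" and \<alpha> P +
  fixes w :: "'a \<Rightarrow> real"
  assumes weight_nonneg: "w x \<ge> 0"
    and heavy_finite: "i \<in> heavy \<Longrightarrow> emeasure M (P i) < \<infinity>"
    and heavy_weight: "i \<in> heavy \<Longrightarrow> x \<in> P i \<Longrightarrow> w x = measure M (P i)"
    and heavy_rich: "i \<in> heavy \<Longrightarrow>
      is_singleton (P i) \<or> (\<forall>A\<in>sets M. A \<subseteq> P i \<and> emeasure M A > 0 \<longrightarrow> infinite A)"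
    and light_bound: "z \<in> Fpow (space M) \<Longrightarrow> integrable M h \<Longrightarrow> (\<And>x. h x \<ge> 0) \<Longrightarrow>
      block_sum \<alpha> P (\<lambda>x. indicator (space M - heavy_part) x * h x * w x) z
        \<le> (\<integral>x. indicator (space M - heavy_part) x * h x \<partial>M)"
    and exhaustion: "\<exists>E. incseq E \<and> (\<Union>n. E n) = space M \<and> (\<forall>n. exactly_weighed w (E n))"
begin

lemma heavy_measure_pos: "i \<in> heavy \<Longrightarrow> measure M (P i) > 0"
  using heavyD(3) heavy_finite by (simp add: measure_def enn2real_positive_iff)

lemma heavy_sub_finite: "i \<in> heavy \<Longrightarrow> A \<subseteq> P i \<Longrightarrow> emeasure M A < \<infinity>"
  using heavy_finite emeasure_mono[of A "P i" M] heavyD(2) le_less_trans by blast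

definition bounds_tests :: "'a set filter \<Rightarrow> bool" where
  "bounds_tests G \<longleftrightarrow> (\<forall>V C b. valid_test V C \<and> b < 1 \<and> (\<forall>n. test_sum (measure M) V C n \<le> b) \<longrightarrow>
     (\<forall>\<^sub>F z in G. \<forall>n. test_sum (count_in z) V C n \<le> 1))"

text \<open>
  Fineness without properness.
\<close>

definition covering :: "'a set filter \<Rightarrow> bool" where
  "covering G \<longleftrightarrow> G \<le> principal (Fpow (space M)) \<and> (\<forall>x\<in>space M. \<forall>\<^sub>F z in G. x \<in> z)"

lemma covering_Fpow: "covering G \<Longrightarrow> \<forall>\<^sub>F z in G. z \<in> Fpow (space M)"
  by (simp add: covering_def le_principal)

lemma covering_superset:
  assumes "covering G" "s \<in> Fpow (space M)"
  shows "\<forall>\<^sub>F z in G. s \<subseteq> z"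
proof -
  have "\<forall>\<^sub>F z in G. \<forall>x\<in>s. x \<in> z"
    using assms by (intro eventually_ball_finite) (auto simp: covering_def Fpow_def)
  then show ?thesis by (rule eventually_mono) blast
qed

definition test_density :: "('a \<Rightarrow> nat) \<Rightarrow> (nat \<Rightarrow> nat) \<Rightarrow> 'a \<Rightarrow> real" where
  "test_density V C x = heavy_test V C x / w x"

lemma weight_heavy_part: "x \<in> heavy_part \<Longrightarrow> w x = measure M (block x)"
  and weight_heavy_part_pos: "x \<in> heavy_part \<Longrightarrow> w x > 0"
  using mem_heavy_part_iff heavy_weight mem_block heavy_measure_pos heavy_part_subset
  by (metis subsetD)+

lemma test_density_weight: "test_density V C x * w x = heavy_test V C x"
  using weight_heavy_part_pos[of x] by (auto simp: test_density_def heavy_test_def)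

lemma has_bochner_integral_level_set:
  assumes "valid_test V C" "j \<in> heavy"
  shows "has_bochner_integral M (\<lambda>x. c * indicator {x \<in> P j. V x = k} x) (c * measure M {x \<in> P j. V x = k})"
proof -
  have "{x \<in> P j. V x = k} \<in> sets M" using assms by (simp add: valid_test_def)
  moreover have "emeasure M {x \<in> P j. V x = k} < \<infinity>" by (rule heavy_sub_finite[OF assms(2)]) auto
  ultimately have "has_bochner_integral M (indicator {x \<in> P j. V x = k} :: 'a \<Rightarrow> real)
      (measure M {x \<in> P j. V x = k})"
    by (intro has_bochner_integral_real_indicator)
  then show ?thesis by (rule has_bochner_integral_mult_right)
qed

text \<open>
  The partial sums \<open>test_sum\<close> are the integrals of truncations of the test density, so this is monotone
  convergence.
\<close>

lemma test_density_integral: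
  assumes valid: "valid_test V C" and b: "\<And>n. test_sum (measure M) V C n \<le> b"
  shows "integrable M (test_density V C) \<and> (\<integral>x. test_density V C x \<partial>M) \<le> b"
proof -
  define F where "F n x = (\<Sum>j\<in>heavy \<inter> {..<n}. \<Sum>k<n.
      real k / (real (C j) * measure M (P j)) * indicator {x \<in> P j. V x = k} x)" for n x
  have F_int: "has_bochner_integral M (F n) (test_sum (measure M) V C n)" for n
  proof -
    have "has_bochner_integral M (F n) (\<Sum>j\<in>heavy \<inter> {..<n}. \<Sum>k<n.
      real k / (real (C j) * measure M (P j)) * measure M {x \<in> P j. V x = k})"
      unfolding F_def
      by (intro has_bochner_integral_sum has_bochner_integral_level_set[OF valid]) auto
    then show ?thesis by (simp add: test_sum_def)
  qed
  have F_eq: "F n x = (if block_index x < n \<and> V x < n then test_density V C x else 0)"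
    if x: "x \<in> space M" for n x
  proof -
    have "F n x = (\<Sum>j\<in>heavy \<inter> {..<n}. \<Sum>k<n. if k = V x then if j = block_index x then
        real k / (real (C j) * measure M (P j)) else 0 else 0)"
      unfolding F_def
      by (intro sum.cong refl) (auto simp: indicator_def mem_block_iff[OF x] heavyD)
    also have "\<dots> = (\<Sum>j\<in>heavy \<inter> {..<n}. if j = block_index x then
        if V x < n then real (V x) / (real (C j) * measure M (P j)) else 0 else 0)"
      by (intro sum.cong refl) (auto simp: sum.delta)
    also have "\<dots> = (if block_index x < n \<and> V x < n then test_density V C x else 0)"
      by (auto simp: sum.delta test_density_def heavy_test_def mem_heavy_part_iff[OF x]
          weight_heavy_part)
    finally show ?thesis .
  qed
  have nonneg: "test_density V C x \<ge> 0" for x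
    by (simp add: test_density_def heavy_test_nonneg weight_nonneg)
  have mono: "mono (\<lambda>n. F n x)" if "x \<in> space M" for x
    by (rule monoI) (auto simp: F_eq[OF that] nonneg)
  have lim: "(\<lambda>n. F n x) \<longlonglongrightarrow> test_density V C x" if "x \<in> space M" for x
  proof (rule tendsto_eventually)
    show "\<forall>\<^sub>F n in sequentially. F n x = test_density V C x"
      using eventually_gt_at_top[of "max (block_index x) (V x)"]
      by eventually_elim (simp add: F_eq[OF that])
  qed
  have "incseq (\<lambda>n. test_sum (measure M) V C n)"
  proof (rule monoI)
    fix m n :: nat assume "m \<le> n"
    then have "integral\<^sup>L M (F m) \<le> integral\<^sup>L M (F n)"
      using F_int monoD[OF mono] by (intro integral_mono) (auto simp: has_bochner_integral_iff)
    then show "test_sum (measure M) V C m \<le> test_sum (measure M) V C n"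
      using F_int by (simp add: has_bochner_integral_iff)
  qed
  then obtain L where L: "(\<lambda>n. test_sum (measure M) V C n) \<longlonglongrightarrow> L" "\<And>n. test_sum (measure M) V C n \<le> L"
    using incseq_convergent[of "\<lambda>n. test_sum (measure M) V C n" b] b by blast
  have "L \<le> b" using L(1) b by (intro LIMSEQ_le_const2) auto
  have meas: "test_density V C \<in> borel_measurable M"
    by (rule borel_measurable_LIMSEQ_real[of M F])
      (use lim F_int in \<open>auto simp: has_bochner_integral_iff\<close>)
  have *: "integrable M (F n)" "AE x in M. mono (\<lambda>n. F n x)"
    "AE x in M. (\<lambda>n. F n x) \<longlonglongrightarrow> test_density V C x" "(\<lambda>n. integral\<^sup>L M (F n)) \<longlonglongrightarrow> L" for n
    using F_int mono lim L(1) by (auto simp: has_bochner_integral_iff)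
  show ?thesis
    using integrable_monotone_convergence[OF * meas] integral_monotone_convergence[OF * meas] \<open>L \<le> b\<close>
    by simp
qed

text \<open>
  The test density is integrable with integral at most \<open>b\<close>, and its block sum is the one of the test.
\<close>

lemma tests_bounded_of_convergence:
  assumes G: "covering G" "converges_to_integral M \<alpha> P w G"
    and valid: "valid_test V C" and b: "\<And>n. test_sum (measure M) V C n \<le> b" and "b < b'"
  shows "\<forall>\<^sub>F z in G. \<forall>n. test_sum (count_in z) V C n \<le> b'"
proof -
  note int = test_density_integral[OF valid b]
  have "(block_sum \<alpha> P (heavy_test V C) \<longlongrightarrow> (\<integral>x. test_density V C x \<partial>M)) G"
    using G(2) int unfolding converges_to_integral_def by (metis (no_types, lifting) ext test_density_weight)
  then have "\<forall>\<^sub>F z in G. block_sum \<alpha> P (heavy_test V C) z < b'"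
    by (rule order_tendstoD) (use int \<open>b < b'\<close> in auto)
  then show ?thesis
    using covering_Fpow[OF G(1)] by eventually_elim (auto simp: test_sum_count_le_iff)
qed

text \<open>
  On the heavy blocks, \<open>h\<close> is scaled to have integral less than 1 and multiplied by its weight; then it is
  rounded up to a test.  The gap \<open>\<delta>\<close> below 1 pays for the rounding.
\<close>

lemma eventually_block_sum_le:
  assumes G: "covering G" "bounds_tests G"
    and h: "integrable M h" "\<And>x. h x \<ge> 0" and K: "(\<integral>x. h x \<partial>M) < K"
  shows "\<forall>\<^sub>F z in G. block_sum \<alpha> P (\<lambda>x. h x * w x) z \<le> K"
proof -
  define H where "H = (\<integral>x. indicator heavy_part x * h x \<partial>M)"
  define L where "L = (\<integral>x. indicator (space M - heavy_part) x * h x \<partial>M)"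
  have int: "integrable M (\<lambda>x. indicator A x * h x)" if "A \<in> sets M" for A
    using integrable_mult_indicator[OF that h(1)] by simp
  have "H + L = (\<integral>x. h x \<partial>M)"
    unfolding H_def L_def
    by (subst Bochner_Integration.integral_add[symmetric])
      (auto intro!: int Bochner_Integration.integral_cong split: split_indicator)
  define K' where "K' = K - L"
  have "H \<ge> 0" unfolding H_def using h(2) by (intro integral_nonneg_AE) simp
  have HK: "H < K'" using K \<open>H + L = _\<close> by (simp add: K'_def)
  with \<open>H \<ge> 0\<close> have "K' > 0" by simp
  define \<delta> where "\<delta> = 1 - H / K'"
  have "\<delta> > 0" using HK \<open>K' > 0\<close> by (simp add: \<delta>_def)
  \<comment> \<open>The choice makes the sum of all \<open>1 / C j\<close> at most \<open>\<delta> / 2\<close>.\<close>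
  define C where "C j = nat \<lceil>2 ^ (j + 2) / \<delta>\<rceil>" for j :: nat
  \<comment> \<open>On the block \<open>P j\<close>, the quotient \<open>V / C j\<close> exceeds the scaled \<open>h * w\<close> by at most \<open>1 / C j\<close>.\<close>
  define V where "V x = nat \<lceil>h x / K' * w x * real (C (block_index x))\<rceil>" for x
  have C_ge: "real (C j) \<ge> 2 ^ (j + 2) / \<delta>" for j
    unfolding C_def by (rule real_nat_ceiling_ge)
  have C_pos: "C j > 0" for j
    using C_ge[of j] \<open>\<delta> > 0\<close> by (metis divide_pos_pos gr0I leD of_nat_0 zero_less_numeral zero_less_power)
  have V_ge: "real (V x) \<ge> h x / K' * w x * real (C (block_index x))" for x
    unfolding V_def by (rule real_nat_ceiling_ge)
  have V_le: "real (V x) \<le> h x / K' * w x * real (C (block_index x)) + 1" for x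
    unfolding V_def
  proof -
    let ?r = "h x / K' * w x * real (C (block_index x))"
    have "?r \<ge> 0" using h(2) \<open>K' > 0\<close> weight_nonneg by simp
    then show "real (nat \<lceil>?r\<rceil>) \<le> ?r + 1" by linarith
  qed
  have valid: "valid_test V C"
    unfolding valid_test_def
  proof (intro conjI allI ballI)
    fix j k assume j: "j \<in> heavy"
    have [measurable]: "h \<in> borel_measurable M" "P j \<in> sets M" using h(1) heavyD(2)[OF j] by auto
    have "{x \<in> P j. V x = k} = P j \<inter> {x \<in> space M. nat \<lceil>h x / K' * measure M (P j) * real (C j)\<rceil> = k}"
      using heavyD[OF j] block_subset_space heavy_weight[OF j] by (auto simp: V_def block_index_eq)
    also have "\<dots> \<in> sets M" by measurable
    finally show "{x \<in> P j. V x = k} \<in> sets M" .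
  qed (rule C_pos)
  have inner: "(\<Sum>k<n. real k / real (C j) * (measure M {x \<in> P j. V x = k} / measure M (P j)))
      \<le> (\<integral>x. indicator (P j) x * (h x / K') \<partial>M) + 1 / real (C j)" if j: "j \<in> heavy" for j n
  proof -
    let ?m = "measure M (P j)"
    have m: "?m > 0" by (rule heavy_measure_pos[OF j])
    have int1: "has_bochner_integral M (\<lambda>x. \<Sum>k<n. real k * indicator {x \<in> P j. V x = k} x)
        (\<Sum>k<n. real k * measure M {x \<in> P j. V x = k})"
      by (intro has_bochner_integral_sum has_bochner_integral_level_set[OF valid j])
    have int2: "integrable M (\<lambda>x. indicator (P j) x * (h x / K'))"
      using integrable_mult_indicator[OF heavyD(2)[OF j] Bochner_Integration.integrable_divide[OF h(1), of K']] by simp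
    have int3: "integrable M (indicator (P j) :: 'a \<Rightarrow> real)"
      using heavyD(2)[OF j] heavy_finite[OF j] by simp
    have "(\<Sum>k<n. real k * measure M {x \<in> P j. V x = k}) =
        (\<integral>x. (\<Sum>k<n. real k * indicator {x \<in> P j. V x = k} x) \<partial>M)"
      using int1 by (simp add: has_bochner_integral_iff)
    also have "\<dots> \<le> (\<integral>x. ?m * real (C j) * (indicator (P j) x * (h x / K')) + indicator (P j) x \<partial>M)"
    proof (rule integral_mono)
      fix x assume x: "x \<in> space M"
      have "(\<Sum>k<n. real k * indicator {x \<in> P j. V x = k} x) =
          (\<Sum>k<n. if k = V x then indicator (P j) x * real k else 0)"
        by (intro sum.cong) (auto simp: indicator_def)
      also have "\<dots> \<le> indicator (P j) x * real (V x)"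
        by (simp add: sum.delta)
      also have "\<dots> \<le> ?m * real (C j) * (indicator (P j) x * (h x / K')) + indicator (P j) x"
        using V_le[of x] heavy_weight[OF j] heavyD[OF j]
        by (auto simp: indicator_def block_index_eq mult_ac)
      finally show "(\<Sum>k<n. real k * indicator {x \<in> P j. V x = k} x) \<le> \<dots>" .
    next
      show "integrable M (\<lambda>x. \<Sum>k<n. real k * indicator {x \<in> P j. V x = k} x)"
        using int1 by (rule integrable.intros)
      show "integrable M (\<lambda>x. ?m * real (C j) * (indicator (P j) x * (h x / K')) + indicator (P j) x)"
        by (intro Bochner_Integration.integrable_add integrable_mult_right int2 int3)
    qed
    also have "\<dots> = ?m * real (C j) * (\<integral>x. indicator (P j) x * (h x / K') \<partial>M) + ?m"
      using heavyD(2)[OF j]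
      by (subst Bochner_Integration.integral_add[OF integrable_mult_right[OF int2] int3])
        (simp only: integral_mult_right_zero, simp)
    finally have "(\<Sum>k<n. real k * measure M {x \<in> P j. V x = k}) / (?m * real (C j))
        \<le> (\<integral>x. indicator (P j) x * (h x / K') \<partial>M) + 1 / real (C j)"
      using m C_pos[of j] by (simp add: field_simps)
    then show ?thesis by (simp add: sum_divide_distrib mult.commute)
  qed
  have bound: "test_sum (measure M) V C n \<le> 1 - \<delta> / 2" for n
  proof -
    have "test_sum (measure M) V C n \<le>
        (\<Sum>j\<in>heavy \<inter> {..<n}. (\<integral>x. indicator (P j) x * (h x / K') \<partial>M) + 1 / real (C j))"
      unfolding test_sum_def by (intro sum_mono inner) auto
    also have "\<dots> = (\<Sum>j\<in>heavy \<inter> {..<n}. (\<integral>x. indicator (P j) x * (h x / K') \<partial>M)) +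
        (\<Sum>j\<in>heavy \<inter> {..<n}. 1 / real (C j))" by (rule sum.distrib)
    also have "(\<Sum>j\<in>heavy \<inter> {..<n}. (\<integral>x. indicator (P j) x * (h x / K') \<partial>M)) \<le> 1 - \<delta>"
    proof -
      have int: "integrable M (\<lambda>x. indicator A x * (h x / K'))" if "A \<in> sets M" for A
        using integrable_mult_indicator[OF that Bochner_Integration.integrable_divide[OF h(1), of K']] by simp
      have "(\<Sum>j\<in>heavy \<inter> {..<n}. (\<integral>x. indicator (P j) x * (h x / K') \<partial>M)) =
          (\<integral>x. (\<Sum>j\<in>heavy \<inter> {..<n}. indicator (P j) x * (h x / K')) \<partial>M)"
        by (rule Bochner_Integration.integral_sum[symmetric]) (rule int, auto simp: heavyD)
      also have "\<dots> \<le> (\<integral>x. indicator heavy_part x * (h x / K') \<partial>M)"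
      proof (rule integral_mono)
        fix x assume x: "x \<in> space M"
        have "(\<Sum>j\<in>heavy \<inter> {..<n}. indicator (P j) x * (h x / K')) =
            (\<Sum>j\<in>heavy \<inter> {..<n}. if j = block_index x then h x / K' else 0)"
          by (intro sum.cong) (auto simp: indicator_def mem_block_iff[OF x] heavyD)
        also have "\<dots> \<le> indicator heavy_part x * (h x / K')"
          using h(2)[of x] \<open>K' > 0\<close> by (auto simp: sum.delta mem_heavy_part_iff[OF x])
        finally show "(\<Sum>j\<in>heavy \<inter> {..<n}. indicator (P j) x * (h x / K')) \<le> \<dots>" .
      next
        show "integrable M (\<lambda>x. indicator heavy_part x * (h x / K'))"
          by (rule int) simp
        show "integrable M (\<lambda>x. \<Sum>j\<in>heavy \<inter> {..<n}. indicator (P j) x * (h x / K'))"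
          by (intro Bochner_Integration.integrable_sum int) (simp add: heavyD)
      qed
      also have "\<dots> = 1 - \<delta>" by (simp add: H_def \<delta>_def)
      finally show ?thesis .
    qed
    also have "(\<Sum>j\<in>heavy \<inter> {..<n}. 1 / real (C j)) \<le> \<delta> / 2"
    proof -
      have "(\<Sum>j\<in>heavy \<inter> {..<n}. 1 / real (C j)) \<le> (\<Sum>j<n. 1 / real (C j))"
        by (rule sum_mono2) auto
      also have "\<dots> \<le> (\<Sum>j<n. \<delta> / 4 * (1 / 2) ^ j)"
      proof (rule sum_mono)
        fix j
        have "1 / real (C j) \<le> 1 / (2 ^ (j + 2) / \<delta>)"
          using C_ge[of j] \<open>\<delta> > 0\<close> by (intro divide_left_mono) (auto simp: C_pos)
        also have "\<dots> = \<delta> / 4 * (1 / 2) ^ j" by (simp add: power_one_over field_simps)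
        finally show "1 / real (C j) \<le> \<dots>" .
      qed
      also have "\<dots> = \<delta> / 4 * (2 - 2 * (1 / 2) ^ n)"
        by (induction n) (simp_all add: algebra_simps)
      also have "\<dots> \<le> \<delta> / 2" using \<open>\<delta> > 0\<close> by (simp add: field_simps)
      finally show ?thesis .
    qed
    finally show ?thesis by simp
  qed
  have "\<forall>\<^sub>F z in G. \<forall>n. test_sum (count_in z) V C n \<le> 1"
  proof -
    have "1 - \<delta> / 2 < 1" using \<open>\<delta> > 0\<close> by simp
    then show ?thesis using G(2) valid bound unfolding bounds_tests_def by blast
  qed
  then show ?thesis
    using covering_Fpow[OF G(1)]
  proof eventually_elim
    case (elim z)
    have "block_sum \<alpha> P (\<lambda>x. indicator heavy_part x * h x * w x) z \<le>
        block_sum \<alpha> P (\<lambda>x. K' * heavy_test V C x) z"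
    proof (rule block_sum_mono[OF elim(2)])
      fix x assume "x \<in> z"
      show "indicator heavy_part x * h x * w x \<le> K' * heavy_test V C x"
        using V_ge[of x] \<open>K' > 0\<close> C_pos[of "block_index x"]
        by (auto simp: heavy_test_def indicator_def field_simps)
    qed
    also have "\<dots> \<le> K' * 1"
      unfolding block_sum_scale[OF elim(2)]
      using elim \<open>K' > 0\<close> by (intro mult_left_mono) (auto simp: test_sum_count_le_iff)
    finally have "block_sum \<alpha> P (\<lambda>x. indicator heavy_part x * h x * w x) z \<le> K'" by simp
    moreover have "block_sum \<alpha> P (\<lambda>x. indicator (space M - heavy_part) x * h x * w x) z \<le> L"
      unfolding L_def by (rule light_bound[OF elim(2) h])
    moreover have "block_sum \<alpha> P (\<lambda>x. h x * w x) z =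
        block_sum \<alpha> P (\<lambda>x. indicator heavy_part x * h x * w x +
          indicator (space M - heavy_part) x * h x * w x) z"
      using elim(2) unfolding block_sum_eq[OF elim(2)]
      by (intro sum.cong) (auto simp: indicator_def Fpow_def)
    ultimately show ?case by (simp add: block_sum_add[OF elim(2)] K'_def)
  qed
qed

text \<open>
  Upper bounds for nonnegative functions are \<open>eventually_block_sum_le\<close>.  For a lower bound, apply them
  to \<open>g = n - min f n\<close> on a set \<open>E n\<close> of finite measure whose block sum is eventually exact.
\<close>

lemma converges_of_bounds_tests:
  assumes G: "covering G" "bounds_tests G"
  shows "converges_to_integral M \<alpha> P w G"
proof -
  let ?S = "\<lambda>f. block_sum \<alpha> P (\<lambda>x. f x * w x)"
  have Fpow: "\<forall>\<^sub>F z in G. z \<in> Fpow (space M)" by (rule covering_Fpow[OF G(1)])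
  have nonneg: "(?S f \<longlongrightarrow> (\<integral>x. f x \<partial>M)) G" if f: "integrable M f" "\<And>x. f x \<ge> 0" for f
  proof (rule order_tendstoI)
    fix a assume "(\<integral>x. f x \<partial>M) < a"
    then obtain b where b: "(\<integral>x. f x \<partial>M) < b" "b < a" using dense by blast
    show "\<forall>\<^sub>F z in G. ?S f z < a"
      using eventually_block_sum_le[OF G f b(1)] by eventually_elim (use b(2) in simp)
  next
    fix a assume a: "a < (\<integral>x. f x \<partial>M)"
    obtain E where E: "incseq E" "(\<Union>n. E n) = space M" "\<And>n. exactly_weighed w (E n)"
      using exhaustion by metis
    note E_fin = E(3)[unfolded exactly_weighed_def, THEN conjunct1]
      E(3)[unfolded exactly_weighed_def, THEN conjunct2, THEN conjunct1]
    have [measurable]: "f \<in> borel_measurable M" "E n \<in> sets M" for n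
      using f(1) E_fin(1) by auto
    define F where "F n x = min (f x) (real n) * indicator (E n) x" for n x
    have F_le: "F n x \<le> f x" for n x
      using f(2)[of x] by (auto simp: F_def indicator_def)
    have F_nonneg: "F n x \<ge> 0" for n x
      using f(2)[of x] by (auto simp: F_def indicator_def)
    have [measurable]: "F n \<in> borel_measurable M" for n unfolding F_def by measurable
    have F_int: "integrable M (F n)" for n
      by (rule Bochner_Integration.integrable_bound[OF f(1)])
        (use F_le F_nonneg f(2) in auto)
    have "(\<lambda>n. integral\<^sup>L M (F n)) \<longlonglongrightarrow> (\<integral>x. f x \<partial>M)"
    proof (rule integral_dominated_convergence[where w = f])
      show "AE x in M. (\<lambda>n. F n x) \<longlonglongrightarrow> f x"
      proof (rule AE_I2, rule tendsto_eventually)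
        fix x assume "x \<in> space M"
        then obtain m where m: "x \<in> E m" using E(2) by blast
        obtain k where k: "f x \<le> real k" using real_arch_simple by blast
        show "\<forall>\<^sub>F n in sequentially. F n x = f x"
          using eventually_ge_at_top[of "max m k"]
        proof eventually_elim
          case (elim n)
          then have "x \<in> E n" using m E(1) by (auto simp: incseq_def)
          moreover have "f x \<le> real n" using k elim by linarith
          ultimately show ?case by (simp add: F_def)
        qed
      qed
    qed (use f F_le F_nonneg in auto)
    then have "\<forall>\<^sub>F n in sequentially. a < integral\<^sup>L M (F n)"
      using a by (rule order_tendstoD)
    then obtain n where "a < integral\<^sup>L M (F n)"
      using eventually_happens'[OF sequentially_bot] by blast
    then obtain b where b: "a < b" "b < integral\<^sup>L M (F n)" using dense by blast
    define g where "g x = real n * indicator (E n) x - F n x" for x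
    have g_nonneg: "g x \<ge> 0" for x
      by (auto simp: g_def F_def indicator_def)
    have E_int: "integrable M (\<lambda>x. real n * indicator (E n) x :: real)"
      using E_fin by simp
    have g_int: "integrable M g"
      unfolding g_def by (intro Bochner_Integration.integrable_diff E_int F_int)
    have "integral\<^sup>L M g = real n * measure M (E n) - integral\<^sup>L M (F n)"
      unfolding g_def using E_fin(1) by (subst Bochner_Integration.integral_diff[OF E_int F_int]) simp
    then have K: "integral\<^sup>L M g < real n * measure M (E n) - b"
      using b by simp
    obtain s where s: "s \<in> Fpow (space M)" "\<And>z. z \<in> Fpow (space M) \<Longrightarrow> s \<subseteq> z \<Longrightarrow>
           block_sum \<alpha> P (\<lambda>x. indicator (E n) x * w x) z = measure M (E n)"
      using E(3)[of n] unfolding exactly_weighed_def by metis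
    show "\<forall>\<^sub>F z in G. a < ?S f z"
      using eventually_block_sum_le[OF G g_int g_nonneg K] covering_superset[OF G(1) s(1)] Fpow
    proof eventually_elim
      case (elim z)
      have "real n * measure M (E n) = block_sum \<alpha> P (\<lambda>x. real n * (indicator (E n) x * w x)) z"
        using s(2)[OF elim(3,2)] by (simp add: block_sum_scale[OF elim(3)])
      also have "\<dots> = block_sum \<alpha> P (\<lambda>x. g x * w x + F n x * w x) z"
        by (simp add: g_def algebra_simps)
      also have "\<dots> = ?S g z + ?S (F n) z" by (rule block_sum_add[OF elim(3)])
      also have "\<dots> \<le> ?S g z + ?S f z"
        by (intro add_left_mono block_sum_mono[OF elim(3)] mult_right_mono F_le weight_nonneg)
      finally show ?case using elim(1) b(1) by linarith
    qed
  qed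
  show ?thesis
    unfolding converges_to_integral_def
  proof (intro allI impI)
    fix f :: "'a \<Rightarrow> real" assume f: "integrable M f"
    have int: "integrable M (\<lambda>x. max 0 (f x))" "integrable M (\<lambda>x. max 0 (- f x))"
      using f by auto
    have "((\<lambda>z. ?S (\<lambda>x. max 0 (f x)) z - ?S (\<lambda>x. max 0 (- f x)) z) \<longlongrightarrow>
        (\<integral>x. max 0 (f x) \<partial>M) - (\<integral>x. max 0 (- f x) \<partial>M)) G"
      by (intro tendsto_diff nonneg int) auto
    moreover have "(\<integral>x. max 0 (f x) \<partial>M) - (\<integral>x. max 0 (- f x) \<partial>M) = (\<integral>x. f x \<partial>M)"
      by (subst Bochner_Integration.integral_diff[OF int, symmetric])
        (auto intro!: Bochner_Integration.integral_cong)
    moreover have "\<forall>\<^sub>F z in G. ?S (\<lambda>x. max 0 (f x)) z - ?S (\<lambda>x. max 0 (- f x)) z = ?S f z"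
      using Fpow
    proof eventually_elim
      case (elim z)
      have "f x * w x = max 0 (f x) * w x - max 0 (- f x) * w x" for x
        by (simp add: max_def)
      then show ?case by (simp add: block_sum_diff[OF elim])
    qed
    ultimately show "(?S f \<longlongrightarrow> (\<integral>x. f x \<partial>M)) G"
      using tendsto_cong by fastforce
  qed
qed

end


section \<open>Sampling: a proper filter that bounds all tests\<close>

lemma sample_disjoint_cells:
  fixes A :: "'u \<Rightarrow> 'a set" and m :: "'u \<Rightarrow> nat"
  assumes fin: "finite U" and disj: "disjoint_family_on A U"
    and inf: "\<And>u. u \<in> U \<Longrightarrow> m u > 0 \<Longrightarrow> infinite (A u)"
  obtains Z where "finite Z" "Z \<subseteq> (\<Union>u\<in>U. A u)" "\<And>u. u \<in> U \<Longrightarrow> card (Z \<inter> A u) = m u"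
proof -
  have "\<exists>B. finite B \<and> card B = m u \<and> B \<subseteq> A u" if "u \<in> U" for u
    using inf[OF that] infinite_arbitrarily_large[of "A u" "m u"]
    by (cases "m u > 0") (auto intro: exI[of _ "{}"])
  then obtain B where B: "\<And>u. u \<in> U \<Longrightarrow> finite (B u)" "\<And>u. u \<in> U \<Longrightarrow> card (B u) = m u"
    "\<And>u. u \<in> U \<Longrightarrow> B u \<subseteq> A u" by metis
  have "(\<Union>u\<in>U. B u) \<inter> A u = B u" if "u \<in> U" for u
    using B(3) disj that unfolding disjoint_family_on_def by fast
  then have "\<And>u. u \<in> U \<Longrightarrow> card ((\<Union>u\<in>U. B u) \<inter> A u) = m u" using B(2) by simp
  moreover have "finite (\<Union>u\<in>U. B u)" using fin B(1) by simp
  moreover have "(\<Union>u\<in>U. B u) \<subseteq> (\<Union>u\<in>U. A u)" using B(3) by blast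
  ultimately show ?thesis using that by blast
qed

lemma sets_Collect_finite_Ball:
  assumes "finite S" "A \<in> sets M" "\<And>i. i \<in> S \<Longrightarrow> {x \<in> A. Q i x} \<in> sets M"
  shows "{x \<in> A. \<forall>i\<in>S. Q i x} \<in> sets M"
  using assms
proof (induction S rule: finite_induct)
  case (insert i S)
  have "{x \<in> A. \<forall>i\<in>insert i S. Q i x} = {x \<in> A. Q i x} \<inter> {x \<in> A. \<forall>i\<in>S. Q i x}" by auto
  then show ?case using insert by simp
qed simp

context adapted_partition
begin

definition block_mean :: "('a \<Rightarrow> nat) \<Rightarrow> nat \<Rightarrow> nat \<Rightarrow> real" where
  "block_mean V j n = (\<Sum>k<n. real k * (measure M {x \<in> P j. V x = k} / measure M (P j)))"

lemma block_mean_mono: "n \<le> n' \<Longrightarrow> block_mean V j n \<le> block_mean V j n'"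
  unfolding block_mean_def by (rule sum_mono2) auto

text \<open>
  The vectors of values of the functions in \<open>\<V>\<close> partition the block into countably many cells.  The
  finitely many cells with all values below some \<open>n\<close> have almost full measure.  A cell of positive measure
  is infinite, so it contains \<open>\<lfloor>N p\<rfloor>\<close> points, where \<open>p\<close> is its share of the measure.  For large \<open>N\<close>, the
  rounding and the prescribed points of \<open>s\<close> become negligible.  A singleton block is its own sample.
\<close>

lemma sample_block:
  assumes j: "j \<in> heavy" and fin: "finite \<V>"
    and meas: "\<And>V k. V \<in> \<V> \<Longrightarrow> {x \<in> P j. V x = k} \<in> sets M"
    and K: "\<And>V n. V \<in> \<V> \<Longrightarrow> block_mean V j n \<le> K"
    and s: "finite s" "s \<subseteq> P j" and \<epsilon>: "\<epsilon> > 0"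
  shows "\<exists>z n. finite z \<and> s \<subseteq> z \<and> z \<subseteq> P j \<and> z \<noteq> {} \<and>
    (\<forall>V\<in>\<V>. (\<Sum>x\<in>z. real (V x)) / real (card z) \<le> block_mean V j n + \<epsilon>)"
proof (cases "is_singleton (P j)")
  case True
  then obtain y where y: "P j = {y}" by (auto simp: is_singleton_def)
  define n where "n = Suc (\<Sum>V\<in>\<V>. V y)"
  have "block_mean V j n = real (V y)" if V: "V \<in> \<V>" for V
  proof -
    have "V y < n" using member_le_sum[OF V, of "\<lambda>V. V y"] fin by (simp add: n_def)
    have "block_mean V j n = (\<Sum>k<n. if k = V y then real k else 0)"
      unfolding block_mean_def
    proof (rule sum.cong[OF refl])
      fix k
      have "{x \<in> P j. V x = k} = (if k = V y then P j else {})" using y by auto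
      then show "real k * (measure M {x \<in> P j. V x = k} / measure M (P j)) =
          (if k = V y then real k else 0)"
        using heavy_measure_pos[OF j] by simp
    qed
    also have "\<dots> = real (V y)" using \<open>V y < n\<close> by (simp add: sum.delta)
    finally show ?thesis .
  qed
  then show ?thesis
    using s y \<epsilon> by (intro exI[of _ "{y}"] exI[of _ n]) auto
next
  case False
  then have rich: "\<And>A. A \<in> sets M \<Longrightarrow> A \<subseteq> P j \<Longrightarrow> emeasure M A > 0 \<Longrightarrow> infinite A"
    using heavy_rich[OF j] by blast
  let ?m = "measure M (P j)"
  have m: "?m > 0" by (rule heavy_measure_pos[OF j])
  have Pj: "P j \<in> sets M" by (rule heavyD(2)[OF j])
  define K' where "K' = max K 1"
  have K': "K' \<ge> 1" "\<And>V n. V \<in> \<V> \<Longrightarrow> block_mean V j n \<le> K'"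
    using K by (auto simp: K'_def max.coboundedI1)
  \<comment> \<open>An upper bound for the share of the measure outside of the cells in use.  Dividing by \<open>1 - \<eta>\<close> must not raise
    a mean, which is at most \<open>K'\<close>, by more than the allowed \<open>\<epsilon>\<close>.\<close>
  define \<eta> where "\<eta> = min (1 / 2) (\<epsilon> / (4 * K'))"
  have \<eta>: "\<eta> > 0" "\<eta> \<le> 1 / 2" "K' * \<eta> \<le> \<epsilon> / 4"
    using \<epsilon> K'(1) by (auto simp: \<eta>_def min_def field_simps)
  define B where "B n = {x \<in> P j. \<forall>V\<in>\<V>. V x < n}" for n
  have less_meas: "{x \<in> P j. V x < n} \<in> sets M" if "V \<in> \<V>" for V n
  proof -
    have "{x \<in> P j. V x < n} = (\<Union>k<n. {x \<in> P j. V x = k})" by auto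
    then show ?thesis using meas[OF that] by auto
  qed
  have B_sets: "B n \<in> sets M" for n
    unfolding B_def by (rule sets_Collect_finite_Ball[OF fin Pj less_meas])
  have "(\<lambda>n. measure M (B n)) \<longlonglongrightarrow> measure M (\<Union>n. B n)"
  proof (rule Lim_measure_incseq)
    show "incseq B" by (fastforce simp: incseq_def B_def)
    have "emeasure M (\<Union>n. B n) < \<infinity>" by (rule heavy_sub_finite[OF j]) (auto simp: B_def)
    then show "emeasure M (\<Union>n. B n) \<noteq> \<infinity>" by simp
  qed (use B_sets in auto)
  moreover have "(\<Union>n. B n) = P j"
  proof -
    have "x \<in> B (Suc (\<Sum>V\<in>\<V>. V x))" if "x \<in> P j" for x
      using that member_le_sum[of _ \<V> "\<lambda>V. V x"] fin by (auto simp: B_def less_Suc_eq_le)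
    then show ?thesis by (auto simp: B_def)
  qed
  ultimately have "(\<lambda>n. measure M (B n)) \<longlonglongrightarrow> ?m" by simp
  moreover have "(1 - \<eta>) * ?m < ?m" using m \<eta> by simp
  ultimately have "\<forall>\<^sub>F n in sequentially. (1 - \<eta>) * ?m < measure M (B n)"
    by (rule order_tendstoD)
  then obtain n where n: "(1 - \<eta>) * ?m < measure M (B n)"
    using eventually_happens'[OF sequentially_bot] by blast
  define \<Phi> where "\<Phi> x = restrict (\<lambda>V. V x) \<V>" for x :: 'a
  define U where "U = \<Phi> ` B n"
  have "U \<subseteq> PiE \<V> (\<lambda>_. {..<n})" by (auto simp: U_def \<Phi>_def B_def)
  then have finU: "finite U" using fin by (metis finite_PiE finite_lessThan finite_subset)
  define A where "A u = {x \<in> B n. \<Phi> x = u}" for u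
  have disj: "disjoint_family_on A U" by (auto simp: disjoint_family_on_def A_def)
  have UN: "(\<Union>u\<in>U. A u) = B n" by (auto simp: U_def A_def)
  have A_sub: "A u \<subseteq> P j" for u by (auto simp: A_def B_def)
  have A_val: "V x = u V" if "x \<in> A u" "V \<in> \<V>" for x u V
    using that by (auto simp: A_def \<Phi>_def)
  have A_sets: "A u \<in> sets M" if "u \<in> U" for u
  proof -
    have "A u = B n \<inter> {x \<in> P j. \<forall>V\<in>\<V>. V x = u V}"
    proof
      show "B n \<inter> {x \<in> P j. \<forall>V\<in>\<V>. V x = u V} \<subseteq> A u"
        using that unfolding A_def U_def \<Phi>_def by (auto intro!: restrict_ext)
    qed (use A_val A_sub in \<open>auto simp: A_def\<close>)
    moreover have "{x \<in> P j. \<forall>V\<in>\<V>. V x = u V} \<in> sets M"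
      by (rule sets_Collect_finite_Ball[OF fin Pj meas])
    ultimately show ?thesis using B_sets by simp
  qed
  have A_fin: "emeasure M (A u) \<noteq> \<infinity>" for u
    using heavy_sub_finite[OF j A_sub, of u] by simp
  \<comment> \<open>Here \<open>c\<close> bounds the number of points lost by rounding down, and \<open>a\<close> the contribution of \<open>s\<close>.\<close>
  define c where "c = real (card U)"
  define a where "a = (\<Sum>V\<in>\<V>. \<Sum>x\<in>s. real (V x))"
  obtain N :: nat where N: "real N \<ge> 4 * (a + (K' + \<epsilon>) * c) / \<epsilon>" "real N > 2 * c"
  proof -
    obtain N1 :: nat where N1: "real N1 \<ge> 4 * (a + (K' + \<epsilon>) * c) / \<epsilon>" using real_arch_simple by blast
    obtain N2 :: nat where N2: "real N2 > 2 * c" using reals_Archimedean2 by blast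
    show ?thesis by (rule that[of "max N1 N2"]) (use N1 N2 in auto)
  qed
  define k where "k u = nat \<lfloor>real N * (measure M (A u) / ?m)\<rfloor>" for u
  have k_le: "real (k u) \<le> real N * (measure M (A u) / ?m)" for u
    unfolding k_def using m by simp
  have k_ge: "real (k u) \<ge> real N * (measure M (A u) / ?m) - 1" for u
    unfolding k_def by linarith
  have "infinite (A u)" if "u \<in> U" "k u > 0" for u
  proof (rule rich[OF A_sets[OF that(1)] A_sub])
    have "measure M (A u) > 0"
      using that(2) k_le[of u] by (cases "measure M (A u) = 0") (auto simp: zero_less_measure_iff)
    then show "emeasure M (A u) > 0" by (simp add: measure_def enn2real_positive_iff)
  qed
  then obtain Z where Z: "finite Z" "Z \<subseteq> (\<Union>u\<in>U. A u)" "\<And>u. u \<in> U \<Longrightarrow> card (Z \<inter> A u) = k u"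
    using sample_disjoint_cells[OF finU disj] by metis
  have Z_sum: "(\<Sum>x\<in>Z. g x) = (\<Sum>u\<in>U. \<Sum>x\<in>Z \<inter> A u. g x)" for g :: "'a \<Rightarrow> real"
  proof -
    have "Z = (\<Union>u\<in>U. Z \<inter> A u)" using Z(2) by blast
    then have "(\<Sum>x\<in>Z. g x) = sum g (\<Union>u\<in>U. Z \<inter> A u)" by simp
    also have "\<dots> = (\<Sum>u\<in>U. \<Sum>x\<in>Z \<inter> A u. g x)"
      by (rule sum.UNION_disjoint) (use finU Z(1) disj in \<open>auto simp: disjoint_family_on_def\<close>)
    finally show ?thesis .
  qed
  have measure_cells: "(\<Sum>u\<in>U'. measure M (A u)) = measure M (\<Union>u\<in>U'. A u)" if "U' \<subseteq> U" for U'
    using that finU A_sets A_fin disjoint_family_on_mono[OF that disj]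
    by (intro measure_finite_Union[symmetric]) (auto intro: finite_subset)
  have card_Z: "real (card Z) \<ge> real N * (1 - \<eta>) - c"
  proof -
    have "real N * (1 - \<eta>) \<le> real N * (measure M (B n) / ?m)"
      using n m by (intro mult_left_mono) (auto simp: field_simps)
    also have "\<dots> = (\<Sum>u\<in>U. real N * (measure M (A u) / ?m))"
      using measure_cells[of U] UN by (simp add: sum_divide_distrib[symmetric] sum_distrib_left[symmetric])
    also have "\<dots> - c \<le> (\<Sum>u\<in>U. real (k u))"
      using sum_mono[of U "\<lambda>u. real N * (measure M (A u) / ?m) - 1" "\<lambda>u. real (k u)"] k_ge
      by (simp add: sum_subtractf c_def)
    also have "\<dots> = real (card Z)" using Z_sum[of "\<lambda>_. 1"] Z(3) by simp
    finally show ?thesis by simp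
  qed
  have Z_V: "(\<Sum>x\<in>Z. real (V x)) \<le> real N * block_mean V j n" if V: "V \<in> \<V>" for V
  proof -
    have "(\<Sum>x\<in>Z. real (V x)) = (\<Sum>u\<in>U. real (k u) * real (u V))"
      unfolding Z_sum
    proof (rule sum.cong[OF refl])
      fix u assume u: "u \<in> U"
      have "(\<Sum>x\<in>Z \<inter> A u. real (V x)) = (\<Sum>x\<in>Z \<inter> A u. real (u V))"
        by (rule sum.cong) (auto simp: A_val[OF _ V])
      then show "(\<Sum>x\<in>Z \<inter> A u. real (V x)) = real (k u) * real (u V)"
        using Z(3)[OF u] by simp
    qed
    also have "\<dots> \<le> (\<Sum>u\<in>U. real N * (measure M (A u) / ?m) * real (u V))"
      by (intro sum_mono mult_right_mono k_le) auto
    also have "\<dots> = real N / ?m * (\<Sum>u\<in>U. measure M (A u) * real (u V))"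
      by (simp add: sum_distrib_left mult_ac)
    also have "(\<Sum>u\<in>U. measure M (A u) * real (u V)) =
        (\<Sum>i<n. \<Sum>u\<in>{u \<in> U. u V = i}. measure M (A u) * real (u V))"
      by (rule sum.group[symmetric]) (use finU V in \<open>auto simp: U_def \<Phi>_def B_def\<close>)
    also have "\<dots> = (\<Sum>i<n. real i * measure M (\<Union>u\<in>{u \<in> U. u V = i}. A u))"
      by (intro sum.cong) (auto simp: sum_distrib_left mult_ac simp flip: measure_cells)
    also have "\<dots> \<le> (\<Sum>i<n. real i * measure M {x \<in> P j. V x = i})"
    proof (intro sum_mono mult_left_mono)
      fix i
      show "measure M (\<Union>u\<in>{u \<in> U. u V = i}. A u) \<le> measure M {x \<in> P j. V x = i}"
      proof (rule measure_mono_fmeasurable)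
        show "(\<Union>u\<in>{u \<in> U. u V = i}. A u) \<subseteq> {x \<in> P j. V x = i}"
          using A_val[OF _ V] A_sub by auto
        show "(\<Union>u\<in>{u \<in> U. u V = i}. A u) \<in> sets M"
          using finU A_sets by (intro sets.finite_UN) auto
        show "{x \<in> P j. V x = i} \<in> fmeasurable M"
          using meas[OF V] heavy_sub_finite[OF j, of "{x \<in> P j. V x = i}"] by (auto simp: fmeasurable_def)
      qed
    qed auto
    finally show ?thesis
      using m by (simp add: block_mean_def sum_divide_distrib[symmetric] mult_left_mono divide_right_mono)
  qed
  define z where "z = s \<union> Z"
  have "finite z" "z \<subseteq> P j" using s Z UN by (auto simp: z_def B_def)
  have card_z: "real (card z) \<ge> real N * (1 - \<eta>) - c"
    using card_Z card_mono[of z Z] \<open>finite z\<close> by (simp add: z_def)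
  have "real N * (1 / 2) \<le> real N * (1 - \<eta>)" using \<eta> by (intro mult_left_mono) auto
  then have "card z > 0" using card_z N(2) by linarith
  have "(\<Sum>x\<in>z. real (V x)) / real (card z) \<le> block_mean V j n + \<epsilon>" if V: "V \<in> \<V>" for V
  proof -
    let ?E = "block_mean V j n"
    have E: "?E \<ge> 0" "?E \<le> K'" using K'(2)[OF V] by (auto simp: block_mean_def intro!: sum_nonneg)
    have "(\<Sum>x\<in>z. real (V x)) \<le> (\<Sum>x\<in>s. real (V x)) + (\<Sum>x\<in>Z. real (V x))"
      unfolding z_def using sum_Un_nat[of s Z V] s(1) Z(1)
      by (simp flip: of_nat_sum of_nat_add)
    also have "(\<Sum>x\<in>s. real (V x)) \<le> a"
      unfolding a_def using fin V
      by (intro member_le_sum[of V \<V> "\<lambda>V. \<Sum>x\<in>s. real (V x)"]) (auto intro: sum_nonneg)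
    finally have *: "(\<Sum>x\<in>z. real (V x)) \<le> a + real N * ?E" using Z_V[OF V] by simp
    have "4 * (a + (K' + \<epsilon>) * c) \<le> real N * \<epsilon>" using N(1) \<epsilon> by (simp add: field_simps)
    moreover have "real N * (?E * \<eta>) \<le> real N * (\<epsilon> / 4)"
      using order_trans[OF mult_right_mono[OF E(2)] \<eta>(3)] \<eta>(1) by (intro mult_left_mono) simp_all
    moreover have "real N * (\<epsilon> * (1 / 2)) \<le> real N * (\<epsilon> * (1 - \<eta>))"
      using \<eta> \<epsilon> by (intro mult_left_mono) auto
    moreover have "(?E + \<epsilon>) * c \<le> (K' + \<epsilon>) * c"
      using E by (intro mult_right_mono) (auto simp: c_def)
    moreover have "(?E + \<epsilon>) * (real N * (1 - \<eta>) - c) =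
        real N * ?E - real N * (?E * \<eta>) + real N * (\<epsilon> * (1 - \<eta>)) - (?E + \<epsilon>) * c"
      by (simp add: algebra_simps)
    ultimately have "a + real N * ?E \<le> (?E + \<epsilon>) * (real N * (1 - \<eta>) - c)" by simp
    also have "\<dots> \<le> (?E + \<epsilon>) * real (card z)"
      using card_z E \<epsilon> by (intro mult_left_mono) auto
    finally have "(\<Sum>x\<in>z. real (V x)) \<le> (?E + \<epsilon>) * real (card z)" using * by simp
    then show ?thesis using \<open>card z > 0\<close> by (simp add: pos_divide_le_eq)
  qed
  then show ?thesis
    using \<open>finite z\<close> \<open>z \<subseteq> P j\<close> \<open>card z > 0\<close> by (intro exI[of _ z] exI[of _ n]) (auto simp: z_def)
qed

definition bounded_test :: "('a \<Rightarrow> nat) \<times> (nat \<Rightarrow> nat) \<Rightarrow> bool" where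
  "bounded_test t \<longleftrightarrow> valid_test (fst t) (snd t) \<and>
     (\<exists>b<1. \<forall>n. test_sum (measure M) (fst t) (snd t) n \<le> b)"

lemma test_sum_measure_eq:
  "test_sum (measure M) V C n = (\<Sum>j\<in>heavy \<inter> {..<n}. block_mean V j n / real (C j))"
  by (simp add: test_sum_def block_mean_def sum_divide_distrib mult.commute)

lemma block_mean_nonneg: "block_mean V j n \<ge> 0"
  unfolding block_mean_def by (intro sum_nonneg) auto

text \<open>
  The sample consists of \<open>s\<close> and of one sample for each heavy block that meets \<open>s\<close>.  As only upper
  bounds are required, all other heavy blocks can be left out, and the slack \<open>1 - \<beta>\<close> is shared among finitely
  many blocks.
\<close>

lemma tests_satisfiable:
  assumes s: "s \<in> Fpow (space M)" and fin: "finite \<T>" and tests: "\<And>t. t \<in> \<T> \<Longrightarrow> bounded_test t"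
  shows "\<exists>z\<in>Fpow (space M). s \<subseteq> z \<and>
    (\<forall>t\<in>\<T>. \<forall>n. test_sum (count_in z) (fst t) (snd t) n \<le> 1)"
proof -
  obtain b where b: "\<And>t. t \<in> \<T> \<Longrightarrow> b t < 1"
    "\<And>t n. t \<in> \<T> \<Longrightarrow> test_sum (measure M) (fst t) (snd t) n \<le> b t"
    using tests unfolding bounded_test_def by metis
  have valid: "valid_test (fst t) (snd t)" if "t \<in> \<T>" for t
    using tests[OF that] by (simp add: bounded_test_def)
  have C_pos: "snd t j > 0" if "t \<in> \<T>" for t j
    using valid[OF that] by (simp add: valid_test_def)
  define \<beta> where "\<beta> = Max (insert 0 (b ` \<T>))"
  have \<beta>: "\<beta> < 1" "\<And>t. t \<in> \<T> \<Longrightarrow> b t \<le> \<beta>"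
    using fin b(1) by (auto simp: \<beta>_def)
  define J where "J = heavy \<inter> block_index ` s"
  have J: "finite J" "J \<subseteq> heavy" using s by (auto simp: J_def Fpow_def)
  define \<epsilon> where "\<epsilon> = (1 - \<beta>) / (real (card J) + 1)"
  have \<epsilon>: "\<epsilon> > 0" "real (card J) * \<epsilon> \<le> 1 - \<beta>"
    using \<beta>(1) by (auto simp: \<epsilon>_def field_simps)
  have "\<exists>z n. finite z \<and> s \<inter> P j \<subseteq> z \<and> z \<subseteq> P j \<and> z \<noteq> {} \<and>
    (\<forall>V\<in>fst ` \<T>. (\<Sum>x\<in>z. real (V x)) / real (card z) \<le> block_mean V j n + \<epsilon>)" if j: "j \<in> J" for j
  proof (rule sample_block[where K = "\<Sum>t\<in>\<T>. real (snd t j)"])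
    fix V n assume "V \<in> fst ` \<T>"
    then obtain t where t: "t \<in> \<T>" "V = fst t" by auto
    let ?n = "max n (Suc j)"
    have "block_mean V j n / real (snd t j) \<le> block_mean V j ?n / real (snd t j)"
      by (intro divide_right_mono block_mean_mono) auto
    also have "\<dots> \<le> test_sum (measure M) V (snd t) ?n"
      unfolding test_sum_measure_eq using j J
      by (intro member_le_sum) (auto intro!: divide_nonneg_nonneg block_mean_nonneg)
    also have "\<dots> \<le> 1" using b t by (meson less_imp_le order_trans)
    finally have "block_mean V j n \<le> real (snd t j)"
      using C_pos[OF t(1)] by (simp add: divide_le_eq)
    also have "\<dots> \<le> (\<Sum>t\<in>\<T>. real (snd t j))"
      using t(1) fin by (intro member_le_sum) auto
    finally show "block_mean V j n \<le> (\<Sum>t\<in>\<T>. real (snd t j))" .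
  next
    fix V k assume "V \<in> fst ` \<T>"
    then show "{x \<in> P j. V x = k} \<in> sets M" using valid j J by (auto simp: valid_test_def)
  qed (use j J fin s \<epsilon> in \<open>auto simp: Fpow_def\<close>)
  then obtain Z n where Z: "\<And>j. j \<in> J \<Longrightarrow> finite (Z j)" "\<And>j. j \<in> J \<Longrightarrow> s \<inter> P j \<subseteq> Z j"
    "\<And>j. j \<in> J \<Longrightarrow> Z j \<subseteq> P j"
    "\<And>j t. j \<in> J \<Longrightarrow> t \<in> \<T> \<Longrightarrow>
      (\<Sum>x\<in>Z j. real (fst t x)) / real (card (Z j)) \<le> block_mean (fst t) j (n j) + \<epsilon>"
    by (metis image_eqI)
  define z where "z = (s - heavy_part) \<union> (\<Union>j\<in>J. Z j)"
  have Z_space: "Z j \<subseteq> space M" if "j \<in> J" for j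
    using Z(3)[OF that] block_subset_space J(2) heavyD(1) that by blast
  have z: "z \<in> Fpow (space M)"
    using s J(1) Z(1) Z_space by (auto simp: z_def Fpow_def)
  have "s \<subseteq> z"
  proof
    fix x assume x: "x \<in> s"
    then have "x \<in> space M" using s by (auto simp: Fpow_def)
    show "x \<in> z"
    proof (cases "x \<in> heavy_part")
      case True
      then have "block_index x \<in> J"
        using x mem_heavy_part_iff[OF \<open>x \<in> space M\<close>] by (simp add: J_def)
      then show ?thesis using Z(2) x mem_block[OF \<open>x \<in> space M\<close>] by (auto simp: z_def)
    qed (use x in \<open>simp add: z_def\<close>)
  qed
  have index: "block_index x = j" if "j \<in> J" "x \<in> Z j" for j x
    using Z(3) that J(2) heavyD(1) block_index_eq by blast
  have z_block: "z \<inter> P j = Z j" if j: "j \<in> J" for j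
  proof
    show "z \<inter> P j \<subseteq> Z j"
    proof
      fix x assume x: "x \<in> z \<inter> P j"
      then have "x \<in> heavy_part" using j J by (auto simp: heavy_part_def)
      then obtain i where i: "i \<in> J" "x \<in> Z i" using x by (auto simp: z_def)
      have "block_index x = j" using x j J heavyD(1) block_index_eq by blast
      then show "x \<in> Z j" using i index by auto
    qed
    show "Z j \<subseteq> z \<inter> P j" using j Z(3) by (auto simp: z_def)
  qed
  have "block_sum \<alpha> P (heavy_test (fst t) (snd t)) z \<le> 1" if t: "t \<in> \<T>" for t
  proof -
    obtain V C where VC: "t = (V, C)" by (cases t)
    let ?g = "\<lambda>x. heavy_test V C x / real (card (z \<inter> block x))"
    define m where "m = Suc (Max (insert 0 (n ` J \<union> J)))"
    have m: "n j \<le> m" "j < m" if "j \<in> J" for j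
    proof -
      have "n j \<le> Max (insert 0 (n ` J \<union> J))" "j \<le> Max (insert 0 (n ` J \<union> J))"
        using J(1) that by (intro Max_ge; simp)+
      then show "n j \<le> m" "j < m" by (simp_all add: m_def)
    qed
    have "block_sum \<alpha> P (heavy_test V C) z = sum ?g (\<Union>j\<in>J. Z j)"
      unfolding block_sum_eq[OF z]
    proof (rule sum.mono_neutral_right)
      show "\<forall>x\<in>z - (\<Union>j\<in>J. Z j). ?g x = 0"
        by (auto simp: z_def heavy_test_def)
    qed (use z in \<open>auto simp: z_def Fpow_def\<close>)
    also have "\<dots> = (\<Sum>j\<in>J. sum ?g (Z j))"
    proof (rule sum.UNION_disjoint[OF J(1)])
      show "\<forall>i\<in>J. \<forall>j\<in>J. i \<noteq> j \<longrightarrow> Z i \<inter> Z j = {}" using index by blast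
    qed (use Z(1) in blast)
    also have "\<dots> \<le> (\<Sum>j\<in>J. block_mean V j m / real (C j) + \<epsilon>)"
    proof (rule sum_mono)
      fix j assume j: "j \<in> J"
      have "sum ?g (Z j) = (\<Sum>x\<in>Z j. real (V x) / real (card (Z j)) / real (C j))"
      proof (rule sum.cong[OF refl])
        fix x assume x: "x \<in> Z j"
        then have "x \<in> heavy_part" using Z(3)[OF j] j J(2) by (auto simp: heavy_part_def)
        then show "?g x = real (V x) / real (card (Z j)) / real (C j)"
          using index[OF j x] z_block[OF j] by (simp add: heavy_test_def)
      qed
      also have "\<dots> = (\<Sum>x\<in>Z j. real (V x)) / real (card (Z j)) / real (C j)"
        by (simp add: sum_divide_distrib)
      also have "\<dots> \<le> (block_mean V j m + \<epsilon>) / real (C j)"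
        using Z(4)[OF j t] block_mean_mono[OF m(1)[OF j], of V j] VC by (intro divide_right_mono) auto
      also have "\<dots> \<le> block_mean V j m / real (C j) + \<epsilon>"
        using C_pos[OF t, of j] VC \<epsilon>(1) by (auto simp: field_simps)
      finally show "sum ?g (Z j) \<le> block_mean V j m / real (C j) + \<epsilon>" .
    qed
    also have "\<dots> \<le> test_sum (measure M) V C m + real (card J) * \<epsilon>"
    proof -
      have "(\<Sum>j\<in>J. block_mean V j m / real (C j)) \<le> test_sum (measure M) V C m"
        unfolding test_sum_measure_eq using J m(2)
        by (intro sum_mono2) (auto intro!: divide_nonneg_nonneg block_mean_nonneg)
      then show ?thesis by (simp add: sum.distrib)
    qed
    also have "\<dots> \<le> 1"
      using b(2)[OF t, of m] \<beta>(2)[OF t] \<epsilon>(2) VC by simp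
    finally show ?thesis by (simp add: VC)
  qed
  then show ?thesis
    using z \<open>s \<subseteq> z\<close> by (intro bexI[of _ z]) (simp_all add: test_sum_count_le_iff)
qed

lemma ex_covering_bounds_tests: "\<exists>G. G \<noteq> bot \<and> covering G \<and> bounds_tests G"
proof -
  define B where "B = {(s, \<T>). s \<in> Fpow (space M) \<and> finite \<T> \<and> (\<forall>t\<in>\<T>. bounded_test t)}"
  define S where "S = (\<lambda>(s, \<T>). {z \<in> Fpow (space M). s \<subseteq> z \<and>
    (\<forall>t\<in>\<T>. \<forall>n. test_sum (count_in z) (fst t) (snd t) n \<le> 1)})"
  define G where "G = (INF b\<in>B. principal (S b))"
  have ev: "eventually Q G \<longleftrightarrow> (\<exists>b\<in>B. \<forall>z\<in>S b. Q z)" for Q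
    unfolding G_def
  proof (subst eventually_INF_base)
    show "B \<noteq> {}" by (auto simp: B_def Fpow_def intro!: exI[of _ "{}"])
    fix b c assume bc: "b \<in> B" "c \<in> B"
    let ?d = "(fst b \<union> fst c, snd b \<union> snd c)"
    have "?d \<in> B" using bc by (auto simp: B_def Fpow_def)
    moreover have "S ?d \<subseteq> S b \<inter> S c" by (auto simp: S_def split: prod.splits)
    ultimately show "\<exists>x\<in>B. principal (S x) \<le> inf (principal (S b)) (principal (S c))"
      by (intro bexI[of _ ?d]) auto
  qed (simp add: eventually_principal)
  have "S b \<noteq> {}" if "b \<in> B" for b
  proof -
    have "fst b \<in> Fpow (space M)" "finite (snd b)" "\<And>t. t \<in> snd b \<Longrightarrow> bounded_test t"
      using that by (auto simp: B_def)
    from tests_satisfiable[OF this] show ?thesis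
      unfolding S_def by (cases b) (simp, blast)
  qed
  then have "G \<noteq> bot"
    unfolding trivial_limit_def ev by blast
  moreover have "covering G"
    unfolding covering_def le_principal ev
  proof (intro conjI ballI)
    show "\<exists>b\<in>B. \<forall>z\<in>S b. z \<in> Fpow (space M)"
      by (intro bexI[of _ "({}, {})"]) (auto simp: S_def B_def Fpow_def)
    show "\<exists>b\<in>B. \<forall>z\<in>S b. x \<in> z" if "x \<in> space M" for x
      using that by (intro bexI[of _ "({x}, {})"]) (auto simp: S_def B_def Fpow_def)
  qed
  moreover have "bounds_tests G"
    unfolding bounds_tests_def ev
  proof (intro allI impI)
    fix V C and b :: real
    assume "valid_test V C \<and> b < 1 \<and> (\<forall>n. test_sum (measure M) V C n \<le> b)"
    then have "({}, {(V, C)}) \<in> B" by (auto simp: B_def Fpow_def bounded_test_def)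
    then show "\<exists>b\<in>B. \<forall>z\<in>S b. \<forall>n. test_sum (count_in z) V C n \<le> 1"
      by (rule bexI[rotated]) (simp add: S_def)
  qed
  ultimately show ?thesis by blast
qed

end


section \<open>Finite atoms and the choice of the partition\<close>

text \<open>
  The block with index 0 is prescribed, because it is the only one that may be empty.
\<close>

lemma enumerate_blocks:
  fixes \<B> :: "'a set set"
  assumes "countable \<B>" "disjoint \<B>" "{} \<notin> \<B>" "Q \<inter> \<Union>\<B> = {}"
  obtains \<alpha> P where "countable_partition (Q \<union> \<Union>\<B>) \<alpha> P" "P 0 = Q" "0 < \<alpha>"
    "P ` {i. 0 < i \<and> enat i < \<alpha>} = \<B>"
proof -
  define P where "P i = (if i = 0 then Q else from_nat_into \<B> (i - 1))" for i
  define \<alpha> where "\<alpha> = (if finite \<B> then enat (Suc (card \<B>)) else \<infinity>)"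
  have bij: "bij_betw (from_nat_into \<B>) {k. enat (Suc k) < \<alpha>} \<B>"
  proof (cases "finite \<B>")
    case True
    then have "{k. enat (Suc k) < \<alpha>} = {..<card \<B>}" by (auto simp: \<alpha>_def)
    then show ?thesis using bij_betw_from_nat_into_finite[OF True] by simp
  next
    case False
    then show ?thesis using bij_betw_from_nat_into[OF assms(1) False] by (simp add: \<alpha>_def)
  qed
  have pos: "{i. 0 < i \<and> enat i < \<alpha>} = Suc ` {k. enat (Suc k) < \<alpha>}"
    by (auto simp: image_iff gr0_conv_Suc)
  have "0 < \<alpha>" by (simp add: \<alpha>_def zero_enat_def)
  have P_pos: "P ` {i. 0 < i \<and> enat i < \<alpha>} = \<B>"
    using bij unfolding pos image_image by (simp add: P_def bij_betw_def)
  have split: "{i. enat i < \<alpha>} = insert 0 {i. 0 < i \<and> enat i < \<alpha>}"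
    using \<open>0 < \<alpha>\<close> by (auto simp: zero_enat_def)
  have "countable_partition (Q \<union> \<Union>\<B>) \<alpha> P"
    unfolding countable_partition_def
  proof (intro conjI allI impI)
    show "disjoint_family_on P {i. enat i < \<alpha>}"
      unfolding disjoint_family_on_def
    proof (intro ballI impI)
      fix m n assume mn: "m \<in> {i. enat i < \<alpha>}" "n \<in> {i. enat i < \<alpha>}" "m \<noteq> n"
      have mem: "P i \<in> \<B>" if "i \<in> {i. enat i < \<alpha>}" "i \<noteq> 0" for i
        using that P_pos by blast
      show "P m \<inter> P n = {}"
      proof (cases "m = 0 \<or> n = 0")
        case True
        then show ?thesis using mem mn assms(4) P_def by (metis Int_commute UnionI disjoint_iff)
      next
        case False
        have "P m \<noteq> P n"
        proof
          assume eq: "P m = P n"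
          have "from_nat_into \<B> (m - 1) = from_nat_into \<B> (n - 1)"
            using eq False by (simp add: P_def)
          moreover have "m - 1 \<in> {k. enat (Suc k) < \<alpha>}" "n - 1 \<in> {k. enat (Suc k) < \<alpha>}"
            using mn False by auto
          ultimately have "m - 1 = n - 1" using bij by (auto simp: bij_betw_def dest: inj_onD)
          then show False using False mn(3) by arith
        qed
        then show ?thesis using mem mn False assms(2) by (auto simp: disjoint_def)
      qed
    qed
    show "(\<Union>i\<in>{i. enat i < \<alpha>}. P i) = Q \<union> \<Union>\<B>"
      unfolding split UN_insert P_pos by (simp add: P_def)
    show "P i \<noteq> {}" if "0 < i \<and> enat i < \<alpha>" for i
      using that P_pos assms(3) by blast
  qed
  then show ?thesis using \<open>0 < \<alpha>\<close> P_pos by (intro that[of \<alpha> P]) (auto simp: P_def)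
qed

text \<open>
  These are the minimal finite sets of positive measure: a proper measurable part of such a set is null
  by minimality, so its complement in the set has positive measure, whence the part is empty.
\<close>

definition finite_atom :: "'a measure \<Rightarrow> 'a set \<Rightarrow> bool" where
  "finite_atom M A \<longleftrightarrow> A \<in> sets M \<and> finite A \<and> emeasure M A > 0 \<and>
     (\<forall>B\<in>sets M. B \<subseteq> A \<longrightarrow> B = {} \<or> B = A)"

lemma finite_atomD:
  "finite_atom M A \<Longrightarrow> A \<in> sets M" "finite_atom M A \<Longrightarrow> finite A" "finite_atom M A \<Longrightarrow> emeasure M A > 0"
  "finite_atom M A \<Longrightarrow> B \<in> sets M \<Longrightarrow> B \<subseteq> A \<Longrightarrow> B \<noteq> {} \<Longrightarrow> B = A"
  by (auto simp: finite_atom_def)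

lemma finite_atom_nonempty: "finite_atom M A \<Longrightarrow> A \<noteq> {}"
  by (auto simp: finite_atom_def)

lemma finite_atom_unique: "finite_atom M A \<Longrightarrow> finite_atom M B \<Longrightarrow> x \<in> A \<Longrightarrow> x \<in> B \<Longrightarrow> A = B"
  using finite_atomD(4)[of M A "A \<inter> B"] finite_atomD(4)[of M B "A \<inter> B"] finite_atomD(1) by blast

text \<open>
  Splitting off measurable parts and keeping one of positive measure ends after finitely many steps.
\<close>

lemma finite_set_contains_atom:
  assumes "finite A" "A \<in> sets M" "emeasure M A > 0"
  shows "\<exists>B\<subseteq>A. finite_atom M B"
  using assms
proof (induction A rule: finite_psubset_induct)
  case (psubset A)
  show ?case
  proof (cases "finite_atom M A")
    case False
    then obtain B where B: "B \<in> sets M" "B \<subset> A" "B \<noteq> {}"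
      using psubset by (auto simp: finite_atom_def)
    have "emeasure M A \<le> emeasure M B + emeasure M (A - B)"
      using emeasure_subadditive[of B M "A - B"] B psubset.prems(1) by (simp add: Un_absorb1 psubset_imp_subset)
    then consider "emeasure M B > 0" | "emeasure M (A - B) > 0"
      using psubset.prems(2) by (metis add_0 not_gr_zero order_less_le_trans)
    then obtain C where "C \<subset> A" "C \<in> sets M" "emeasure M C > 0"
      using B psubset.prems(1) by cases blast+
    then show ?thesis using psubset.IH[of C] by blast
  qed auto
qed

lemma finite_atom_constant:
  assumes A: "finite_atom M A" and h: "h \<in> borel_measurable M" and xy: "x \<in> A" "y \<in> A"
  shows "h x = (h y :: real)"
proof -
  have "{u \<in> A. h u = h x} = A \<inter> {u \<in> space M. h u = h x}"
    using finite_atomD(1)[OF A] sets.sets_into_space by auto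
  moreover have "A \<inter> {u \<in> space M. h u = h x} \<in> sets M"
    using h finite_atomD(1)[OF A] by measurable
  ultimately have "{u \<in> A. h u = h x} = A"
    using xy by (intro finite_atomD(4)[OF A]) auto
  then have "y \<in> {u \<in> A. h u = h x}" using xy(2) by simp
  then show ?thesis by simp
qed

lemma finite_atom_singleton:
  "finite_atom M A \<Longrightarrow> x \<in> A \<Longrightarrow> {x} \<in> sets M \<Longrightarrow> A = {x}"
  using finite_atomD(4)[of M A "{x}"] by auto

context sigma_finite_measure
begin

lemma finite_atom_finite_measure:
  assumes A: "finite_atom M A"
  shows "emeasure M A < \<infinity>"
proof -
  obtain Q :: "nat \<Rightarrow> 'a set" where Q: "range Q \<subseteq> sets M" "(\<Union>i. Q i) = space M" "\<And>i. emeasure M (Q i) \<noteq> \<infinity>"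
    using sigma_finite by metis
  obtain x where "x \<in> A" using finite_atom_nonempty[OF A] by blast
  then have "x \<in> space M" using finite_atomD(1)[OF A] sets.sets_into_space by blast
  then obtain i where "x \<in> Q i" using Q(2) by blast
  then have "A \<inter> Q i = A"
    using Q(1) finite_atomD(1)[OF A] \<open>x \<in> A\<close> by (intro finite_atomD(4)[OF A]) auto
  then have "emeasure M A \<le> emeasure M (Q i)"
    using Q(1) by (intro emeasure_mono) auto
  then show ?thesis using Q(3)[of i] by (simp add: less_top order_le_less_trans)
qed

text \<open>
  Every atom lies inside one of countably many sets of finite measure, and disjoint sets of
  positive measure within such a set have summable measures.
\<close>

lemma countable_finite_atoms: "countable {A. finite_atom M A}"
proof -
  obtain Q :: "nat \<Rightarrow> 'a set" where Q: "range Q \<subseteq> sets M" "(\<Union>i. Q i) = space M" "\<And>i. emeasure M (Q i) \<noteq> \<infinity>"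
    using sigma_finite by metis
  define \<A> where "\<A> i = {A. finite_atom M A \<and> A \<subseteq> Q i}" for i
  have "countable (\<A> i)" for i
  proof -
    have "(\<lambda>A. measure M A) summable_on \<A> i"
    proof (rule nonneg_bdd_above_summable_on)
      have "sum (measure M) \<F> \<le> measure M (Q i)" if "\<F> \<subseteq> \<A> i" "finite \<F>" for \<F>
      proof -
        have "sum (measure M) \<F> = measure M (\<Union>A\<in>\<F>. A)"
        proof (rule measure_finite_Union[symmetric])
          show "disjoint_family_on (\<lambda>A. A) \<F>"
            unfolding disjoint_family_on_def
          proof (intro ballI impI)
            fix A B assume "A \<in> \<F>" "B \<in> \<F>" "A \<noteq> B"
            then have "finite_atom M A" "finite_atom M B" using that(1) by (auto simp: \<A>_def)
            then show "A \<inter> B = {}" using finite_atom_unique \<open>A \<noteq> B\<close> by (metis disjoint_iff)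
          qed
          show "emeasure M A \<noteq> \<infinity>" if "A \<in> \<F>" for A
            using finite_atom_finite_measure[of A] that \<open>\<F> \<subseteq> \<A> i\<close> by (auto simp: \<A>_def)
          show "(\<lambda>A. A) ` \<F> \<subseteq> sets M"
            using that(1) by (auto simp: \<A>_def finite_atomD(1))
        qed (rule that(2))
        also have "\<dots> \<le> measure M (Q i)"
        proof (rule measure_mono_fmeasurable)
          show "(\<Union>A\<in>\<F>. A) \<in> sets M"
            using that by (intro sets.finite_UN) (auto simp: \<A>_def finite_atomD)
          show "Q i \<in> fmeasurable M" using Q by (auto simp: fmeasurable_def less_top)
        qed (use that in \<open>auto simp: \<A>_def\<close>)
        finally show ?thesis .
      qed
      then show "bdd_above (sum (measure M) ` {\<F>. \<F> \<subseteq> \<A> i \<and> finite \<F>})"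
        by (intro bdd_aboveI[of _ "measure M (Q i)"]) auto
    qed simp
    then have "countable {A \<in> \<A> i. measure M A \<noteq> 0}" by (rule summable_countable_real)
    moreover have "{A \<in> \<A> i. measure M A \<noteq> 0} = \<A> i"
    proof -
      have "measure M A \<noteq> 0" if "finite_atom M A" for A
        using finite_atom_finite_measure[OF that] finite_atomD(3)[OF that]
        by (auto simp: measure_def enn2real_eq_0_iff)
      then show ?thesis by (auto simp: \<A>_def)
    qed
    ultimately show ?thesis by simp
  qed
  moreover have "{A. finite_atom M A} \<subseteq> (\<Union>i. \<A> i)"
  proof
    fix A assume "A \<in> {A. finite_atom M A}"
    then have A: "finite_atom M A" by simp
    obtain x where "x \<in> A" using finite_atom_nonempty[OF A] by blast
    then have "x \<in> space M" using finite_atomD(1)[OF A] sets.sets_into_space by blast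
    then obtain i where "x \<in> Q i" using Q(2) by blast
    then have "A \<inter> Q i = A"
      using Q(1) finite_atomD(1)[OF A] \<open>x \<in> A\<close> by (intro finite_atomD(4)[OF A]) auto
    then show "A \<in> (\<Union>i. \<A> i)" using A by (auto simp: \<A>_def)
  qed
  ultimately show ?thesis by (meson countable_UN countable_subset countableI_type)
qed

end

context partitioned_space
begin

lemma exactly_weighed_Un:
  assumes A: "exactly_weighed w A" and B: "exactly_weighed w B" and "A \<inter> B = {}"
  shows "exactly_weighed w (A \<union> B)"
proof -
  obtain s where s: "s \<in> Fpow (space M)" "\<And>z. z \<in> Fpow (space M) \<Longrightarrow> s \<subseteq> z \<Longrightarrow>
      block_sum \<alpha> P (\<lambda>x. indicator A x * w x) z = measure M A"
    using A unfolding exactly_weighed_def by metis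
  obtain t where t: "t \<in> Fpow (space M)" "\<And>z. z \<in> Fpow (space M) \<Longrightarrow> t \<subseteq> z \<Longrightarrow>
      block_sum \<alpha> P (\<lambda>x. indicator B x * w x) z = measure M B"
    using B unfolding exactly_weighed_def by metis
  have fin: "A \<in> sets M" "B \<in> sets M" "emeasure M A < \<infinity>" "emeasure M B < \<infinity>"
    using A B by (auto simp: exactly_weighed_def)
  have "block_sum \<alpha> P (\<lambda>x. indicator (A \<union> B) x * w x) z = measure M (A \<union> B)"
    if z: "z \<in> Fpow (space M)" "s \<union> t \<subseteq> z" for z
  proof -
    have "block_sum \<alpha> P (\<lambda>x. indicator (A \<union> B) x * w x) z =
        block_sum \<alpha> P (\<lambda>x. indicator A x * w x + indicator B x * w x) z"
      using \<open>A \<inter> B = {}\<close> unfolding block_sum_eq[OF z(1)]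
      by (intro sum.cong) (auto simp: indicator_def)
    also have "\<dots> = measure M A + measure M B"
      using z s t by (simp add: block_sum_add)
    also have "\<dots> = measure M (A \<union> B)"
      using fin \<open>A \<inter> B = {}\<close> by (intro measure_Union[symmetric]) auto
    finally show ?thesis .
  qed
  moreover have "s \<union> t \<in> Fpow (space M)" using s(1) t(1) by (auto simp: Fpow_def)
  moreover have "emeasure M (A \<union> B) < \<infinity>"
    using fin emeasure_subadditive[of A M B] by (simp add: order_le_less_trans)
  ultimately show ?thesis using fin unfolding exactly_weighed_def by blast
qed

lemma exactly_weighed_Union:
  assumes "finite \<C>" "disjoint \<C>" "\<And>A. A \<in> \<C> \<Longrightarrow> exactly_weighed w A"
  shows "exactly_weighed w (\<Union>\<C>)"
  using assms
proof (induction \<C> rule: finite_induct)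
  case empty
  have "block_sum \<alpha> P (\<lambda>x. indicator {} x * w x) z = 0" if "z \<in> Fpow (space M)" for z
    by (simp add: block_sum_eq[OF that])
  then show ?case by (auto simp: exactly_weighed_def Fpow_def intro!: exI[of _ "{}"])
next
  case (insert A \<C>)
  have "exactly_weighed w (A \<union> \<Union>\<C>)"
  proof (rule exactly_weighed_Un)
    show "A \<inter> \<Union>\<C> = {}" using insert by (fastforce simp: disjoint_def)
    show "exactly_weighed w (\<Union>\<C>)"
      using insert by (intro insert.IH) (auto simp: disjoint_def)
  qed (use insert in simp)
  then show ?case by simp
qed

end

text \<open>
  Outside the union \<open>D\<close> of the finite atoms, every measurable set of positive measure is infinite, since
  otherwise it would contain an atom.  A singleton of \<open>D\<close> is measurable only if it is itself an atom, so that the light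
  part consists of null blocks and of the atoms with several points.  A measurable function is constant
  on such an atom, which therefore contributes its integral exactly once all its points are in \<open>z\<close>.
\<close>

theorem (in sigma_finite_measure) ex_adapted_partition:
  "\<exists>\<alpha> P w. adapted_partition M \<alpha> P w \<and> (\<forall>i. enat i < \<alpha> \<longrightarrow> w constant_on P i) \<and>
     (\<forall>x\<in>P 0. \<not> point_mass M x) \<and>
     (emeasure M (space M) < \<infinity> \<longrightarrow> (\<forall>i. 0 < i \<and> enat i < \<alpha> \<longrightarrow> is_singleton (P i)))"
proof -
  \<comment> \<open>For a finite measure a single set suffices, and all blocks but the first are singletons.\<close>
  obtain Q :: "nat \<Rightarrow> 'a set" where Q: "range Q \<subseteq> sets M" "(\<Union>i. Q i) = space M"
    "\<And>i. emeasure M (Q i) < \<infinity>" "disjoint_family Q"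
    "emeasure M (space M) < \<infinity> \<Longrightarrow> (\<forall>i>0. Q i = {})"
  proof (cases "emeasure M (space M) < \<infinity>")
    case True
    show ?thesis
      by (rule that[of "\<lambda>i. if i = 0 then space M else {}"])
        (use True in \<open>auto simp: disjoint_family_on_def split: if_splits\<close>)
  next
    case False
    obtain A :: "nat \<Rightarrow> 'a set" where "range A \<subseteq> sets M" "(\<Union>i. A i) = space M"
      "\<And>i. emeasure M (A i) \<noteq> \<infinity>" "disjoint_family A"
      using sigma_finite_disjoint by metis
    then show ?thesis using False by (intro that[of A]) (simp_all add: top.not_eq_extremum)
  qed
  define D where "D = \<Union>{A. finite_atom M A}"
  define atom where "atom x = (THE A. finite_atom M A \<and> x \<in> A)" for x
  have atom_eq: "atom x = A" if "finite_atom M A" "x \<in> A" for x A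
    unfolding atom_def by (rule the_equality) (use that finite_atom_unique[of M _ A x] in blast)+
  have atom: "finite_atom M (atom x)" "x \<in> atom x" if x: "x \<in> D" for x
  proof -
    obtain A where "finite_atom M A" "x \<in> A" using x unfolding D_def by blast
    then show "finite_atom M (atom x)" "x \<in> atom x" using atom_eq[of A x] by simp_all
  qed
  have atom_D: "A \<subseteq> D" if "finite_atom M A" for A using that by (auto simp: D_def)
  have "countable D"
  proof -
    have "countable (\<Union>A\<in>{A. finite_atom M A}. A)"
      by (intro countable_UN countable_finite_atoms) (auto intro: countable_finite finite_atomD(2))
    then show ?thesis by (simp add: D_def)
  qed
  have D_sets: "D \<in> sets M"
    unfolding D_def using countable_finite_atoms by (intro sets.countable_Union) (auto simp: finite_atomD(1))
  then have D_space: "D \<subseteq> space M" by (rule sets.sets_into_space)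
  define H where "H i = Q i - D" for i
  have H_sets: "H i \<in> sets M" for i using Q(1) D_sets by (auto simp: H_def)
  have H_fin: "emeasure M (H i) < \<infinity>" for i
    using Q(1,3) emeasure_mono[of "H i" "Q i" M] by (auto simp: H_def intro: order_le_less_trans)
  have H_disj: "H i \<inter> H j = {}" if "i \<noteq> j" for i j
    using Q(4) that by (auto simp: H_def disjoint_family_on_def)
  have H_D: "x \<notin> D" if "x \<in> H i" for x i using that by (simp add: H_def)
  have H_UN: "(\<Union>i. H i) = space M - D" using Q(2) by (auto simp: H_def)
  define \<B> where "\<B> = (H ` {0<..} - {{}}) \<union> (\<lambda>x. {x}) ` D"
  have \<B>_UN: "\<Union>\<B> = (\<Union>i\<in>{0<..}. H i) \<union> D" by (auto simp: \<B>_def)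
  have "H 0 \<union> \<Union>\<B> = space M"
  proof -
    have "(UNIV :: nat set) = insert 0 {0<..}" by auto
    then have "(\<Union>i. H i) = H 0 \<union> (\<Union>i\<in>{0<..}. H i)" by (metis UN_insert)
    then show ?thesis using H_UN D_space \<B>_UN by auto
  qed
  moreover obtain \<alpha> P where P: "countable_partition (H 0 \<union> \<Union>\<B>) \<alpha> P" "P 0 = H 0" "0 < \<alpha>"
    "P ` {i. 0 < i \<and> enat i < \<alpha>} = \<B>"
  proof (rule enumerate_blocks)
    show "countable \<B>" using \<open>countable D\<close> by (auto simp: \<B>_def)
    show "disjoint \<B>"
      unfolding disjoint_def
    proof (intro ballI impI)
      fix A B assume AB: "A \<in> \<B>" "B \<in> \<B>" "A \<noteq> B"
      have "(\<exists>i. A = H i) \<or> (\<exists>x\<in>D. A = {x})" "(\<exists>i. B = H i) \<or> (\<exists>x\<in>D. B = {x})"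
        using AB by (auto simp: \<B>_def)
      then show "A \<inter> B = {}"
        using H_disj AB(3) H_D by (elim disjE exE bexE; metis disjoint_iff singletonD)
    qed
    show "{} \<notin> \<B>" by (auto simp: \<B>_def)
    show "H 0 \<inter> \<Union>\<B> = {}"
      using H_disj[of 0] H_D[of _ 0] unfolding \<B>_UN by auto
  qed blast
  ultimately have part: "countable_partition (space M) \<alpha> P" by simp
  interpret partitioned_space M \<alpha> P by unfold_locales (rule part)
  have \<B>_block: "\<exists>i. enat i < \<alpha> \<and> P i = B" if "B \<in> \<B>" for B
    using that P(4) by blast
  have H_block: "\<exists>i. enat i < \<alpha> \<and> P i = H n" if "x \<in> H n" for x n
  proof (cases "n = 0")
    case True
    then show ?thesis using P(2,3) by (metis zero_enat_def)
  next
    case False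
    then show ?thesis using that by (intro \<B>_block) (auto simp: \<B>_def)
  qed
  define cell where "cell x = (THE n. x \<in> H n)" for x
  have cell_eq: "cell x = n" if "x \<in> H n" for x n
    unfolding cell_def by (rule the_equality) (use that H_disj in blast)+
  have cell: "x \<in> H (cell x)" if "x \<in> space M - D" for x
    using that H_UN cell_eq by blast
  have block: "block x = (if x \<in> D then {x} else H (cell x))" if x: "x \<in> space M" for x
  proof -
    have "\<exists>i. enat i < \<alpha> \<and> P i = (if x \<in> D then {x} else H (cell x))"
      using H_block[OF cell[of x]] \<B>_block[of "{x}"] x by (auto simp: \<B>_def)
    moreover have "x \<in> (if x \<in> D then {x} else H (cell x))" using cell x by auto
    ultimately show ?thesis using block_index_eq by metis
  qed
  define w where "w x = (if x \<in> D then measure M (atom x) / real (card (atom x))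
    else measure M (H (cell x)))" for x
  have atom_singleton: "atom x = {x}" if "x \<in> D" "{x} \<in> sets M" for x
    using finite_atom_singleton[OF atom[OF that(1)] that(2)] .
  have block_eq: "P i = block x" if "enat i < \<alpha>" "x \<in> P i" for i x
    using block_index_eq[OF that] by simp
  have heavy_point: "\<exists>x\<in>space M. x \<in> P i \<and> P i = block x" if "i \<in> heavy" for i
  proof -
    have "P i \<noteq> {}" using heavyD(3)[OF that] by auto
    then show ?thesis using block_eq heavyD(1)[OF that] block_subset_space by blast
  qed
  have light_D: "{x} \<notin> sets M" if "x \<in> D" "x \<notin> heavy_part" for x
  proof
    assume "{x} \<in> sets M"
    then have "emeasure M {x} > 0"
      using finite_atomD(3)[OF atom(1)[OF that(1)]] atom_singleton[OF that(1)] by simp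
    have "x \<in> space M" using D_space that by blast
    then have "block_index x \<in> heavy"
      using \<open>{x} \<in> sets M\<close> \<open>emeasure M {x} > 0\<close> block[of x] that(1) block_index_less
      by (simp add: heavy_def)
    then show False using that(2) mem_heavy_part_iff[OF \<open>x \<in> space M\<close>] by simp
  qed
  have light_not_D: "w x = 0" if x: "x \<in> space M" "x \<notin> D" "x \<notin> heavy_part" for x
  proof -
    have "block_index x \<notin> heavy" using x mem_heavy_part_iff by blast
    then have "emeasure M (H (cell x)) = 0"
      using block[OF x(1)] x block_index_less[OF x(1)] H_sets by (auto simp: heavy_def)
    then show ?thesis using x by (simp add: w_def measure_def)
  qed
  have adapted: "adapted_partition M \<alpha> P w"
  proof
    fix x show "w x \<ge> 0" by (simp add: w_def)
  next
    fix i assume "i \<in> heavy"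
    then obtain x where x: "x \<in> space M" "x \<in> P i" "P i = block x" using heavy_point by blast
    show "emeasure M (P i) < \<infinity>"
    proof (cases "x \<in> D")
      case True
      then have "{x} = atom x" using atom_singleton block[OF x(1)] x(3) heavyD(2)[OF \<open>i \<in> heavy\<close>] by simp
      then show ?thesis
        using finite_atom_finite_measure[OF atom(1)[OF True]] block[OF x(1)] x(3) True by simp
    next
      case False
      then show ?thesis using H_fin block[OF x(1)] x(3) by simp
    qed
    show "is_singleton (P i) \<or> (\<forall>A\<in>sets M. A \<subseteq> P i \<and> emeasure M A > 0 \<longrightarrow> infinite A)"
    proof (cases "x \<in> D")
      case True
      then show ?thesis using block[OF x(1)] x(3) by simp
    next
      case False
      have "infinite A" if A: "A \<in> sets M" "A \<subseteq> P i" "emeasure M A > 0" for A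
      proof
        assume "finite A"
        then obtain B where B: "B \<subseteq> A" "finite_atom M B" using finite_set_contains_atom A by blast
        then have "B \<subseteq> H (cell x)" using A(2) block[OF x(1)] x(3) False by auto
        then show False using atom_D[OF B(2)] finite_atom_nonempty[OF B(2)] by (auto simp: H_def)
      qed
      then show ?thesis by blast
    qed
  next
    fix i x assume i: "i \<in> heavy" and x: "x \<in> P i"
    have xs: "x \<in> space M" using block_subset_space heavyD(1)[OF i] x by blast
    have eq: "P i = block x" by (rule block_eq[OF heavyD(1)[OF i] x])
    show "w x = measure M (P i)"
    proof (cases "x \<in> D")
      case True
      then have "atom x = {x}" using atom_singleton eq block[OF xs] heavyD(2)[OF i] by simp
      then show ?thesis using True eq block[OF xs] by (simp add: w_def)
    next
      case False
      then show ?thesis using eq block[OF xs] by (simp add: w_def)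
    qed
  next
    fix z h assume z: "z \<in> Fpow (space M)" and h: "integrable M h" "\<And>x. h x \<ge> (0 :: real)"
    let ?L = "space M - heavy_part"
    define \<A> where "\<A> = atom ` (z \<inter> ?L \<inter> D)"
    have fin: "finite z" "finite \<A>" using z by (auto simp: Fpow_def \<A>_def)
    have \<A>: "finite_atom M A" if "A \<in> \<A>" for A using that atom by (auto simp: \<A>_def)
    have \<A>_light: "A \<subseteq> ?L" if A: "A \<in> \<A>" for A
    proof
      fix y assume y: "y \<in> A"
      obtain x where x: "x \<in> ?L" "x \<in> D" "A = atom x" using A by (auto simp: \<A>_def)
      have ys: "y \<in> space M" "y \<in> D" using y \<A>[OF A] atom_D D_space by blast+
      have "y \<notin> heavy_part"
      proof
        assume "y \<in> heavy_part"
        then have "block_index y \<in> heavy" using mem_heavy_part_iff ys by blast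
        then have "{y} \<in> sets M" using heavyD(2) block[OF ys(1)] ys(2) by fastforce
        then have "A = {y}" using finite_atom_singleton[OF \<A>[OF A] y] by simp
        then have "{x} \<in> sets M" using atom(2)[OF x(2)] x(3) \<open>{y} \<in> sets M\<close> by simp
        then show False using light_D x by blast
      qed
      then show "y \<in> ?L" using ys by simp
    qed
    have atom_int: "(\<integral>x. indicator A x * h x \<partial>M) = (\<Sum>x\<in>A. h x * (measure M A / real (card A)))"
      if A: "finite_atom M A" for A
    proof -
      obtain y where y: "y \<in> A" using finite_atom_nonempty[OF A] by blast
      have hy: "h x = h y" if "x \<in> A" for x
        using finite_atom_constant[OF A _ that y] h(1) by auto
      have "(\<integral>x. indicator A x * h x \<partial>M) = (\<integral>x. h y * indicator A x \<partial>M)"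
        by (intro Bochner_Integration.integral_cong) (auto simp: indicator_def hy)
      also have "\<dots> = h y * measure M A"
        using finite_atomD(1)[OF A] sets.sets_into_space by (simp add: Int_absorb2)
      also have "\<dots> = (\<Sum>x\<in>A. h y * (measure M A / real (card A)))"
        using y finite_atomD(2)[OF A] by auto
      also have "\<dots> = (\<Sum>x\<in>A. h x * (measure M A / real (card A)))"
        by (intro sum.cong) (auto simp: hy)
      finally show ?thesis .
    qed
    have disj: "A \<inter> B = {}" if "A \<in> \<A>" "B \<in> \<A>" "A \<noteq> B" for A B
      using finite_atom_unique \<A> that by (metis disjoint_iff)
    have int: "integrable M (\<lambda>x. indicator A x * h x)" if "A \<in> sets M" for A
      using integrable_mult_indicator[OF that h(1)] by simp
    have "block_sum \<alpha> P (\<lambda>x. indicator ?L x * h x * w x) z = (\<Sum>x\<in>z \<inter> ?L \<inter> D. h x * w x)"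
      unfolding block_sum_eq[OF z]
    proof (rule sum.mono_neutral_cong_right[OF fin(1)])
      show "\<forall>x\<in>z - z \<inter> ?L \<inter> D. indicator ?L x * h x * w x / real (card (z \<inter> block x)) = 0"
        using light_not_D z by (auto simp: indicator_def Fpow_def)
      show "indicator ?L x * h x * w x / real (card (z \<inter> block x)) = h x * w x"
        if "x \<in> z \<inter> ?L \<inter> D" for x
        using that block[of x] by simp
    qed auto
    also have "\<dots> \<le> (\<Sum>x\<in>\<Union>\<A>. h x * w x)"
    proof (rule sum_mono2)
      show "finite (\<Union>\<A>)" using fin(2) \<A>[THEN finite_atomD(2)] by (rule finite_Union)
      show "z \<inter> ?L \<inter> D \<subseteq> \<Union>\<A>" using atom(2) by (auto simp: \<A>_def)
    qed (use h in \<open>auto simp: w_def\<close>)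
    also have "\<dots> = (\<Sum>A\<in>\<A>. \<Sum>x\<in>A. h x * w x)"
    proof (rule sum.Union_disjoint[unfolded comp_def])
      show "\<forall>A\<in>\<A>. finite A" using \<A> finite_atomD(2) by blast
      show "\<forall>A\<in>\<A>. \<forall>B\<in>\<A>. A \<noteq> B \<longrightarrow> A \<inter> B = {}" using disj by blast
    qed
    also have "\<dots> = (\<Sum>A\<in>\<A>. \<Sum>x\<in>A. h x * (measure M A / real (card A)))"
    proof (intro sum.cong refl)
      fix A x assume "A \<in> \<A>" "x \<in> A"
      then have "atom x = A" "x \<in> D" using atom_eq \<A> atom_D by blast+
      then show "h x * w x = h x * (measure M A / real (card A))" by (simp add: w_def)
    qed
    also have "\<dots> = (\<Sum>A\<in>\<A>. \<integral>x. indicator A x * h x \<partial>M)"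
      using atom_int \<A> by simp
    also have "\<dots> = (\<integral>x. (\<Sum>A\<in>\<A>. indicator A x * h x) \<partial>M)"
      by (rule Bochner_Integration.integral_sum[symmetric]) (use int \<A> finite_atomD(1) in blast)
    also have "\<dots> \<le> (\<integral>x. indicator ?L x * h x \<partial>M)"
    proof (rule integral_mono)
      show "integrable M (\<lambda>x. \<Sum>A\<in>\<A>. indicator A x * h x)"
        by (rule Bochner_Integration.integrable_sum) (use int \<A> finite_atomD(1) in blast)
      show "integrable M (\<lambda>x. indicator ?L x * h x)" by (rule int) simp
      fix x assume "x \<in> space M"
      show "(\<Sum>A\<in>\<A>. indicator A x * h x) \<le> indicator ?L x * h x"
      proof (cases "x \<in> \<Union>\<A>")
        case True
        then obtain A where A: "A \<in> \<A>" "x \<in> A" by blast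
        have "(\<Sum>B\<in>\<A>. indicator B x * h x) = (\<Sum>B\<in>\<A>. if B = A then h x else 0)"
          using disj[OF _ A(1)] A by (intro sum.cong) (auto simp: indicator_def)
        also have "\<dots> = h x" using A fin(2) by (simp add: sum.delta)
        finally show ?thesis using \<A>_light[OF A(1)] A(2) by auto
      next
        case False
        then have "(\<Sum>B\<in>\<A>. indicator B x * h x) = 0" by (intro sum.neutral) auto
        then show ?thesis using h(2)[of x] by simp
      qed
    qed
    finally show "block_sum \<alpha> P (\<lambda>x. indicator ?L x * h x * w x) z \<le> (\<integral>x. indicator ?L x * h x \<partial>M)" .
  next
    let ?\<A> = "{A. finite_atom M A}"
    have H_exact: "exactly_weighed w (H i)" for i
    proof (cases "H i = {}")
      case True
      then show ?thesis
        using exactly_weighed_Union[of "{}" w] by (simp add: disjoint_def)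
    next
      case False
      then obtain x where x: "x \<in> H i" by blast
      have H_space: "H i \<subseteq> space M" using H_sets sets.sets_into_space by blast
      have "block_sum \<alpha> P (\<lambda>y. indicator (H i) y * w y) z = measure M (H i)"
        if z: "z \<in> Fpow (space M)" "{x} \<subseteq> z" for z
      proof -
        have fin: "finite z" using z by (simp add: Fpow_def)
        have "block_sum \<alpha> P (\<lambda>y. indicator (H i) y * w y) z =
            (\<Sum>y\<in>z \<inter> H i. measure M (H i) / real (card (z \<inter> H i)))"
          unfolding block_sum_eq[OF z(1)]
        proof (rule sum.mono_neutral_cong_right[OF fin])
          fix y assume y: "y \<in> z \<inter> H i"
          then have "y \<notin> D" "y \<in> space M" "cell y = i" using H_space cell_eq by (auto simp: H_def)
          then show "indicator (H i) y * w y / real (card (z \<inter> block y)) =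
              measure M (H i) / real (card (z \<inter> H i))"
            using y block[of y] by (simp add: w_def)
        qed auto
        also have "\<dots> = measure M (H i)"
          using x z fin by (auto simp: card_gt_0_iff)
        finally show ?thesis .
      qed
      moreover have "{x} \<in> Fpow (space M)" using x H_space by (auto simp: Fpow_def)
      ultimately show ?thesis using H_sets H_fin unfolding exactly_weighed_def by blast
    qed
    have atom_exact: "exactly_weighed w A" if A: "finite_atom M A" for A
    proof -
      have A_space: "A \<subseteq> space M" using atom_D[OF A] D_space by blast
      have "block_sum \<alpha> P (\<lambda>y. indicator A y * w y) z = measure M A"
        if z: "z \<in> Fpow (space M)" "A \<subseteq> z" for z
      proof -
        have fin: "finite z" using z by (simp add: Fpow_def)
        have "block_sum \<alpha> P (\<lambda>y. indicator A y * w y) z = (\<Sum>y\<in>A. measure M A / real (card A))"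
          unfolding block_sum_eq[OF z(1)]
        proof (rule sum.mono_neutral_cong_right[OF fin z(2)])
          fix y assume y: "y \<in> A"
          then have "y \<in> D" "y \<in> space M" "atom y = A" "y \<in> z"
            using A_space atom_D[OF A] atom_eq[OF A] z(2) by auto
          then show "indicator A y * w y / real (card (z \<inter> block y)) = measure M A / real (card A)"
            using y block[of y] by (simp add: w_def)
        qed auto
        also have "\<dots> = measure M A"
          using finite_atomD(2)[OF A] finite_atom_nonempty[OF A] by simp
        finally show ?thesis .
      qed
      moreover have "A \<in> Fpow (space M)" using A_space finite_atomD(2)[OF A] by (auto simp: Fpow_def)
      ultimately show ?thesis
        using finite_atomD(1)[OF A] finite_atom_finite_measure[OF A] unfolding exactly_weighed_def by blast
    qed
    \<comment> \<open>The exhausting sets are finite unions of pieces \<open>H i\<close> and of atoms.\<close>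
    define \<C> where "\<C> n = H ` {..<n} \<union> {A \<in> ?\<A>. to_nat_on ?\<A> A < n}" for n
    have \<C>_exact: "exactly_weighed w (\<Union>(\<C> n))" for n
    proof (rule exactly_weighed_Union)
      have "finite {A \<in> ?\<A>. to_nat_on ?\<A> A < n}"
      proof (rule finite_imageD)
        show "finite (to_nat_on ?\<A> ` {A \<in> ?\<A>. to_nat_on ?\<A> A < n})"
          by (rule finite_subset[of _ "{..<n}"]) auto
        show "inj_on (to_nat_on ?\<A>) {A \<in> ?\<A>. to_nat_on ?\<A> A < n}"
          by (rule inj_on_subset[OF inj_on_to_nat_on[OF countable_finite_atoms]]) auto
      qed
      then show "finite (\<C> n)" by (simp add: \<C>_def)
      show "disjoint (\<C> n)"
        unfolding disjoint_def
      proof (intro ballI impI)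
        fix A B assume AB: "A \<in> \<C> n" "B \<in> \<C> n" "A \<noteq> B"
        have cases: "(\<exists>i. A = H i) \<or> finite_atom M A" "(\<exists>i. B = H i) \<or> finite_atom M B"
          using AB by (auto simp: \<C>_def)
        have "x \<notin> B" if "x \<in> A" for x
          using cases that AB(3) H_disj[of _ _] H_D atom_D[of A] atom_D[of B] finite_atom_unique[of M A B x]
          by (elim disjE exE; metis disjoint_iff subsetD)
        then show "A \<inter> B = {}" by blast
      qed
      show "exactly_weighed w A" if "A \<in> \<C> n" for A
        using that H_exact atom_exact by (auto simp: \<C>_def)
    qed
    moreover have "incseq (\<lambda>n. \<Union>(\<C> n))"
      by (rule monoI) (force simp: \<C>_def)
    moreover have "(\<Union>n. \<Union>(\<C> n)) = space M"
    proof
      show "(\<Union>n. \<Union>(\<C> n)) \<subseteq> space M"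
      proof -
        have "H i \<subseteq> space M" for i using H_UN by blast
        moreover have "A \<subseteq> space M" if "finite_atom M A" for A using atom_D[OF that] D_space by blast
        ultimately show ?thesis unfolding \<C>_def by blast
      qed
      show "space M \<subseteq> (\<Union>n. \<Union>(\<C> n))"
      proof
        fix x assume x: "x \<in> space M"
        show "x \<in> (\<Union>n. \<Union>(\<C> n))"
        proof (cases "x \<in> D")
          case True
          then have "atom x \<in> \<C> (Suc (to_nat_on ?\<A> (atom x)))" using atom by (simp add: \<C>_def)
          then show ?thesis using atom(2)[OF True] by blast
        next
          case False
          then have "H (cell x) \<in> \<C> (Suc (cell x))" by (simp add: \<C>_def)
          then show ?thesis using cell[of x] x False by blast
        qed
      qed
    qed
    ultimately show "\<exists>E. incseq E \<and> (\<Union>n. E n) = space M \<and> (\<forall>n. exactly_weighed w (E n))"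
      by blast
  qed
  have const: "w constant_on P i" if i: "enat i < \<alpha>" for i
    unfolding constant_on_def
  proof (cases "P i = {}")
    case False
    then obtain x where x: "x \<in> P i" by blast
    have "w y = w x" if "y \<in> P i" for y
    proof -
      have sp: "x \<in> space M" "y \<in> space M" using x that block_subset_space[OF i] by auto
      have eq: "block x = P i" "block y = P i" using block_eq[OF i] x that by simp_all
      show ?thesis
      proof (cases "x \<in> D")
        case True
        then have "P i = {x}" using block[OF sp(1)] eq(1) by simp
        then show ?thesis using that by simp
      next
        case False
        then have "y \<in> H (cell x)" using block[OF sp(1)] eq(1) that by simp
        then show ?thesis using False cell_eq H_D by (simp add: w_def)
      qed
    qed
    then show "\<exists>c. \<forall>y\<in>P i. w y = c" by blast
  qed simp
  have "\<not> point_mass M x" if "x \<in> P 0" for x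
  proof
    assume "point_mass M x"
    then obtain B where B: "B \<subseteq> {x}" "finite_atom M B"
      using finite_set_contains_atom[of "{x}" M] by (auto simp: point_mass_def)
    then have "x \<in> D" using finite_atom_nonempty[OF B(2)] atom_D[OF B(2)] by blast
    then show False using that P(2) by (simp add: H_def)
  qed
  moreover have "is_singleton (P i)" if "emeasure M (space M) < \<infinity>" "0 < i" "enat i < \<alpha>" for i
  proof -
    have "P i \<in> \<B>" using that P(4) by blast
    then show ?thesis using Q(5)[OF that(1)] by (auto simp: \<B>_def H_def)
  qed
  ultimately show ?thesis using adapted const by blast
qed


section \<open>A calculus of definability\<close>

text \<open>
  Predicates are represented by their meaning in all universes at once, and formulas appear only as
  witnesses.  Under a quantifier the environment is shifted by one, as with de Bruijn indices, so that
  the rules below can be applied backwards to a predicate written in ordinary logical notation.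
\<close>

definition expressible :: "(('v \<Rightarrow> 'v set) \<Rightarrow> (nat \<Rightarrow> 'v) \<Rightarrow> bool) \<Rightarrow> bool" where
  "expressible R \<longleftrightarrow> (\<exists>\<phi>. \<forall>E. set_universe E \<longrightarrow> (\<forall>e. sat E e \<phi> \<longleftrightarrow> R E e))"

lemma sat_cong_bounded: "\<exists>b. \<forall>E (e :: nat \<Rightarrow> 'v) e'. (\<forall>i<b. e i = e' i) \<longrightarrow> sat E e \<phi> = sat E e' \<phi>"
proof (induction \<phi>)
  case (Mem i j)
  show ?case by (rule exI[of _ "Suc (max i j)"]) auto
next
  case (Equal i j)
  show ?case by (rule exI[of _ "Suc (max i j)"]) auto
next
  case (Neg \<phi>)
  then show ?case by simp
next
  case (Conj \<phi> \<psi>)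
  then obtain b b' where
    "\<forall>E (e :: nat \<Rightarrow> 'v) e'. (\<forall>i<b. e i = e' i) \<longrightarrow> sat E e \<phi> = sat E e' \<phi>"
    "\<forall>E (e :: nat \<Rightarrow> 'v) e'. (\<forall>i<b'. e i = e' i) \<longrightarrow> sat E e \<psi> = sat E e' \<psi>"
    by blast
  then show ?case
    by (intro exI[of _ "max b b'"]) (metis less_max_iff_disj sat.simps(4))
next
  case (Exi i \<phi>)
  then obtain b where b:
    "\<forall>E (e :: nat \<Rightarrow> 'v) e'. (\<forall>i<b. e i = e' i) \<longrightarrow> sat E e \<phi> = sat E e' \<phi>" by blast
  have "sat E (e(i := x)) \<phi> = sat E (e'(i := x)) \<phi>" if "\<forall>k<b. e k = e' k"
    for E and e e' :: "nat \<Rightarrow> 'v" and x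
    using b that by simp
  then show ?case by (intro exI[of _ b]) (simp, blast)
qed

text \<open>
  The bound variable has to be replaced by one that the renaming does not hit; only finitely many
  values of the renaming matter, by \<open>sat_cong_bounded\<close>.
\<close>

lemma rename_formula: "\<exists>\<psi>. \<forall>E (e :: nat \<Rightarrow> 'v). sat E e \<psi> \<longleftrightarrow> sat E (\<lambda>n. e (f n)) \<phi>"
proof (induction \<phi> arbitrary: f)
  case (Mem i j)
  show ?case by (rule exI[of _ "Mem (f i) (f j)"]) simp
next
  case (Equal i j)
  show ?case by (rule exI[of _ "Equal (f i) (f j)"]) simp
next
  case (Neg \<phi>)
  then obtain \<psi> where "\<forall>E (e :: nat \<Rightarrow> 'v). sat E e \<psi> \<longleftrightarrow> sat E (\<lambda>n. e (f n)) \<phi>" by blast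
  then show ?case by (intro exI[of _ "Neg \<psi>"]) simp
next
  case (Conj \<phi> \<phi>')
  then obtain \<psi> \<psi>' where "\<forall>E (e :: nat \<Rightarrow> 'v). sat E e \<psi> \<longleftrightarrow> sat E (\<lambda>n. e (f n)) \<phi>"
    "\<forall>E (e :: nat \<Rightarrow> 'v). sat E e \<psi>' \<longleftrightarrow> sat E (\<lambda>n. e (f n)) \<phi>'" by blast
  then show ?case by (intro exI[of _ "Conj \<psi> \<psi>'"]) simp
next
  case (Exi i \<phi>)
  obtain b where b:
    "\<And>E (e :: nat \<Rightarrow> 'v) e'. (\<forall>i<b. e i = e' i) \<Longrightarrow> sat E e \<phi> = sat E e' \<phi>"
    using sat_cong_bounded by metis
  define j where "j = Suc (Max (f ` {..b}))"
  have fresh: "f k \<noteq> j" if "k < b" for k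
    using that Max_ge[of "f ` {..b}" "f k"] unfolding j_def by fastforce
  obtain \<psi> where \<psi>: "\<And>E (e :: nat \<Rightarrow> 'v). sat E e \<psi> \<longleftrightarrow> sat E (\<lambda>n. e ((f(i := j)) n)) \<phi>"
    using Exi by blast
  have "sat E (e(j := x)) \<psi> \<longleftrightarrow> sat E ((\<lambda>n. e (f n))(i := x)) \<phi>" for E and e :: "nat \<Rightarrow> 'v" and x
    unfolding \<psi> by (rule b) (auto simp: fresh)
  then show ?case by (intro exI[of _ "Exi j \<psi>"]) simp
qed

lemma expressible_rename: "expressible R \<Longrightarrow> expressible (\<lambda>E e. R E (\<lambda>n. e (f n)))"
  unfolding expressible_def by (metis rename_formula)

lemma expressible_cong:
  "expressible R' \<Longrightarrow> (\<And>E e. set_universe E \<Longrightarrow> R E e \<longleftrightarrow> R' E e) \<Longrightarrow> expressible R"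
  unfolding expressible_def by meson

lemma expressible_not: "expressible R \<Longrightarrow> expressible (\<lambda>E e. \<not> R E e)"
  unfolding expressible_def by (metis sat.simps(3))

lemma expressible_conj:
  "expressible R \<Longrightarrow> expressible R' \<Longrightarrow> expressible (\<lambda>E e. R E e \<and> R' E e)"
  unfolding expressible_def by (metis sat.simps(4))

lemma expressible_disj:
  "expressible R \<Longrightarrow> expressible R' \<Longrightarrow> expressible (\<lambda>E e. R E e \<or> R' E e)"
  unfolding expressible_def
  by (metis sat.simps(3) sat.simps(4))

lemma expressible_imp:
  "expressible R \<Longrightarrow> expressible R' \<Longrightarrow> expressible (\<lambda>E e. R E e \<longrightarrow> R' E e)"
  unfolding imp_conv_disj by (intro expressible_disj expressible_not)

lemma expressible_iff:
  "expressible R \<Longrightarrow> expressible R' \<Longrightarrow> expressible (\<lambda>E e. R E e \<longleftrightarrow> R' E e)"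
  unfolding iff_conv_conj_imp by (intro expressible_conj expressible_imp)

lemma expressible_ex:
  fixes Q :: "('v \<Rightarrow> 'v set) \<Rightarrow> (nat \<Rightarrow> 'v) \<Rightarrow> 'v \<Rightarrow> bool"
  assumes "expressible (\<lambda>E e. Q E (\<lambda>n. e (Suc n)) (e 0))"
  shows "expressible (\<lambda>E e. \<exists>x. Q E e x)"
proof -
  from assms obtain \<phi> where \<phi>:
    "\<And>E e. set_universe E \<Longrightarrow> sat E e \<phi> \<longleftrightarrow> Q E (\<lambda>n. e (Suc n)) (e 0)"
    unfolding expressible_def by blast
  obtain b where b:
    "\<And>E (e :: nat \<Rightarrow> 'v) e'. (\<forall>i<b. e i = e' i) \<Longrightarrow> sat E e \<phi> = sat E e' \<phi>"
    using sat_cong_bounded by metis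
  define f where "f = case_nat b id"
  obtain \<psi> where \<psi>: "\<And>E (e :: nat \<Rightarrow> 'v). sat E e \<psi> \<longleftrightarrow> sat E (\<lambda>n. e (f n)) \<phi>"
    using rename_formula by blast
  have "sat E (e(b := x)) \<psi> \<longleftrightarrow> Q E e x" if "set_universe E" for E e x
  proof -
    have "sat E (e(b := x)) \<psi> \<longleftrightarrow> sat E (case_nat x e) \<phi>"
      unfolding \<psi> by (rule b) (auto simp: f_def split: nat.split)
    then show ?thesis using \<phi>[OF that, of "case_nat x e"] by simp
  qed
  then show ?thesis
    unfolding expressible_def by (intro exI[of _ "Exi b \<psi>"]) simp
qed

lemma expressible_all:
  assumes "expressible (\<lambda>E e. Q E (\<lambda>n. e (Suc n)) (e 0))"
  shows "expressible (\<lambda>E e. \<forall>x. Q E e x)"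
proof -
  have "expressible (\<lambda>E e. \<not> (\<exists>x. \<not> Q E e x))"
    by (rule expressible_not[OF expressible_ex[OF expressible_not[OF assms]]])
  then show ?thesis by simp
qed

text \<open>
  A term is definable if its graph is; the value is put into variable 0.
\<close>

definition definable_term :: "(('v \<Rightarrow> 'v set) \<Rightarrow> (nat \<Rightarrow> 'v) \<Rightarrow> 'v) \<Rightarrow> bool" where
  "definable_term t \<longleftrightarrow> expressible (\<lambda>E e. t E (\<lambda>n. e (Suc n)) = e 0)"

lemma definable_term_var: "definable_term (\<lambda>E e. e k)"
  unfolding definable_term_def expressible_def by (intro exI[of _ "Equal (Suc k) 0"]) simp

text \<open>
  Definable terms may be substituted, since \<open>Q (t)\<close> says that some \<open>x\<close> equals \<open>t\<close> and satisfies \<open>Q\<close>.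
\<close>

lemma expressible_subst:
  assumes "definable_term t" "expressible (\<lambda>E e. Q E (\<lambda>n. e (Suc n)) (e 0))"
  shows "expressible (\<lambda>E e. Q E e (t E e))"
proof -
  have "expressible (\<lambda>E e. \<exists>x. t E e = x \<and> Q E e x)"
    by (rule expressible_ex[OF expressible_conj[OF assms(1)[unfolded definable_term_def] assms(2)]])
  then show ?thesis by simp
qed

lemma definable_term_shift:
  "definable_term t \<Longrightarrow> definable_term (\<lambda>E e. t E (\<lambda>n. e (f n)))"
  using expressible_rename[of "\<lambda>E e. t E (\<lambda>n. e (Suc n)) = e 0" "case_nat 0 (\<lambda>n. Suc (f n))"]
  unfolding definable_term_def by simp

lemma expressible_mem:
  assumes s: "definable_term s" and t: "definable_term t"
  shows "expressible (\<lambda>E e. s E e \<in> E (t E e))"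
proof -
  have "expressible (\<lambda>E e. e (Suc 0) \<in> E (e 0))"
    unfolding expressible_def by (rule exI[of _ "Mem 1 0"]) simp
  then have "expressible (\<lambda>E e. e 0 \<in> E (t E (\<lambda>n. e (Suc n))))"
    by (rule expressible_subst[OF definable_term_shift[OF t], of "\<lambda>E e x. e 0 \<in> E x"])
  then show ?thesis
    by (rule expressible_subst[OF s, of "\<lambda>E e x. x \<in> E (t E e)"])
qed

lemma expressible_eq:
  assumes s: "definable_term s" and t: "definable_term t"
  shows "expressible (\<lambda>E e. s E e = t E e)"
proof -
  have "expressible (\<lambda>E e. e (Suc 0) = e 0)"
    unfolding expressible_def by (rule exI[of _ "Equal 1 0"]) simp
  then have "expressible (\<lambda>E e. e 0 = t E (\<lambda>n. e (Suc n)))"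
    by (rule expressible_subst[OF definable_term_shift[OF t], of "\<lambda>E e x. e 0 = x"])
  then show ?thesis
    by (rule expressible_subst[OF s, of "\<lambda>E e x. x = t E e"])
qed

lemma expressible_ball:
  assumes "definable_term t" "expressible (\<lambda>E e. Q E (\<lambda>n. e (Suc n)) (e 0))"
  shows "expressible (\<lambda>E e. \<forall>x\<in>E (t E e). Q E e x)"
  unfolding Ball_def
  by (intro expressible_all expressible_imp expressible_mem definable_term_var
      definable_term_shift[OF assms(1)] assms(2))

lemma expressible_bex:
  assumes "definable_term t" "expressible (\<lambda>E e. Q E (\<lambda>n. e (Suc n)) (e 0))"
  shows "expressible (\<lambda>E e. \<exists>x\<in>E (t E e). Q E e x)"
  unfolding Bex_def
  by (intro expressible_ex expressible_conj expressible_mem definable_term_var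
      definable_term_shift[OF assms(1)] assms(2))

lemma expressible_subset:
  assumes "definable_term s" "definable_term t"
  shows "expressible (\<lambda>E e. E (s E e) \<subseteq> E (t E e))"
  unfolding subset_eq
  by (intro expressible_ball expressible_mem definable_term_var assms[THEN definable_term_shift])

context set_universe
begin

definition small :: "'v set \<Rightarrow> bool" where
  "small A \<longleftrightarrow> (\<exists>x. elts x = A)"

lemma elts_mk: "small A \<Longrightarrow> elts (mk A) = A"
  unfolding small_def mk_def by (metis (mono_tags, lifting) extensionality theI)

lemma mk_eq_iff: "small A \<Longrightarrow> mk A = y \<longleftrightarrow> elts y = A"
  using elts_mk extensionality by metis

lemma small_elts [simp]: "small (elts x)"
  by (auto simp: small_def)

lemma mk_elts [simp]: "mk (elts x) = x"
  by (simp add: mk_eq_iff)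

lemma small_subset: "small B \<Longrightarrow> A \<subseteq> B \<Longrightarrow> small A"
  unfolding small_def using separation by metis

lemma small_image: "small A \<Longrightarrow> small (f ` A)"
  unfolding small_def using replacement by metis

lemma small_pair [simp]: "small {x, y}"
  unfolding small_def by (rule pairing)

lemma small_singleton [simp]: "small {x}"
  using small_pair[of x x] by simp

lemma small_empty [simp]: "small {}"
  using small_subset[OF small_singleton] by blast

lemma small_UN:
  assumes "small A" "\<And>x. x \<in> A \<Longrightarrow> small (B x)"
  shows "small (\<Union>x\<in>A. B x)"
proof -
  obtain y where y: "elts y = (\<lambda>x. mk (B x)) ` A"
    using small_image[OF assms(1)] unfolding small_def by blast
  obtain u where "elts u = (\<Union>w\<in>elts y. elts w)"
    using union by blast
  then have "elts u = (\<Union>x\<in>A. B x)"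
    using assms(2) by (simp add: y elts_mk)
  then show ?thesis unfolding small_def by blast
qed

lemma small_Un: "small A \<Longrightarrow> small B \<Longrightarrow> small (A \<union> B)"
  using small_UN[of "{mk A, mk B}" elts] by (simp add: elts_mk)

lemma small_insert: "small A \<Longrightarrow> small (insert x A)"
  using small_Un[OF small_singleton] by simp

lemma kpair_inject [simp]: "kpair a b = kpair c d \<longleftrightarrow> a = c \<and> b = d"
proof
  assume "kpair a b = kpair c d"
  then have "elts (kpair a b) = elts (kpair c d)" by simp
  then have "{mk {a}, mk {a, b}} = {mk {c}, mk {c, d}}"
    unfolding kpair_def by (simp add: elts_mk)
  then have "elts ` {mk {a}, mk {a, b}} = elts ` {mk {c}, mk {c, d}}" by simp
  then have "{{a}, {a, b}} = {{c}, {c, d}}" by (simp add: elts_mk)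
  then show "a = c \<and> b = d" by (auto simp: doubleton_eq_iff)
qed auto

end

lemma definable_term_mk:
  assumes t: "\<And>E e. set_universe E \<Longrightarrow> t E e = set_universe.mk E {x. Q E e x}"
    and small: "\<And>E e. set_universe E \<Longrightarrow> set_universe.small E {x. Q E e x}"
    and Q: "expressible (\<lambda>E e. Q E (\<lambda>n. e (Suc n)) (e 0))"
  shows "definable_term t"
proof -
  have "expressible (\<lambda>E e. \<forall>x. x \<in> E (e 0) \<longleftrightarrow> Q E (\<lambda>n. e (Suc n)) x)"
    by (intro expressible_all expressible_iff expressible_mem definable_term_var)
      (use expressible_rename[OF Q, of "case_nat 0 (\<lambda>n. Suc (Suc n))"] in simp)
  then show ?thesis unfolding definable_term_def
    by (rule expressible_cong) (auto simp: t small set_universe.mk_eq_iff)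
qed

lemma definable_term_pair:
  assumes "definable_term s" "definable_term t"
  shows "definable_term (\<lambda>E e. set_universe.mk E {s E e, t E e})"
proof (rule definable_term_mk)
  show "set_universe.mk E {s E e, t E e} = set_universe.mk E {x. x = s E e \<or> x = t E e}" for E e
    by (rule arg_cong[where f = "set_universe.mk E"]) auto
  have "{x. x = s E e \<or> x = t E e} = {s E e, t E e}" for E e by auto
  then show "set_universe E \<Longrightarrow> set_universe.small E {x. x = s E e \<or> x = t E e}" for E e
    by (simp add: set_universe.small_pair)
qed (intro expressible_disj expressible_eq definable_term_var assms[THEN definable_term_shift])

lemma definable_term_kpair:
  assumes "definable_term s" "definable_term t"
  shows "definable_term (\<lambda>E e. set_universe.kpair E (s E e) (t E e))"
proof -
  have "definable_term (\<lambda>E e. set_universe.mk E {set_universe.mk E {s E e, s E e},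
    set_universe.mk E {s E e, t E e}})"
    by (intro definable_term_pair assms)
  moreover have "expressible (\<lambda>E e. set_universe.kpair E (s E (\<lambda>n. e (Suc n))) (t E (\<lambda>n. e (Suc n))) = e 0)"
    using calculation unfolding definable_term_def
    by (rule expressible_cong) (simp add: set_universe.kpair_def)
  ultimately show ?thesis unfolding definable_term_def by blast
qed

lemmas definability_intros =
  expressible_not expressible_conj expressible_disj expressible_imp expressible_iff
  expressible_ex expressible_all expressible_ball expressible_bex expressible_mem expressible_eq
  expressible_subset definable_term_var definable_term_kpair


section \<open>The defining formula\<close>

context set_universe
begin

lemma not_mem_self: "x \<notin> elts x"
proof
  assume "x \<in> elts x"
  then have "(x, x) \<in> {(x, y). x \<in> elts y}" by simp
  then show False using foundation wf_not_refl by metis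
qed

lemma small_finite: "finite A \<Longrightarrow> small A"
  by (induction rule: finite_induct) (auto intro: small_insert)

lemma elts_nat_code: "elts (nat_code n) = nat_code ` {..<n}"
proof (induction n)
  case (Suc n)
  have "small (insert (nat_code n) (elts (nat_code n)))" by (simp add: small_insert)
  then show ?case using Suc by (simp add: elts_mk lessThan_Suc)
qed (simp add: elts_mk)

lemma nat_code_inject [simp]: "nat_code m = nat_code n \<longleftrightarrow> m = n"
proof -
  have "nat_code m \<noteq> nat_code n" if "m < n" for m n
    using that not_mem_self[of "nat_code n"] elts_nat_code[of n] by (metis imageI lessThan_iff)
  then show ?thesis by (metis linorder_neqE_nat)
qed

lemma inj_nat_code: "inj_on nat_code A"
  by (simp add: inj_on_def)

lemma nat_code_mem_iff [simp]: "nat_code m \<in> elts (nat_code n) \<longleftrightarrow> m < n"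
  by (auto simp: elts_nat_code)

lemma mem_nat_code_iff: "x \<in> elts (nat_code n) \<longleftrightarrow> (\<exists>m<n. x = nat_code m)"
  by (auto simp: elts_nat_code)

lemma finite_nat_code [simp]: "finite (elts (nat_code n))"
  by (simp add: elts_nat_code)

lemma card_nat_code [simp]: "card (elts (nat_code n)) = n"
  by (simp add: elts_nat_code card_image inj_nat_code)

lemma small_range_nat_code: "small (range nat_code)"
proof -
  obtain x where "infinite (elts x)" using infinity by blast
  then obtain f :: "nat \<Rightarrow> 'v" where f: "inj f" "range f \<subseteq> elts x"
    using infinite_countable_subset by blast
  have "small (range f)" using f(2) by (rule small_subset[OF small_elts])
  then have "small ((\<lambda>u. nat_code (inv f u)) ` range f)" by (rule small_image)
  moreover have "(\<lambda>u. nat_code (inv f u)) ` range f = range nat_code"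
    using f(1) by (simp add: image_image)
  ultimately show ?thesis by simp
qed

definition \<omega> :: 'v where "\<omega> = mk (range nat_code)"

lemma elts_\<omega>: "elts \<omega> = range nat_code"
  by (simp add: \<omega>_def elts_mk small_range_nat_code)

definition successor_closed :: "'v \<Rightarrow> bool" where
  "successor_closed w \<longleftrightarrow> (\<exists>x\<in>elts w. \<forall>y. y \<notin> elts x) \<and>
     (\<forall>x\<in>elts w. \<exists>y\<in>elts w. \<forall>u. u \<in> elts y \<longleftrightarrow> u \<in> elts x \<or> u = x)"

lemma least_successor_closed: "{x. \<forall>w. successor_closed w \<longrightarrow> x \<in> elts w} = range nat_code"
proof -
  have "nat_code n \<in> elts w" if w: "successor_closed w" for n w
  proof (induction n)
    case 0
    obtain x where "x \<in> elts w" "elts x = {}"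
      using w unfolding successor_closed_def by blast
    moreover have "nat_code 0 = x" using calculation by (simp add: mk_eq_iff)
    ultimately show ?case by simp
  next
    case (Suc n)
    then obtain y where "y \<in> elts w" "elts y = insert (nat_code n) (elts (nat_code n))"
      using w unfolding successor_closed_def by blast
    moreover have "nat_code (Suc n) = y" using calculation by (simp add: mk_eq_iff small_insert)
    ultimately show ?case by simp
  qed
  moreover have "successor_closed \<omega>"
    unfolding successor_closed_def
  proof
    show "\<exists>x\<in>elts \<omega>. \<forall>y. y \<notin> elts x"
      by (rule bexI[of _ "nat_code 0"]) (simp_all add: elts_\<omega> elts_nat_code del: nat_code.simps)
    show "\<forall>x\<in>elts \<omega>. \<exists>y\<in>elts \<omega>. \<forall>u. u \<in> elts y \<longleftrightarrow> u \<in> elts x \<or> u = x"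
    proof
      fix x assume "x \<in> elts \<omega>"
      then obtain n where "x = nat_code n" by (auto simp: elts_\<omega>)
      then show "\<exists>y\<in>elts \<omega>. \<forall>u. u \<in> elts y \<longleftrightarrow> u \<in> elts x \<or> u = x"
        by (intro bexI[of _ "nat_code (Suc n)"])
          (auto simp add: elts_\<omega> elts_nat_code lessThan_Suc simp del: nat_code.simps)
    qed
  qed
  ultimately show ?thesis
    using elts_\<omega> by blast
qed

definition product :: "'v \<Rightarrow> 'v \<Rightarrow> 'v" where
  "product x y = mk {w. \<exists>u\<in>elts x. \<exists>v\<in>elts y. w = kpair u v}"

lemma product_collect_eq:
  "{w. \<exists>u\<in>elts x. \<exists>v\<in>elts y. w = kpair u v} = (\<lambda>(u, v). kpair u v) ` (elts x \<times> elts y)"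
  by auto

lemma small_product: "small {w. \<exists>u\<in>elts x. \<exists>v\<in>elts y. w = kpair u v}"
proof -
  have "small (\<Union>u\<in>elts x. kpair u ` elts y)"
    by (intro small_UN small_image small_elts)
  then show ?thesis by (rule small_subset) auto
qed

lemma elts_product: "elts (product x y) = (\<lambda>(u, v). kpair u v) ` (elts x \<times> elts y)"
  unfolding product_def using elts_mk[OF small_product] product_collect_eq by metis

lemma finite_product [simp]: "finite (elts x) \<Longrightarrow> finite (elts y) \<Longrightarrow> finite (elts (product x y))"
  by (simp add: elts_product)

lemma card_product [simp]: "card (elts (product x y)) = card (elts x) * card (elts y)"
proof -
  have "inj_on (\<lambda>(u, v). kpair u v) (elts x \<times> elts y)" by (auto simp: inj_on_def)
  then show ?thesis by (simp add: elts_product card_image card_cartesian_product)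
qed

text \<open>
  A relation that is total on \<open>x\<close> and left-unique contains the graph of an injection.
\<close>

definition embeds :: "'v \<Rightarrow> 'v \<Rightarrow> bool" where
  "embeds x y \<longleftrightarrow> (\<exists>g. (\<forall>u\<in>elts x. \<exists>v\<in>elts y. kpair u v \<in> elts g) \<and>
     (\<forall>u u' v. kpair u v \<in> elts g \<and> kpair u' v \<in> elts g \<longrightarrow> u = u'))"

lemma embeds_iff_inj_on: "embeds x y \<longleftrightarrow> (\<exists>f. inj_on f (elts x) \<and> f ` elts x \<subseteq> elts y)"
proof
  assume "embeds x y"
  then obtain g where g: "\<forall>u\<in>elts x. \<exists>v\<in>elts y. kpair u v \<in> elts g"
    "\<And>u u' v. kpair u v \<in> elts g \<Longrightarrow> kpair u' v \<in> elts g \<Longrightarrow> u = u'"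
    unfolding embeds_def by blast
  then obtain f where "\<forall>u\<in>elts x. f u \<in> elts y \<and> kpair u (f u) \<in> elts g" by metis
  then show "\<exists>f. inj_on f (elts x) \<and> f ` elts x \<subseteq> elts y"
    by (intro exI[of _ f]) (metis g(2) image_subsetI inj_onI)
next
  assume "\<exists>f. inj_on f (elts x) \<and> f ` elts x \<subseteq> elts y"
  then obtain f where f: "inj_on f (elts x)" "f ` elts x \<subseteq> elts y" by blast
  define g where "g = mk ((\<lambda>u. kpair u (f u)) ` elts x)"
  have g: "kpair u v \<in> elts g \<longleftrightarrow> u \<in> elts x \<and> v = f u" for u v
    unfolding g_def by (auto simp: elts_mk small_image)
  show "embeds x y"
    unfolding embeds_def
  proof (intro exI[of _ g] conjI ballI allI impI)
    show "\<exists>v\<in>elts y. kpair u v \<in> elts g" if "u \<in> elts x" for u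
      using that f(2) g by blast
    show "u = u'" if "kpair u v \<in> elts g \<and> kpair u' v \<in> elts g" for u u' v
      using that f(1) unfolding g by (metis inj_onD)
  qed
qed

lemma embeds_iff_card_le:
  assumes "finite (elts x)" "finite (elts y)"
  shows "embeds x y \<longleftrightarrow> card (elts x) \<le> card (elts y)"
  unfolding embeds_iff_inj_on using assms card_le_inj[OF assms] card_inj_on_le by blast

lemma finite_iff_embeds_in_nat: "finite (elts x) \<longleftrightarrow> (\<exists>n\<in>elts \<omega>. embeds x n)"
proof
  assume "finite (elts x)"
  then have "embeds x (nat_code (card (elts x)))" by (simp add: embeds_iff_card_le)
  then show "\<exists>n\<in>elts \<omega>. embeds x n" by (auto simp: elts_\<omega>)
next
  assume "\<exists>n\<in>elts \<omega>. embeds x n"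
  then obtain n f where "inj_on f (elts x)" "f ` elts x \<subseteq> elts (nat_code n)"
    unfolding embeds_iff_inj_on elts_\<omega> by blast
  then show "finite (elts x)" by (metis finite_imageD finite_nat_code finite_subset)
qed

definition meet :: "'v \<Rightarrow> 'v \<Rightarrow> 'v" where
  "meet x y = mk {u. u \<in> elts x \<and> u \<in> elts y}"

definition level_set :: "'v \<Rightarrow> 'v \<Rightarrow> 'v \<Rightarrow> 'v" where
  "level_set B v k = mk {x. x \<in> elts B \<and> kpair x k \<in> elts v}"

definition fibre :: "'v \<Rightarrow> 'v \<Rightarrow> 'v \<Rightarrow> 'v \<Rightarrow> 'v" where
  "fibre N W j k = mk {s. s \<in> elts N \<and> kpair j (kpair k s) \<in> elts W}"

lemma small_Collect_conj: "small {u. u \<in> elts x \<and> P u}"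
  by (rule small_subset[OF small_elts]) auto

lemma elts_meet: "elts (meet x y) = elts x \<inter> elts y"
  by (auto simp: meet_def elts_mk small_Collect_conj)

lemma elts_level_set: "elts (level_set B v k) = {x \<in> elts B. kpair x k \<in> elts v}"
  by (simp add: level_set_def elts_mk small_Collect_conj)

lemma elts_fibre: "elts (fibre N W j k) = {s \<in> elts N. kpair j (kpair k s) \<in> elts W}"
  by (simp add: fibre_def elts_mk small_Collect_conj)

text \<open>
  In the following, \<open>m\<close> is meant to be the code of a measure and \<open>p\<close> the code of a partition.  The points
  of the space are the elements of the measurable sets.
\<close>

definition in_space :: "'v \<Rightarrow> 'v \<Rightarrow> bool" where
  "in_space m x \<longleftrightarrow> (\<exists>A r. kpair A r \<in> elts m \<and> x \<in> elts A)"

definition measurable_code :: "'v \<Rightarrow> 'v \<Rightarrow> bool" where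
  "measurable_code m A \<longleftrightarrow> (\<exists>r. kpair A r \<in> elts m)"

definition ratio_below :: "'v \<Rightarrow> 'v \<Rightarrow> 'v \<Rightarrow> 'v \<Rightarrow> bool" where
  "ratio_below m A i k \<longleftrightarrow> (\<exists>r. kpair A r \<in> elts m \<and> kpair i k \<in> elts r)"

text \<open>
  Some ratio below the measure of \<open>B\<close> says that \<open>B\<close> is measurable and of positive measure.
\<close>

definition heavy_block :: "'v \<Rightarrow> 'v \<Rightarrow> 'v \<Rightarrow> 'v \<Rightarrow> bool" where
  "heavy_block m p j B \<longleftrightarrow> kpair j B \<in> elts p \<and> (\<exists>i k. ratio_below m B i k)"

text \<open>
  For finite sets \<open>l\<close>, \<open>r\<close> and sets \<open>A\<close>, \<open>B\<close> of finite measure, this says \<open>|l| \<mu>(A) \<le> |r| \<mu>(B)\<close>, by comparing the natural numbers \<open>i\<close> below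
  the multiples \<open>n |l| \<mu>(A)\<close> and \<open>n |r| \<mu>(B)\<close>.  The multiples \<open>k = n |l|\<close> and \<open>k' = n |r|\<close> enter through
  bijections, which replace multiplication.
\<close>

definition measure_le :: "'v \<Rightarrow> 'v \<Rightarrow> 'v \<Rightarrow> 'v \<Rightarrow> 'v \<Rightarrow> bool" where
  "measure_le m l A r B \<longleftrightarrow> (\<forall>i\<in>elts \<omega>. \<forall>n\<in>elts \<omega>. \<forall>k\<in>elts \<omega>. \<forall>k'\<in>elts \<omega>.
     embeds k (product n l) \<and> embeds (product n l) k \<and>
     embeds k' (product n r) \<and> embeds (product n r) k' \<and> ratio_below m A i k \<longrightarrow>
     ratio_below m B i k')"

text \<open>
  The analogue \<open>|l| |z \<inter> A| \<le> |r| |z \<inter> B|\<close> for counting points of \<open>z\<close>.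
\<close>

definition count_le :: "'v \<Rightarrow> 'v \<Rightarrow> 'v \<Rightarrow> 'v \<Rightarrow> 'v \<Rightarrow> bool" where
  "count_le z l A r B \<longleftrightarrow> embeds (product l (meet z A)) (product r (meet z B))"

text \<open>
  The certificate for \<open>a * test_sum \<le> 1\<close>.  The disjoint fibres of \<open>W\<close> over the pairs \<open>(j, k)\<close> are
  subsets of \<open>N\<close>, and the summand with indices \<open>j\<close>, \<open>k\<close>, multiplied by \<open>|N|\<close>, is at most the size of its
  fibre; denominators are cleared in the last line.
\<close>

definition packing ::
  "('v \<Rightarrow> 'v \<Rightarrow> 'v \<Rightarrow> 'v \<Rightarrow> bool) \<Rightarrow> 'v \<Rightarrow> 'v \<Rightarrow> 'v \<Rightarrow> 'v \<Rightarrow> 'v \<Rightarrow> bool" where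
  "packing le m p v d a \<longleftrightarrow> (\<forall>n\<in>elts \<omega>. \<exists>N\<in>elts \<omega>. (\<exists>s. s \<in> elts N) \<and> (\<exists>W.
     (\<forall>j k j' k' s. kpair j (kpair k s) \<in> elts W \<and> kpair j' (kpair k' s) \<in> elts W \<longrightarrow>
        j = j' \<and> k = k') \<and>
     (\<forall>j\<in>elts n. \<forall>k\<in>elts n. \<forall>B q. heavy_block m p j B \<and> kpair j q \<in> elts d \<longrightarrow>
        le (product N (product a k)) (level_set B v k) (product (fibre N W j k) q) B)))"

text \<open>
  The sets \<open>v\<close> and \<open>d\<close> stand for the two components of a valid test.  They are consulted only for pairs
  whose first entry is a point or a natural number, respectively.
\<close>

definition test_data :: "'v \<Rightarrow> 'v \<Rightarrow> 'v \<Rightarrow> 'v \<Rightarrow> bool" where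
  "test_data m p v d \<longleftrightarrow>
     (\<forall>x. in_space m x \<longrightarrow> (\<exists>k\<in>elts \<omega>. \<forall>k'. kpair x k' \<in> elts v \<longleftrightarrow> k' = k)) \<and>
     (\<forall>j\<in>elts \<omega>. \<exists>q\<in>elts \<omega>. (\<exists>s. s \<in> elts q) \<and> (\<forall>q'. kpair j q' \<in> elts d \<longleftrightarrow> q' = q)) \<and>
     (\<forall>j B. heavy_block m p j B \<longrightarrow> (\<forall>k\<in>elts \<omega>. measurable_code m (level_set B v k)))"

definition finite_points :: "'v \<Rightarrow> 'v \<Rightarrow> bool" where
  "finite_points m z \<longleftrightarrow> (\<forall>x\<in>elts z. in_space m x) \<and> (\<exists>n\<in>elts \<omega>. embeds z n)"

text \<open>
  Only the last clause involves the values of the measure.  The strict inequality \<open>a < b\<close> between the factors on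
  its two sides absorbs the slack in the certificates.
\<close>

definition good_filter :: "'v \<Rightarrow> 'v \<Rightarrow> 'v \<Rightarrow> bool" where
  "good_filter m p y \<longleftrightarrow>
     (\<exists>U. U \<in> elts y) \<and>
     (\<forall>U\<in>elts y. \<forall>z\<in>elts U. finite_points m z) \<and>
     (\<forall>U\<in>elts y. \<forall>V. elts U \<subseteq> elts V \<and> (\<forall>z\<in>elts V. finite_points m z) \<longrightarrow> V \<in> elts y) \<and>
     (\<forall>U\<in>elts y. \<forall>V\<in>elts y. \<exists>W\<in>elts y. elts W \<subseteq> elts U \<and> elts W \<subseteq> elts V) \<and>
     (\<forall>x. in_space m x \<longrightarrow> (\<exists>U\<in>elts y. \<forall>z\<in>elts U. x \<in> elts z)) \<and>
     (\<forall>v d a b. test_data m p v d \<and> b \<in> elts \<omega> \<and> a \<in> elts b \<and> packing (measure_le m) m p v d b \<longrightarrow>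
        (\<exists>U\<in>elts y. \<forall>z\<in>elts U. packing (count_le z) m p v d a))"

definition least_good_filter :: "'v \<Rightarrow> 'v \<Rightarrow> 'v \<Rightarrow> bool" where
  "least_good_filter m p y \<longleftrightarrow>
     good_filter m p y \<and> (\<forall>y'. good_filter m p y' \<longrightarrow> elts y \<subseteq> elts y')"

end

lemma definable_term_omega: "definable_term (\<lambda>E e. set_universe.\<omega> E)"
proof -
  have "expressible (\<lambda>E e. \<forall>x. x \<in> E (e 0) \<longleftrightarrow> (\<forall>w. ((\<exists>x\<in>E w. \<forall>y. y \<notin> E x) \<and>
     (\<forall>x\<in>E w. \<exists>y\<in>E w. \<forall>u. u \<in> E y \<longleftrightarrow> u \<in> E x \<or> u = x)) \<longrightarrow> x \<in> E w))"
    by (intro definability_intros)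
  then show ?thesis
    unfolding definable_term_def
  proof (rule expressible_cong)
    fix E :: "'v \<Rightarrow> 'v set" and e
    assume "set_universe E"
    then interpret set_universe E .
    show "\<omega> = e 0 \<longleftrightarrow> (\<forall>x. x \<in> E (e 0) \<longleftrightarrow> (\<forall>w. ((\<exists>x\<in>E w. \<forall>y. y \<notin> E x) \<and>
     (\<forall>x\<in>E w. \<exists>y\<in>E w. \<forall>u. u \<in> E y \<longleftrightarrow> u \<in> E x \<or> u = x)) \<longrightarrow> x \<in> E w))"
      unfolding successor_closed_def[symmetric] \<omega>_def
        mk_eq_iff[OF small_range_nat_code] unfolding least_successor_closed[symmetric] by blast
  qed
qed

lemma definable_term_product:
  assumes "definable_term s" "definable_term t"
  shows "definable_term (\<lambda>E e. set_universe.product E (s E e) (t E e))"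
  by (rule definable_term_mk, erule set_universe.product_def, erule set_universe.small_product)
    (intro definability_intros assms[THEN definable_term_shift])

lemma definable_term_meet:
  assumes "definable_term s" "definable_term t"
  shows "definable_term (\<lambda>E e. set_universe.meet E (s E e) (t E e))"
  by (rule definable_term_mk, erule set_universe.meet_def, erule set_universe.small_Collect_conj)
    (intro definability_intros assms[THEN definable_term_shift])

lemma definable_term_level_set:
  assumes "definable_term s" "definable_term t" "definable_term r"
  shows "definable_term (\<lambda>E e. set_universe.level_set E (s E e) (t E e) (r E e))"
  by (rule definable_term_mk, erule set_universe.level_set_def, erule set_universe.small_Collect_conj)
    (intro definability_intros assms[THEN definable_term_shift])

lemma definable_term_fibre:
  assumes "definable_term s" "definable_term t" "definable_term r" "definable_term q"
  shows "definable_term (\<lambda>E e. set_universe.fibre E (s E e) (t E e) (r E e) (q E e))"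
  by (rule definable_term_mk, erule set_universe.fibre_def, erule set_universe.small_Collect_conj)
    (intro definability_intros assms[THEN definable_term_shift])

lemma expressible_embeds:
  assumes "definable_term s" "definable_term t"
  shows "expressible (\<lambda>E e. set_universe.embeds E (s E e) (t E e))"
  by (rule expressible_cong[rotated], erule set_universe.embeds_def)
    (intro definability_intros assms[THEN definable_term_shift])

lemmas code_definability_intros = definability_intros
  definable_term_omega definable_term_product definable_term_meet definable_term_level_set
  definable_term_fibre expressible_embeds

lemma expressible_ratio_below:
  assumes "definable_term t1" "definable_term t2" "definable_term t3" "definable_term t4"
  shows "expressible (\<lambda>E e. set_universe.ratio_below E (t1 E e) (t2 E e) (t3 E e) (t4 E e))"
  by (rule expressible_cong[rotated], erule set_universe.ratio_below_def)
    (intro code_definability_intros assms[THEN definable_term_shift])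

lemma expressible_in_space:
  assumes "definable_term t1" "definable_term t2"
  shows "expressible (\<lambda>E e. set_universe.in_space E (t1 E e) (t2 E e))"
  by (rule expressible_cong[rotated], erule set_universe.in_space_def)
    (intro code_definability_intros assms[THEN definable_term_shift])

lemma expressible_measurable_code:
  assumes "definable_term t1" "definable_term t2"
  shows "expressible (\<lambda>E e. set_universe.measurable_code E (t1 E e) (t2 E e))"
  by (rule expressible_cong[rotated], erule set_universe.measurable_code_def)
    (intro code_definability_intros assms[THEN definable_term_shift])

lemma expressible_heavy_block:
  assumes "definable_term t1" "definable_term t2" "definable_term t3" "definable_term t4"
  shows "expressible (\<lambda>E e. set_universe.heavy_block E (t1 E e) (t2 E e) (t3 E e) (t4 E e))"
  by (rule expressible_cong[rotated], erule set_universe.heavy_block_def)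
    (intro code_definability_intros expressible_ratio_below assms[THEN definable_term_shift])

lemma expressible_finite_points:
  assumes "definable_term t1" "definable_term t2"
  shows "expressible (\<lambda>E e. set_universe.finite_points E (t1 E e) (t2 E e))"
  by (rule expressible_cong[rotated], erule set_universe.finite_points_def)
    (intro code_definability_intros expressible_in_space assms[THEN definable_term_shift])

lemma expressible_measure_le:
  assumes "definable_term t1" "definable_term t2" "definable_term t3" "definable_term t4"
    "definable_term t5"
  shows "expressible (\<lambda>E e. set_universe.measure_le E (t1 E e) (t2 E e) (t3 E e) (t4 E e) (t5 E e))"
  by (rule expressible_cong[rotated], erule set_universe.measure_le_def)
    (intro code_definability_intros expressible_ratio_below assms[THEN definable_term_shift])

lemma expressible_count_le:
  assumes "definable_term t1" "definable_term t2" "definable_term t3" "definable_term t4"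
    "definable_term t5"
  shows "expressible (\<lambda>E e. set_universe.count_le E (t1 E e) (t2 E e) (t3 E e) (t4 E e) (t5 E e))"
  by (rule expressible_cong[rotated], erule set_universe.count_le_def)
    (intro code_definability_intros assms)

text \<open>
  The comparison \<open>le\<close> may depend on one more object: the measure or the finite set \<open>z\<close>.
\<close>

lemma expressible_packing:
  fixes le :: "('v \<Rightarrow> 'v set) \<Rightarrow> 'v \<Rightarrow> 'v \<Rightarrow> 'v \<Rightarrow> 'v \<Rightarrow> 'v \<Rightarrow> bool"
  assumes le: "\<And>t0 t1 t2 t3 t4. definable_term t0 \<Longrightarrow> definable_term t1 \<Longrightarrow> definable_term t2 \<Longrightarrow>
      definable_term t3 \<Longrightarrow> definable_term t4 \<Longrightarrow>
      expressible (\<lambda>E e. le E (t0 E e) (t1 E e) (t2 E e) (t3 E e) (t4 E e))"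
    and t: "definable_term t0" "definable_term t1" "definable_term t2" "definable_term t3"
      "definable_term t4" "definable_term t5"
  shows "expressible (\<lambda>E e. set_universe.packing E (le E (t0 E e))
      (t1 E e) (t2 E e) (t3 E e) (t4 E e) (t5 E e))"
  by (rule expressible_cong[rotated], erule set_universe.packing_def)
    (intro code_definability_intros expressible_heavy_block le t[THEN definable_term_shift])

lemma expressible_test_data:
  assumes "definable_term t1" "definable_term t2" "definable_term t3" "definable_term t4"
  shows "expressible (\<lambda>E e. set_universe.test_data E (t1 E e) (t2 E e) (t3 E e) (t4 E e))"
  by (rule expressible_cong[rotated], erule set_universe.test_data_def)
    (intro code_definability_intros expressible_heavy_block expressible_in_space
      expressible_measurable_code assms[THEN definable_term_shift])

lemma expressible_packing_measure_le:
  assumes "definable_term t0" "definable_term t1" "definable_term t2" "definable_term t3"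
    "definable_term t4" "definable_term t5"
  shows "expressible (\<lambda>E e. set_universe.packing E (set_universe.measure_le E (t0 E e))
      (t1 E e) (t2 E e) (t3 E e) (t4 E e) (t5 E e))"
proof (rule expressible_packing[where le = set_universe.measure_le, OF _ assms])
  fix s0 s1 s2 s3 s4 :: "('v \<Rightarrow> 'v set) \<Rightarrow> (nat \<Rightarrow> 'v) \<Rightarrow> 'v"
  assume "definable_term s0" "definable_term s1" "definable_term s2" "definable_term s3"
    "definable_term s4"
  then show "expressible (\<lambda>E e. set_universe.measure_le E (s0 E e) (s1 E e) (s2 E e) (s3 E e) (s4 E e))"
    by (rule expressible_measure_le)
qed

lemma expressible_packing_count_le:
  assumes "definable_term t0" "definable_term t1" "definable_term t2" "definable_term t3"
    "definable_term t4" "definable_term t5"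
  shows "expressible (\<lambda>E e. set_universe.packing E (set_universe.count_le E (t0 E e))
      (t1 E e) (t2 E e) (t3 E e) (t4 E e) (t5 E e))"
proof (rule expressible_packing[where le = set_universe.count_le, OF _ assms])
  fix s0 s1 s2 s3 s4 :: "('v \<Rightarrow> 'v set) \<Rightarrow> (nat \<Rightarrow> 'v) \<Rightarrow> 'v"
  assume "definable_term s0" "definable_term s1" "definable_term s2" "definable_term s3"
    "definable_term s4"
  then show "expressible (\<lambda>E e. set_universe.count_le E (s0 E e) (s1 E e) (s2 E e) (s3 E e) (s4 E e))"
    by (rule expressible_count_le)
qed

lemma expressible_good_filter:
  assumes "definable_term t1" "definable_term t2" "definable_term t3"
  shows "expressible (\<lambda>E e. set_universe.good_filter E (t1 E e) (t2 E e) (t3 E e))"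
  by (rule expressible_cong[rotated], erule set_universe.good_filter_def)
    (intro code_definability_intros expressible_finite_points expressible_in_space
      expressible_test_data expressible_packing_measure_le expressible_packing_count_le
      assms[THEN definable_term_shift])

lemma expressible_least_good_filter:
  "expressible (\<lambda>E e. set_universe.least_good_filter E (e 1) (e 2) (e 0))"
  by (rule expressible_cong[rotated], erule set_universe.least_good_filter_def)
    (intro code_definability_intros expressible_good_filter)


section \<open>Decoding the formula in a universe of sets\<close>

locale coded_space = set_universe elts + adapted_partition M \<alpha> P w
  for elts :: "'v \<Rightarrow> 'v set" and M :: "'a measure" and \<alpha> P w +
  fixes c :: "'a \<Rightarrow> 'v"
  assumes universe_over: "universe_over c (space M)"
begin

declare nat_code.simps [simp del]

abbreviation code :: "'a set \<Rightarrow> 'v" where "code \<equiv> set_code c"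
abbreviation \<mu>c :: 'v where "\<mu>c \<equiv> measure_code c M"
abbreviation Pc :: 'v where "Pc \<equiv> family_code c \<alpha> P"

lemma c_inj: "inj_on c (space M)"
  using universe_over by (simp add: universe_over_def)

lemma c_eq_iff: "x \<in> space M \<Longrightarrow> y \<in> space M \<Longrightarrow> c x = c y \<longleftrightarrow> x = y"
  using c_inj by (auto dest: inj_onD)

lemma small_points: "A \<subseteq> space M \<Longrightarrow> small (c ` A)"
  using universe_over unfolding universe_over_def by (meson image_mono small_elts small_subset)

lemma elts_code: "A \<subseteq> space M \<Longrightarrow> elts (code A) = c ` A"
  by (simp add: set_code_def elts_mk small_points)

lemma mem_code_iff: "A \<subseteq> space M \<Longrightarrow> x \<in> space M \<Longrightarrow> c x \<in> elts (code A) \<longleftrightarrow> x \<in> A"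
  by (auto simp: elts_code c_eq_iff)

lemma code_inject: "A \<subseteq> space M \<Longrightarrow> B \<subseteq> space M \<Longrightarrow> code A = code B \<longleftrightarrow> A = B"
  using elts_code inj_on_image_eq_iff[OF c_inj] by metis

lemma code_eqI: "A \<subseteq> space M \<Longrightarrow> elts v = c ` A \<Longrightarrow> v = code A"
  using elts_code extensionality by metis

lemma small_image_of_inj:
  assumes "small (g ` S)" "inj_on g S"
  shows "small (f ` S)"
proof -
  have "f ` S = (\<lambda>v. f (inv_into S g v)) ` g ` S"
    using assms(2) by (simp add: image_image)
  then show ?thesis using small_image[OF assms(1)] by metis
qed

text \<open>
  Two power sets above the set of points are needed for the codes of filters; this is where the
  universe has to contain them.
\<close>

lemma small_code_Pow: "small (code ` Pow (space M))"
  and small_code_Pow_Pow: "small ((\<lambda>S. mk (code ` S)) ` Pow (Pow (space M)))"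
proof -
  obtain u p q where u: "c ` space M \<subseteq> elts u" "is_powerset p u" "is_powerset q p"
    using universe_over unfolding universe_over_def by blast
  have p: "code A \<in> elts p" if "A \<subseteq> space M" for A
  proof -
    have "c ` A \<subseteq> elts u" using u(1) that by blast
    then show ?thesis using u(2) elts_code[OF that] by (simp add: is_powerset_def)
  qed
  then have "code ` Pow (space M) \<subseteq> elts p" by auto
  then show small: "small (code ` Pow (space M))" by (rule small_subset[OF small_elts])
  have "mk (code ` S) \<in> elts q" if "S \<subseteq> Pow (space M)" for S
  proof -
    have "small (code ` S)" using that by (intro small_subset[OF small]) auto
    then have "elts (mk (code ` S)) = code ` S" by (rule elts_mk)
    then show ?thesis using u(3) p that by (auto simp: is_powerset_def)
  qed
  then show "small ((\<lambda>S. mk (code ` S)) ` Pow (Pow (space M)))"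
    by (intro small_subset[OF small_elts[of q]]) auto
qed

lemma small_codes: "S \<subseteq> Pow (space M) \<Longrightarrow> small (code ` S)"
  by (rule small_subset[OF small_code_Pow]) auto

lemma inj_code: "S \<subseteq> Pow (space M) \<Longrightarrow> inj_on code S"
  by (intro inj_onI) (use code_inject in blast)

lemma elts_ennreal_code:
  "elts (ennreal_code r) = {kpair (nat_code m) (nat_code n) | m n. of_nat m < r * of_nat n}"
proof -
  have "small {kpair (nat_code m) (nat_code n) | m n. of_nat m < r * of_nat n}"
    by (rule small_subset[OF small_elts[of "product \<omega> \<omega>"]]) (auto simp: elts_product elts_\<omega>)
  then show ?thesis unfolding ennreal_code_def by (rule elts_mk)
qed

lemma elts_measure_code:
  "elts \<mu>c = (\<lambda>A. kpair (code A) (ennreal_code (emeasure M A))) ` sets M"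
proof -
  have S: "sets M \<subseteq> Pow (space M)" by (rule sets.space_closed)
  show ?thesis
    unfolding measure_code_def
    by (rule elts_mk[OF small_image_of_inj[OF small_codes[OF S] inj_code[OF S]]])
qed

lemma elts_family_code:
  "elts Pc = (\<lambda>i. kpair (nat_code i) (code (P i))) ` {i. enat i < \<alpha>}"
proof -
  have "small (nat_code ` {i. enat i < \<alpha>})"
    by (rule small_subset[OF small_range_nat_code]) auto
  then show ?thesis
    unfolding family_code_def by (rule elts_mk[OF small_image_of_inj[OF _ inj_nat_code]])
qed

lemma in_space_iff: "in_space \<mu>c x \<longleftrightarrow> x \<in> c ` space M"
proof
  assume "in_space \<mu>c x"
  then obtain A where A: "A \<in> sets M" "x \<in> elts (code A)"
    unfolding in_space_def elts_measure_code by auto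
  then show "x \<in> c ` space M" using sets.sets_into_space[OF A(1)] by (auto simp: elts_code)
next
  assume "x \<in> c ` space M"
  then have "x \<in> elts (code (space M))" by (simp add: elts_code)
  then show "in_space \<mu>c x"
    unfolding in_space_def elts_measure_code
    by (intro exI[of _ "code (space M)"] exI[of _ "ennreal_code (emeasure M (space M))"] conjI)
      (rule image_eqI[OF refl sets.top], assumption)
qed

lemma measurable_code_iff:
  assumes A: "A \<subseteq> space M"
  shows "measurable_code \<mu>c (code A) \<longleftrightarrow> A \<in> sets M"
proof
  assume "measurable_code \<mu>c (code A)"
  then obtain B where "B \<in> sets M" "code A = code B"
    unfolding measurable_code_def elts_measure_code by auto
  then show "A \<in> sets M" using code_inject[OF A] sets.sets_into_space by metis
qed (auto simp: measurable_code_def elts_measure_code)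

lemma ratio_below_iff: "ratio_below \<mu>c B x y \<longleftrightarrow> (\<exists>A\<in>sets M. \<exists>i k. B = code A \<and>
    x = nat_code i \<and> y = nat_code k \<and> of_nat i < emeasure M A * of_nat k)"
  unfolding ratio_below_def elts_measure_code
  by (auto simp: elts_ennreal_code)

lemma ratio_below_code_iff:
  assumes A: "A \<in> sets M"
  shows "ratio_below \<mu>c (code A) (nat_code i) (nat_code k) \<longleftrightarrow> of_nat i < emeasure M A * of_nat k"
proof -
  have "code A = code B \<longleftrightarrow> A = B" if "B \<in> sets M" for B
    using A that sets.sets_into_space by (intro code_inject) auto
  then show ?thesis using A by (auto simp: ratio_below_iff)
qed

lemma heavy_block_iff: "heavy_block \<mu>c Pc j B \<longleftrightarrow> (\<exists>i\<in>heavy. j = nat_code i \<and> B = code (P i))"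
proof
  assume "heavy_block \<mu>c Pc j B"
  then obtain i A l k where i: "enat i < \<alpha>" "j = nat_code i" "B = code (P i)"
    and A: "A \<in> sets M" "B = code A" and lk: "of_nat l < emeasure M A * of_nat k"
    unfolding heavy_block_def ratio_below_iff elts_family_code by auto
  have "A = P i"
    using i(3) A code_inject[of A "P i"] sets.sets_into_space block_subset_space[OF i(1)] by metis
  moreover have "emeasure M A > 0" using lk by (cases "emeasure M A = 0") (auto simp: zero_less_iff_neq_zero)
  ultimately show "\<exists>i\<in>heavy. j = nat_code i \<and> B = code (P i)"
    using i A by (auto simp: heavy_def)
next
  assume "\<exists>i\<in>heavy. j = nat_code i \<and> B = code (P i)"
  then obtain i where i: "i \<in> heavy" "j = nat_code i" "B = code (P i)" by blast
  have "ratio_below \<mu>c B (nat_code 0) (nat_code 1)"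
    unfolding i(3) ratio_below_code_iff[OF heavyD(2)[OF i(1)]] using heavyD(3)[OF i(1)] by simp
  then show "heavy_block \<mu>c Pc j B"
    unfolding heavy_block_def elts_family_code using i heavyD(1) by blast
qed

lemma finite_points_iff: "finite_points \<mu>c z \<longleftrightarrow> z \<in> code ` Fpow (space M)"
proof
  assume z: "finite_points \<mu>c z"
  then have fin: "finite (elts z)" and sub: "elts z \<subseteq> c ` space M"
    unfolding finite_points_def in_space_iff finite_iff_embeds_in_nat by auto
  then obtain A where A: "A \<subseteq> space M" "elts z = c ` A" by (auto simp: subset_image_iff)
  have "finite A" using fin A inj_on_subset[OF c_inj A(1)] by (metis finite_imageD)
  then show "z \<in> code ` Fpow (space M)" using A code_eqI[OF A] by (auto simp: Fpow_def)
next
  assume "z \<in> code ` Fpow (space M)"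
  then obtain A where A: "finite A" "A \<subseteq> space M" "z = code A" by (auto simp: Fpow_def)
  then have "elts z = c ` A" by (simp add: elts_code)
  then show "finite_points \<mu>c z"
    unfolding finite_points_def in_space_iff finite_iff_embeds_in_nat[symmetric] using A by auto
qed

definition decodes :: "'v \<Rightarrow> 'v \<Rightarrow> ('a \<Rightarrow> nat) \<Rightarrow> (nat \<Rightarrow> nat) \<Rightarrow> bool" where
  "decodes v d V C \<longleftrightarrow>
     (\<forall>x\<in>space M. \<forall>k. kpair (c x) k \<in> elts v \<longleftrightarrow> k = nat_code (V x)) \<and>
     (\<forall>j q. kpair (nat_code j) q \<in> elts d \<longleftrightarrow> q = nat_code (C j))"

lemma ex_decodes: "\<exists>v d. decodes v d V C"
proof -
  define v where "v = mk ((\<lambda>x. kpair (c x) (nat_code (V x))) ` space M)"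
  define d where "d = mk ((\<lambda>j. kpair (nat_code j) (nat_code (C j))) ` UNIV)"
  have "elts v = (\<lambda>x. kpair (c x) (nat_code (V x))) ` space M"
    unfolding v_def by (rule elts_mk[OF small_image_of_inj[OF small_points[OF subset_refl] c_inj]])
  moreover have "elts d = (\<lambda>j. kpair (nat_code j) (nat_code (C j))) ` UNIV"
    unfolding d_def by (rule elts_mk[OF small_image_of_inj[OF small_range_nat_code inj_nat_code]])
  ultimately have "decodes v d V C" by (auto simp: decodes_def c_eq_iff)
  then show ?thesis by blast
qed

lemma level_set_code:
  assumes "decodes v d V C" "B \<subseteq> space M"
  shows "level_set (code B) v (nat_code k) = code {x \<in> B. V x = k}"
proof (rule code_eqI)
  show "{x \<in> B. V x = k} \<subseteq> space M" using assms(2) by auto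
  show "elts (level_set (code B) v (nat_code k)) = c ` {x \<in> B. V x = k}"
    using assms by (auto simp: elts_level_set elts_code decodes_def subset_eq)
qed

lemma test_data_of_valid:
  assumes dec: "decodes v d V C" and valid: "valid_test V C"
  shows "test_data \<mu>c Pc v d"
  unfolding test_data_def
proof (intro conjI allI impI ballI)
  fix x assume "in_space \<mu>c x"
  then show "\<exists>k\<in>elts \<omega>. \<forall>k'. kpair x k' \<in> elts v \<longleftrightarrow> k' = k"
    using dec by (auto simp: in_space_iff decodes_def elts_\<omega>)
next
  fix j assume "j \<in> elts \<omega>"
  then obtain i where i: "j = nat_code i" by (auto simp: elts_\<omega>)
  have "C i > 0" using valid by (simp add: valid_test_def)
  then have "nat_code 0 \<in> elts (nat_code (C i))" by simp
  then have "\<exists>s. s \<in> elts (nat_code (C i))" by blast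
  then show "\<exists>q\<in>elts \<omega>. (\<exists>s. s \<in> elts q) \<and> (\<forall>q'. kpair j q' \<in> elts d \<longleftrightarrow> q' = q)"
    using dec i by (intro bexI[of _ "nat_code (C i)"]) (auto simp: decodes_def elts_\<omega>)
next
  fix j B k assume "heavy_block \<mu>c Pc j B" "k \<in> elts \<omega>"
  then obtain i k' where i: "i \<in> heavy" "B = code (P i)" "k = nat_code k'"
    by (auto simp: heavy_block_iff elts_\<omega>)
  have "P i \<subseteq> space M" using block_subset_space heavyD(1) i(1) by blast
  then show "measurable_code \<mu>c (level_set B v k)"
    using valid i unfolding i(2,3) by (subst level_set_code[OF dec], simp)
      (subst measurable_code_iff, auto simp: valid_test_def)
qed

lemma ex_valid_test_data:
  assumes t: "test_data \<mu>c Pc v d"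
  obtains V C where "decodes v d V C" "valid_test V C"
proof -
  have "\<exists>k. \<forall>k'. kpair (c x) k' \<in> elts v \<longleftrightarrow> k' = nat_code k" if "x \<in> space M" for x
    using t that unfolding test_data_def in_space_iff elts_\<omega> by auto
  then obtain V where V: "\<And>x k'. x \<in> space M \<Longrightarrow> kpair (c x) k' \<in> elts v \<longleftrightarrow> k' = nat_code (V x)"
    by metis
  have "\<exists>q. q > 0 \<and> (\<forall>q'. kpair (nat_code j) q' \<in> elts d \<longleftrightarrow> q' = nat_code q)" for j
  proof -
    obtain q where q: "q \<in> elts \<omega>" "\<exists>s. s \<in> elts q" "\<forall>q'. kpair (nat_code j) q' \<in> elts d \<longleftrightarrow> q' = q"
      using t unfolding test_data_def elts_\<omega> by blast
    then obtain n where "q = nat_code n" by (auto simp: elts_\<omega>)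
    then show ?thesis using q(2,3) by (intro exI[of _ n]) (auto simp: mem_nat_code_iff)
  qed
  then obtain C where C: "\<And>j. C j > 0" "\<And>j q'. kpair (nat_code j) q' \<in> elts d \<longleftrightarrow> q' = nat_code (C j)"
    by metis
  have dec: "decodes v d V C" using V C by (simp add: decodes_def)
  have "{x \<in> P i. V x = k} \<in> sets M" if i: "i \<in> heavy" for i k
  proof -
    have sub: "P i \<subseteq> space M" using block_subset_space heavyD(1) i by blast
    have "measurable_code \<mu>c (level_set (code (P i)) v (nat_code k))"
      using t i unfolding test_data_def heavy_block_iff elts_\<omega> by blast
    then show ?thesis
      unfolding level_set_code[OF dec sub] by (subst (asm) measurable_code_iff) (use sub in auto)
  qed
  then have "valid_test V C" using C by (simp add: valid_test_def)
  then show ?thesis using dec that by blast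
qed

lemma of_nat_less_emeasure_iff:
  "emeasure M A < \<infinity> \<Longrightarrow> of_nat i < emeasure M A * of_nat k \<longleftrightarrow> real i < measure M A * real k"
proof -
  assume "emeasure M A < \<infinity>"
  then have "emeasure M A = ennreal (measure M A)" by (simp add: emeasure_eq_ennreal_measure)
  then show ?thesis
    by (simp add: ennreal_of_nat_eq_real_of_nat ennreal_mult[symmetric] ennreal_less_iff)
qed

text \<open>
  If \<open>|l| \<mu>(A)\<close> exceeds \<open>|r| \<mu>(B)\<close>, then for large \<open>n\<close> an integer separates the multiples by \<open>n\<close>.
\<close>

lemma measure_le_iff:
  assumes A: "A \<in> sets M" "emeasure M A < \<infinity>" and B: "B \<in> sets M" "emeasure M B < \<infinity>"
    and fin: "finite (elts l)" "finite (elts r)"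
  shows "measure_le \<mu>c l (code A) r (code B) \<longleftrightarrow>
    real (card (elts l)) * measure M A \<le> real (card (elts r)) * measure M B"
proof -
  let ?l = "card (elts l)" and ?r = "card (elts r)"
  have eq: "(k \<le> j \<and> j \<le> k \<and> Q) \<longleftrightarrow> (k = j \<and> Q)" for k j :: nat and Q by auto
  have "measure_le \<mu>c l (code A) r (code B) \<longleftrightarrow>
    (\<forall>i n k k'. k = n * ?l \<and> k' = n * ?r \<and> ratio_below \<mu>c (code A) (nat_code i) (nat_code k) \<longrightarrow>
      ratio_below \<mu>c (code B) (nat_code i) (nat_code k'))"
    unfolding measure_le_def elts_\<omega> using fin
    by (simp add: embeds_iff_card_le eq)
  also have "\<dots> \<longleftrightarrow>
    (\<forall>i n. real i < measure M A * (real n * real ?l) \<longrightarrow> real i < measure M B * (real n * real ?r))"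
    unfolding ratio_below_code_iff[OF A(1)] ratio_below_code_iff[OF B(1)]
      of_nat_less_emeasure_iff[OF A(2)] of_nat_less_emeasure_iff[OF B(2)] by simp
  also have "\<dots> \<longleftrightarrow> real ?l * measure M A \<le> real ?r * measure M B"
  proof
    assume *: "\<forall>i n. real i < measure M A * (real n * real ?l) \<longrightarrow> real i < measure M B * (real n * real ?r)"
    show "real ?l * measure M A \<le> real ?r * measure M B"
    proof (rule ccontr)
      assume "\<not> real ?l * measure M A \<le> real ?r * measure M B"
      then have gap: "real ?l * measure M A - real ?r * measure M B > 0" by simp
      obtain n :: nat where n: "1 < real n * (real ?l * measure M A - real ?r * measure M B)"
        using reals_Archimedean3[OF gap] by blast
      define i where "i = nat \<lceil>real n * (real ?r * measure M B)\<rceil>"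
      have i: "real n * (real ?r * measure M B) \<le> real i" "real i < real n * (real ?r * measure M B) + 1"
      proof -
        have "real n * (real ?r * measure M B) \<ge> 0" by simp
        then show "real n * (real ?r * measure M B) \<le> real i" "real i < real n * (real ?r * measure M B) + 1"
          unfolding i_def by linarith+
      qed
      have "real i < measure M A * (real n * real ?l)" using i(2) n by (simp add: algebra_simps)
      then have "real i < measure M B * (real n * real ?r)" using * by blast
      then show False using i(1) by (simp add: mult_ac)
    qed
  next
    assume le: "real ?l * measure M A \<le> real ?r * measure M B"
    have "measure M A * (real n * real ?l) \<le> measure M B * (real n * real ?r)" for n
      using mult_left_mono[OF le, of "real n"] by (simp add: mult_ac)
    then show "\<forall>i n. real i < measure M A * (real n * real ?l) \<longrightarrow> real i < measure M B * (real n * real ?r)"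
      by (meson less_le_trans)
  qed
  finally show ?thesis .
qed

lemma count_le_iff:
  assumes z: "z \<in> Fpow (space M)" and AB: "A \<subseteq> space M" "B \<subseteq> space M"
    and fin: "finite (elts l)" "finite (elts r)"
  shows "count_le (code z) l (code A) r (code B) \<longleftrightarrow>
    real (card (elts l)) * count_in z A \<le> real (card (elts r)) * count_in z B"
proof -
  have z: "finite z" "z \<subseteq> space M" using z by (auto simp: Fpow_def)
  have "elts (meet (code z) (code A)) = c ` (z \<inter> A)" if "A \<subseteq> space M" for A
    using that z by (simp add: elts_meet elts_code inj_on_image_Int[OF c_inj])
  moreover have "card (c ` (z \<inter> A)) = card (z \<inter> A)" for A
    using z by (intro card_image inj_on_subset[OF c_inj]) auto
  ultimately show ?thesis
    unfolding count_le_def using fin z AB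
    by (simp add: embeds_iff_card_le flip: of_nat_mult)
qed

text \<open>
  The relation \<open>le\<close> between codes compares multiples of the values of \<open>\<nu>\<close>, at least for the sets that
  occur in certificates.  Both \<open>measure_le\<close> and \<open>count_le\<close> are of this kind.
\<close>

definition interprets :: "('v \<Rightarrow> 'v \<Rightarrow> 'v \<Rightarrow> 'v \<Rightarrow> bool) \<Rightarrow> ('a set \<Rightarrow> real) \<Rightarrow> ('a \<Rightarrow> nat) \<Rightarrow> bool" where
  "interprets le \<nu> V \<longleftrightarrow> (\<forall>j\<in>heavy. \<forall>k l r. finite (elts l) \<longrightarrow> finite (elts r) \<longrightarrow>
     (le l (code {x \<in> P j. V x = k}) r (code (P j)) \<longleftrightarrow>
      real (card (elts l)) * \<nu> {x \<in> P j. V x = k} \<le> real (card (elts r)) * \<nu> (P j))) \<and>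
     (\<forall>j\<in>heavy. \<forall>k. 0 \<le> \<nu> {x \<in> P j. V x = k} \<and> \<nu> {x \<in> P j. V x = k} \<le> \<nu> (P j))"

lemma interpretsD:
  assumes "interprets le \<nu> V" "j \<in> heavy"
  shows "finite (elts l) \<Longrightarrow> finite (elts r) \<Longrightarrow>
      le l (code {x \<in> P j. V x = k}) r (code (P j)) \<longleftrightarrow>
      real (card (elts l)) * \<nu> {x \<in> P j. V x = k} \<le> real (card (elts r)) * \<nu> (P j)"
    and "0 \<le> \<nu> {x \<in> P j. V x = k}" "\<nu> {x \<in> P j. V x = k} \<le> \<nu> (P j)"
  using assms unfolding interprets_def by blast+

text \<open>
  Disjoint subsets of \<open>N\<close> have at most \<open>|N|\<close> elements in total.
\<close>

lemma test_sum_le_of_packing: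
  assumes dec: "decodes v d V C" and valid: "valid_test V C" and le: "interprets le \<nu> V"
    and pack: "packing le \<mu>c Pc v d (nat_code a)"
  shows "real a * test_sum \<nu> V C n \<le> 1"
proof -
  let ?I = "(heavy \<inter> {..<n}) \<times> {..<n}"
  have "nat_code n \<in> elts \<omega>" by (simp add: elts_\<omega>)
  from pack[unfolded packing_def, rule_format, OF this]
  obtain N0 s0 W where N0: "N0 \<in> elts \<omega>" "s0 \<in> elts N0"
    and W: "\<forall>j k j' k' s. kpair j (kpair k s) \<in> elts W \<and> kpair j' (kpair k' s) \<in> elts W \<longrightarrow>
      j = j' \<and> k = k'"
    and fit: "\<forall>j\<in>elts (nat_code n). \<forall>k\<in>elts (nat_code n). \<forall>B q.
      heavy_block \<mu>c Pc j B \<and> kpair j q \<in> elts d \<longrightarrow>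
      le (product N0 (product (nat_code a) k)) (level_set B v k) (product (fibre N0 W j k) q) B"
    by (elim bexE conjE exE) (rule that)
  obtain N where N: "N0 = nat_code N" using N0(1) by (auto simp: elts_\<omega>)
  have "N > 0" using N0(2) by (auto simp: N mem_nat_code_iff)
  define T where "T p = elts (fibre N0 W (nat_code (fst p)) (nat_code (snd p)))" for p
  have T_sub: "T p \<subseteq> elts N0" for p by (auto simp: T_def elts_fibre)
  then have T_fin: "finite (T p)" for p by (rule finite_subset) (simp add: N)
  have T_disj: "T p \<inter> T q = {}" if "p \<noteq> q" for p q
  proof (rule ccontr)
    assume "T p \<inter> T q \<noteq> {}"
    then obtain s where "kpair (nat_code (fst p)) (kpair (nat_code (snd p)) s) \<in> elts W"
      "kpair (nat_code (fst q)) (kpair (nat_code (snd q)) s) \<in> elts W"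
      by (auto simp: T_def elts_fibre)
    with W have "nat_code (fst p) = nat_code (fst q) \<and> nat_code (snd p) = nat_code (snd q)" by blast
    then show False using that by (simp add: prod_eq_iff)
  qed
  have bound: "real a * (real k / real (C j) * (\<nu> {x \<in> P j. V x = k} / \<nu> (P j))) \<le> real (card (T (j, k))) / real N"
    if j: "j \<in> heavy \<inter> {..<n}" and k: "k \<in> {..<n}" for j k
  proof (cases "\<nu> (P j) = 0")
    case False
    have pos: "\<nu> (P j) > 0" using False interpretsD(2,3)[OF le, of j 0] j by fastforce
    have "C j > 0" using valid by (simp add: valid_test_def)
    have "le (product N0 (product (nat_code a) (nat_code k))) (level_set (code (P j)) v (nat_code k))
        (product (fibre N0 W (nat_code j) (nat_code k)) (nat_code (C j))) (code (P j))"
      using j k dec by (intro fit[rule_format]) (auto simp: heavy_block_iff decodes_def)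
    moreover have "level_set (code (P j)) v (nat_code k) = code {x \<in> P j. V x = k}"
      using level_set_code[OF dec block_subset_space] heavyD(1) j by blast
    ultimately have "real (N * (a * k)) * \<nu> {x \<in> P j. V x = k} \<le> real (card (T (j, k)) * C j) * \<nu> (P j)"
      using interpretsD(1)[OF le, of j "product N0 (product (nat_code a) (nat_code k))"
          "product (fibre N0 W (nat_code j) (nat_code k)) (nat_code (C j))" k] j T_fin[of "(j, k)"]
      by (simp add: N T_def)
    then show ?thesis
      using \<open>N > 0\<close> pos \<open>C j > 0\<close> by (simp add: field_simps)
  qed simp
  have "real a * test_sum \<nu> V C n =
      (\<Sum>j\<in>heavy \<inter> {..<n}. \<Sum>k<n. real a * (real k / real (C j) * (\<nu> {x \<in> P j. V x = k} / \<nu> (P j))))"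
    by (simp add: test_sum_def sum_distrib_left)
  also have "\<dots> \<le> (\<Sum>j\<in>heavy \<inter> {..<n}. \<Sum>k<n. real (card (T (j, k))) / real N)"
    by (intro sum_mono bound)
  also have "\<dots> = (\<Sum>p\<in>?I. real (card (T p)) / real N)"
    by (simp add: sum.cartesian_product)
  also have "\<dots> = real (\<Sum>p\<in>?I. card (T p)) / real N"
    by (simp add: sum_divide_distrib)
  also have "(\<Sum>p\<in>?I. card (T p)) = card (\<Union>p\<in>?I. T p)"
    using T_fin T_disj by (intro card_UN_disjoint[symmetric]) auto
  also have "\<dots> \<le> card (elts N0)"
    using T_sub by (intro card_mono) (auto simp: N)
  finally show ?thesis using \<open>N > 0\<close> by (simp add: N divide_le_eq)
qed

text \<open>
  Rounding up each \<open>N * y p\<close> costs less than 1 for each of the finitely many indices; if the sum of the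
  \<open>y p\<close> is less than 1, a large \<open>N\<close> makes up for this.
\<close>

lemma packing_of_test_sum_less:
  assumes dec: "decodes v d V C" and valid: "valid_test V C" and le: "interprets le \<nu> V"
    and less: "\<And>n. real a * test_sum \<nu> V C n < 1"
  shows "packing le \<mu>c Pc v d (nat_code a)"
  unfolding packing_def
proof
  fix n0 assume "n0 \<in> elts \<omega>"
  then obtain n where n: "n0 = nat_code n" by (auto simp: elts_\<omega>)
  let ?I = "(heavy \<inter> {..<n}) \<times> {..<n}"
  define y where "y p = real a * (real (snd p) / real (C (fst p)) *
    (\<nu> {x \<in> P (fst p). V x = snd p} / \<nu> (P (fst p))))" for p
  have y_nonneg: "y p \<ge> 0" if "p \<in> ?I" for p
  proof -
    have "fst p \<in> heavy" using that by auto
    note A = interpretsD(2,3)[OF le this]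
    show ?thesis
      unfolding y_def using A(1) order_trans[OF A(1) A(2)]
      by (intro mult_nonneg_nonneg divide_nonneg_nonneg) auto
  qed
  have "(\<Sum>p\<in>?I. y p) = real a * test_sum \<nu> V C n"
    by (simp add: test_sum_def y_def sum_distrib_left sum.cartesian_product split_beta)
  then have y_sum: "(\<Sum>p\<in>?I. y p) < 1" using less by simp
  define gap where "gap = 1 - (\<Sum>p\<in>?I. y p)"
  have "gap > 0" using y_sum by (simp add: gap_def)
  obtain N :: nat where N: "real (card ?I) + 1 < real N * gap"
    using reals_Archimedean3[OF \<open>gap > 0\<close>] by blast
  have "0 < real N * gap" using N by (intro order_le_less_trans[OF _ N]) simp
  then have "N > 0" by (cases "N = 0") auto
  define t where "t p = nat \<lceil>real N * y p\<rceil>" for p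
  have t_ge: "real (t p) \<ge> real N * y p" for p unfolding t_def by (rule real_nat_ceiling_ge)
  have t_le: "real (t p) \<le> real N * y p + 1" if "p \<in> ?I" for p
  proof -
    have "real N * y p \<ge> 0" using y_nonneg[OF that] by simp
    then show ?thesis unfolding t_def by linarith
  qed
  have "real (\<Sum>p\<in>?I. t p) \<le> (\<Sum>p\<in>?I. real N * y p + 1)"
    unfolding of_nat_sum by (rule sum_mono[OF t_le])
  also have "\<dots> = real N * (1 - gap) + real (card ?I)"
    by (simp add: sum.distrib sum_distrib_left gap_def)
  also have "\<dots> \<le> real N" using N by (simp add: algebra_simps)
  finally have "(\<Sum>p\<in>?I. t p) \<le> N" unfolding of_nat_le_iff .
  then have "card (SIGMA p:?I. {..<t p}) \<le> card {..<N}" by simp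
  moreover have "finite (SIGMA p:?I. {..<t p})" by auto
  ultimately obtain g where g: "g ` (SIGMA p:?I. {..<t p}) \<subseteq> {..<N}" "inj_on g (SIGMA p:?I. {..<t p})"
    using card_le_inj[of "SIGMA p:?I. {..<t p}" "{..<N}"] by auto
  define W0 where "W0 = (\<lambda>(p, i). kpair (nat_code (fst p)) (kpair (nat_code (snd p)) (nat_code (g (p, i))))) `
    (SIGMA p:?I. {..<t p})"
  define W where "W = mk W0"
  have "finite W0" unfolding W0_def by (intro finite_imageI) auto
  then have W: "elts W = W0" unfolding W_def by (intro elts_mk small_finite)
  have W_disj: "j = j' \<and> k = k'" if W12: "kpair j (kpair k s) \<in> elts W" "kpair j' (kpair k' s) \<in> elts W" for j k j' k' s
  proof -
    obtain p i where 1: "p \<in> ?I" "i < t p" "j = nat_code (fst p)" "k = nat_code (snd p)" "s = nat_code (g (p, i))"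
      using W12(1) unfolding W W0_def by auto
    obtain p' i' where 2: "p' \<in> ?I" "i' < t p'" "j' = nat_code (fst p')" "k' = nat_code (snd p')" "s = nat_code (g (p', i'))"
      using W12(2) unfolding W W0_def by auto
    have "(p, i) = (p', i')" using 1 2 by (intro inj_onD[OF g(2)]) auto
    then show ?thesis using 1 2 by simp
  qed
  have fibre: "card (elts (fibre (nat_code N) W (nat_code j) (nat_code k))) = t (j, k)"
    if "(j, k) \<in> ?I" for j k
  proof -
    have "elts (fibre (nat_code N) W (nat_code j) (nat_code k)) =
        (\<lambda>i. nat_code (g ((j, k), i))) ` {..<t (j, k)}" (is "?L = ?R")
    proof
      show "?L \<subseteq> ?R" by (auto simp: elts_fibre W W0_def)
      show "?R \<subseteq> ?L"
      proof
        fix s assume "s \<in> ?R"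
        then obtain i where i: "i < t (j, k)" "s = nat_code (g ((j, k), i))" by auto
        have "g ((j, k), i) < N" using g(1) i(1) that by blast
        moreover have "kpair (nat_code j) (kpair (nat_code k) s) \<in> W0"
          unfolding W0_def using i that by (intro image_eqI[of _ _ "((j, k), i)"]) auto
        ultimately show "s \<in> ?L" using i(2) by (simp add: elts_fibre W)
      qed
    qed
    moreover have "inj_on (\<lambda>i. nat_code (g ((j, k), i))) {..<t (j, k)}"
    proof (rule inj_onI)
      fix i i' assume i: "i \<in> {..<t (j, k)}" "i' \<in> {..<t (j, k)}" "nat_code (g ((j, k), i)) = nat_code (g ((j, k), i'))"
      have "((j, k), i) = ((j, k), i')" using i that by (intro inj_onD[OF g(2)]) auto
      then show "i = i'" by simp
    qed
    ultimately show ?thesis by (simp add: card_image)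
  qed
  have fibre_fin: "finite (elts (fibre (nat_code N) W j k))" for j k
    by (rule finite_subset[of _ "elts (nat_code N)"]) (auto simp: elts_fibre)
  have fit: "le (product (nat_code N) (product (nat_code a) k)) (level_set B v k)
      (product (fibre (nat_code N) W j k) q) B"
    if jk: "j \<in> elts n0" "k \<in> elts n0" "heavy_block \<mu>c Pc j B" "kpair j q \<in> elts d" for j k B q
  proof -
    obtain i where i: "i \<in> heavy" "j = nat_code i" "B = code (P i)" using jk(3) by (auto simp: heavy_block_iff)
    obtain k' where k': "k = nat_code k'" "k' < n" using jk(2) by (auto simp: n mem_nat_code_iff)
    have ik: "(i, k') \<in> ?I" using jk(1) i k' by (auto simp: n)
    have q: "q = nat_code (C i)" using jk(4) dec i(2) by (simp add: decodes_def)
    have "C i > 0" using valid by (simp add: valid_test_def)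
    let ?A = "{x \<in> P i. V x = k'}"
    have A: "0 \<le> \<nu> ?A" "\<nu> ?A \<le> \<nu> (P i)" using interpretsD(2,3)[OF le i(1)] by auto
    have "real N * (real a * real k') * \<nu> ?A \<le> real (t (i, k')) * real (C i) * \<nu> (P i)"
    proof (cases "\<nu> (P i) = 0")
      case False
      then have "\<nu> (P i) > 0" using A by simp
      then have "real N * (real a * real k') * \<nu> ?A = real N * y (i, k') * real (C i) * \<nu> (P i)"
        using \<open>C i > 0\<close> by (simp add: y_def field_simps)
      also have "\<dots> \<le> real (t (i, k')) * real (C i) * \<nu> (P i)"
        using t_ge \<open>\<nu> (P i) > 0\<close> by (intro mult_right_mono) auto
      finally show ?thesis .
    qed (use A in simp)
    then show ?thesis
      unfolding i(2,3) k'(1) q level_set_code[OF dec block_subset_space[OF heavyD(1)[OF i(1)]]]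
      using interpretsD(1)[OF le i(1)] fibre[OF ik] fibre_fin by simp
  qed
  have "\<exists>s. s \<in> elts (nat_code N)" using \<open>N > 0\<close> by (intro exI[of _ "nat_code 0"]) simp
  moreover have "\<exists>W. (\<forall>j k j' k' s. kpair j (kpair k s) \<in> elts W \<and> kpair j' (kpair k' s) \<in> elts W \<longrightarrow>
        j = j' \<and> k = k') \<and>
     (\<forall>j\<in>elts n0. \<forall>k\<in>elts n0. \<forall>B q. heavy_block \<mu>c Pc j B \<and> kpair j q \<in> elts d \<longrightarrow>
        le (product (nat_code N) (product (nat_code a) k)) (level_set B v k)
          (product (fibre (nat_code N) W j k) q) B)"
    apply (rule exI[of _ W], rule conjI)
     apply (intro allI impI, elim conjE, rule W_disj, assumption+)
    apply (intro ballI allI impI, elim conjE, rule fit, assumption+)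
    done
  moreover have "nat_code N \<in> elts \<omega>" by (simp add: elts_\<omega>)
  ultimately show "\<exists>N\<in>elts \<omega>. (\<exists>s. s \<in> elts N) \<and> (\<exists>W.
     (\<forall>j k j' k' s. kpair j (kpair k s) \<in> elts W \<and> kpair j' (kpair k' s) \<in> elts W \<longrightarrow>
        j = j' \<and> k = k') \<and>
     (\<forall>j\<in>elts n0. \<forall>k\<in>elts n0. \<forall>B q. heavy_block \<mu>c Pc j B \<and> kpair j q \<in> elts d \<longrightarrow>
        le (product N (product (nat_code a) k)) (level_set B v k) (product (fibre N W j k) q) B))"
    by (intro bexI[of _ "nat_code N"] conjI)
qed

lemma interprets_measure_le:
  assumes "valid_test V C"
  shows "interprets (measure_le \<mu>c) (measure M) V"
  unfolding interprets_def
proof (intro conjI ballI allI impI)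
  fix j k l r assume j: "j \<in> heavy"
  have lev: "{x \<in> P j. V x = k} \<in> sets M" using assms j by (simp add: valid_test_def)
  have fin: "emeasure M {x \<in> P j. V x = k} < \<infinity>" by (rule heavy_sub_finite[OF j]) auto
  show "measure_le \<mu>c l (code {x \<in> P j. V x = k}) r (code (P j)) \<longleftrightarrow>
      real (card (elts l)) * measure M {x \<in> P j. V x = k} \<le> real (card (elts r)) * measure M (P j)"
    if "finite (elts l)" "finite (elts r)"
    by (rule measure_le_iff[OF lev fin heavyD(2)[OF j] heavy_finite[OF j] that])
  show "measure M {x \<in> P j. V x = k} \<le> measure M (P j)"
    using heavyD(2)[OF j] heavy_finite[OF j] lev
    by (intro measure_mono_fmeasurable) (auto simp: fmeasurable_def)
qed simp

lemma interprets_count_le: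
  assumes z: "z \<in> Fpow (space M)"
  shows "interprets (count_le (code z)) (count_in z) V"
  unfolding interprets_def
proof (intro conjI ballI allI impI)
  fix j k l r assume j: "j \<in> heavy"
  have sub: "P j \<subseteq> space M" using block_subset_space heavyD(1) j by blast
  then have sub': "{x \<in> P j. V x = k} \<subseteq> space M" by auto
  show "count_le (code z) l (code {x \<in> P j. V x = k}) r (code (P j)) \<longleftrightarrow>
      real (card (elts l)) * count_in z {x \<in> P j. V x = k} \<le> real (card (elts r)) * count_in z (P j)"
    if "finite (elts l)" "finite (elts r)"
    by (rule count_le_iff[OF z sub' sub that])
  show "count_in z {x \<in> P j. V x = k} \<le> count_in z (P j)"
    using z by (auto simp: Fpow_def intro!: card_mono)
qed simp

text \<open>
  A certificate bounds a sum by 1, and a sum less than 1 has a certificate.  The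
  factors \<open>a < b\<close> bridge the gap between these two statements, on both sides.
\<close>

lemma converges_iff_packing:
  assumes G: "covering G"
  shows "converges_to_integral M \<alpha> P w G \<longleftrightarrow>
    (\<forall>v d a b. test_data \<mu>c Pc v d \<and> b \<in> elts \<omega> \<and> a \<in> elts b \<and> packing (measure_le \<mu>c) \<mu>c Pc v d b \<longrightarrow>
       (\<forall>\<^sub>F z in G. packing (count_le (code z)) \<mu>c Pc v d a))" (is "?conv \<longleftrightarrow> ?pack")
proof
  assume conv: ?conv
  show ?pack
  proof (intro allI impI, elim conjE)
    fix v d a b
    assume t: "test_data \<mu>c Pc v d" and ba: "b \<in> elts \<omega>" "a \<in> elts b"
      and pack: "packing (measure_le \<mu>c) \<mu>c Pc v d b"
    obtain l k where lk: "b = nat_code l" "a = nat_code k" "k < l"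
      using ba by (auto simp: elts_\<omega> mem_nat_code_iff)
    obtain V C where dec: "decodes v d V C" and valid: "valid_test V C"
      using ex_valid_test_data[OF t] by blast
    have "test_sum (measure M) V C n \<le> 1 / real l" for n
      using test_sum_le_of_packing[OF dec valid interprets_measure_le[OF valid] pack[unfolded lk(1)], of n] lk(3)
      by (simp add: field_simps)
    \<comment> \<open>A number strictly between \<open>1 / l\<close> and \<open>1 / k\<close>, well-defined for \<open>k = 0\<close>, too.\<close>
    moreover have "1 / real l < 2 / (2 * real k + 1)" using lk(3) by (simp add: field_simps)
    ultimately have "\<forall>\<^sub>F z in G. \<forall>n. test_sum (count_in z) V C n \<le> 2 / (2 * real k + 1)"
      by (rule tests_bounded_of_convergence[OF G conv valid])
    then show "\<forall>\<^sub>F z in G. packing (count_le (code z)) \<mu>c Pc v d a"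
      using covering_Fpow[OF G]
    proof eventually_elim
      case (elim z)
      show ?case
        unfolding lk(2)
      proof (rule packing_of_test_sum_less[OF dec valid interprets_count_le[OF elim(2)]])
        fix n
        have "real k * test_sum (count_in z) V C n \<le> real k * (2 / (2 * real k + 1))"
          using elim(1) by (intro mult_left_mono) auto
        also have "\<dots> < 1" by (simp add: field_simps)
        finally show "real k * test_sum (count_in z) V C n < 1" .
      qed
    qed
  qed
next
  assume pack: ?pack
  have "bounds_tests G"
    unfolding bounds_tests_def
  proof (intro allI impI, elim conjE)
    fix V C and b :: real
    assume valid: "valid_test V C" and b: "b < 1" and sum: "\<forall>n. test_sum (measure M) V C n \<le> b"
    obtain k :: nat where k: "1 / (1 - b) < real k" using reals_Archimedean2 by blast
    have "k > 0" using k b by (cases "k = 0") (auto simp: divide_less_0_iff)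
    have kb: "(real k + 1) * b < real k"
      using k b by (simp add: field_simps)
    \<comment> \<open>Denominators multiplied by \<open>k\<close> turn the factors \<open>k\<close> and \<open>k + 1\<close> into \<open>1\<close> and \<open>1 + 1 / k\<close>.\<close>
    define C' where "C' j = k * C j" for j
    have scale: "test_sum \<nu> V C' n = test_sum \<nu> V C n / real k" for \<nu> n
      by (simp add: test_sum_def C'_def sum_divide_distrib mult_ac)
    have valid': "valid_test V C'" using valid \<open>k > 0\<close> by (simp add: valid_test_def C'_def)
    obtain v d where dec: "decodes v d V C'" using ex_decodes by blast
    have "packing (measure_le \<mu>c) \<mu>c Pc v d (nat_code (Suc k))"
    proof (rule packing_of_test_sum_less[OF dec valid' interprets_measure_le[OF valid']])
      fix n
      have "(real k + 1) * test_sum (measure M) V C n \<le> (real k + 1) * b"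
        using sum by (intro mult_left_mono) auto
      also note kb
      finally show "real (Suc k) * test_sum (measure M) V C' n < 1"
        using \<open>k > 0\<close> by (simp add: scale divide_less_eq add_ac)
    qed
    then have "\<forall>\<^sub>F z in G. packing (count_le (code z)) \<mu>c Pc v d (nat_code k)"
      using pack[rule_format, of v d "nat_code (Suc k)" "nat_code k"] test_data_of_valid[OF dec valid']
      by (simp add: elts_\<omega>)
    then show "\<forall>\<^sub>F z in G. \<forall>n. test_sum (count_in z) V C n \<le> 1"
      using covering_Fpow[OF G]
    proof eventually_elim
      case (elim z)
      show ?case
        using test_sum_le_of_packing[OF dec valid' interprets_count_le[OF elim(2)] elim(1)] \<open>k > 0\<close>
        by (simp add: scale)
    qed
  qed
  then show ?conv by (rule converges_of_bounds_tests[OF G])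
qed

end


section \<open>The least representing filter is definable\<close>

context coded_space
begin

abbreviation Fc :: "'a set filter \<Rightarrow> 'v" where "Fc G \<equiv> filter_code c (space M) G"

lemma elts_mk_codes: "S \<subseteq> Fpow (space M) \<Longrightarrow> elts (mk (code ` S)) = code ` S"
  by (intro elts_mk small_codes) (auto simp: Fpow_def)

lemma inj_code_Fpow: "inj_on code (Fpow (space M))"
  by (rule inj_code) (auto simp: Fpow_def)

lemma code_mem_codes_iff:
  "S \<subseteq> Fpow (space M) \<Longrightarrow> z \<in> Fpow (space M) \<Longrightarrow> code z \<in> code ` S \<longleftrightarrow> z \<in> S"
  using inj_on_image_mem_iff[OF inj_code_Fpow] by blast

lemma elts_filter_code:
  "elts (Fc G) = (\<lambda>S. mk (code ` S)) ` {S. S \<subseteq> Fpow (space M) \<and> (\<forall>\<^sub>F z in G. z \<in> S)}"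
  unfolding filter_code_def
  by (intro elts_mk small_subset[OF small_code_Pow_Pow] image_mono) (auto simp: Fpow_def)

lemma mk_codes_mem_filter_code_iff:
  assumes "S \<subseteq> Fpow (space M)"
  shows "mk (code ` S) \<in> elts (Fc G) \<longleftrightarrow> (\<forall>\<^sub>F z in G. z \<in> S)"
proof
  assume "mk (code ` S) \<in> elts (Fc G)"
  then obtain S' where S': "S' \<subseteq> Fpow (space M)" "\<forall>\<^sub>F z in G. z \<in> S'" "mk (code ` S) = mk (code ` S')"
    unfolding elts_filter_code by (elim imageE CollectE conjE) (rule that)
  have "code ` S = code ` S'"
    using elts_mk_codes[OF assms] elts_mk_codes[OF S'(1)] S'(3) by metis
  then have "S = S'"
    using inj_on_image_eq_iff[OF inj_code_Fpow assms S'(1)] by blast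
  then show "\<forall>\<^sub>F z in G. z \<in> S" using S'(2) by simp
next
  assume "\<forall>\<^sub>F z in G. z \<in> S"
  with assms show "mk (code ` S) \<in> elts (Fc G)"
    unfolding elts_filter_code by (intro imageI) simp
qed

text \<open>
  A filter contains a set of \<open>z\<close> with the property \<open>R\<close> iff \<open>R\<close> holds eventually.
\<close>

lemma ex_mem_filter_code_iff:
  assumes G: "covering G"
  shows "(\<exists>U\<in>elts (Fc G). \<forall>z\<in>elts U. R z) \<longleftrightarrow> (\<forall>\<^sub>F z in G. R (code z))"
proof
  assume "\<exists>U\<in>elts (Fc G). \<forall>z\<in>elts U. R z"
  then obtain S where S: "S \<subseteq> Fpow (space M)" "\<forall>\<^sub>F z in G. z \<in> S" "\<forall>z\<in>elts (mk (code ` S)). R z"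
    unfolding elts_filter_code by blast
  then have "\<forall>z\<in>S. R (code z)" by (simp add: elts_mk_codes)
  with S(2) show "\<forall>\<^sub>F z in G. R (code z)" by (auto elim: eventually_mono)
next
  assume R: "\<forall>\<^sub>F z in G. R (code z)"
  define S where "S = {z \<in> Fpow (space M). R (code z)}"
  have S: "S \<subseteq> Fpow (space M)" by (auto simp: S_def)
  have "\<forall>\<^sub>F z in G. z \<in> S" using R covering_Fpow[OF G] by eventually_elim (simp add: S_def)
  then have "mk (code ` S) \<in> elts (Fc G)" by (simp add: mk_codes_mem_filter_code_iff[OF S])
  moreover have "\<forall>z\<in>elts (mk (code ` S)). R z" using S by (auto simp: elts_mk_codes S_def)
  ultimately show "\<exists>U\<in>elts (Fc G). \<forall>z\<in>elts U. R z" by blast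
qed

lemma good_filter_code:
  assumes G: "covering G" "converges_to_integral M \<alpha> P w G"
  shows "good_filter \<mu>c Pc (Fc G)"
  unfolding good_filter_def
proof (intro conjI)
  show "\<exists>U. U \<in> elts (Fc G)"
    using mk_codes_mem_filter_code_iff[of "Fpow (space M)" G] covering_Fpow[OF G(1)] by auto
  show "\<forall>U\<in>elts (Fc G). \<forall>z\<in>elts U. finite_points \<mu>c z"
    unfolding elts_filter_code finite_points_iff by (auto simp: elts_mk_codes)
  show "\<forall>U\<in>elts (Fc G). \<forall>V. elts U \<subseteq> elts V \<and> (\<forall>z\<in>elts V. finite_points \<mu>c z) \<longrightarrow> V \<in> elts (Fc G)"
  proof (intro ballI allI impI)
    fix U V assume U: "U \<in> elts (Fc G)" and V: "elts U \<subseteq> elts V \<and> (\<forall>z\<in>elts V. finite_points \<mu>c z)"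
    obtain S where S: "S \<subseteq> Fpow (space M)" "\<forall>\<^sub>F z in G. z \<in> S" "U = mk (code ` S)"
      using U unfolding elts_filter_code by blast
    have "elts V \<subseteq> code ` Fpow (space M)" using V by (auto simp: finite_points_iff)
    then obtain T where T: "T \<subseteq> Fpow (space M)" "elts V = code ` T" by (auto simp: subset_image_iff)
    have "S \<subseteq> T"
    proof
      fix z assume "z \<in> S"
      then have "code z \<in> code ` T" using V T(2) S(1,3) by (auto simp: elts_mk_codes)
      then show "z \<in> T" using code_mem_codes_iff[OF T(1)] S(1) \<open>z \<in> S\<close> by blast
    qed
    then have "\<forall>\<^sub>F z in G. z \<in> T" using S(2) by (auto elim: eventually_mono)
    moreover have "V = mk (code ` T)" using T(2) by (metis mk_elts)
    ultimately show "V \<in> elts (Fc G)" using mk_codes_mem_filter_code_iff[OF T(1)] by simp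
  qed
  show "\<forall>U\<in>elts (Fc G). \<forall>V\<in>elts (Fc G). \<exists>W\<in>elts (Fc G). elts W \<subseteq> elts U \<and> elts W \<subseteq> elts V"
  proof (intro ballI)
    fix U V assume "U \<in> elts (Fc G)" "V \<in> elts (Fc G)"
    then obtain S T where ST: "S \<subseteq> Fpow (space M)" "\<forall>\<^sub>F z in G. z \<in> S" "U = mk (code ` S)"
      "T \<subseteq> Fpow (space M)" "\<forall>\<^sub>F z in G. z \<in> T" "V = mk (code ` T)"
      unfolding elts_filter_code by blast
    have sub: "S \<inter> T \<subseteq> Fpow (space M)" using ST(1) by blast
    have "\<forall>\<^sub>F z in G. z \<in> S \<inter> T" using ST(2,5) by eventually_elim simp
    then have "mk (code ` (S \<inter> T)) \<in> elts (Fc G)" by (simp add: mk_codes_mem_filter_code_iff[OF sub])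
    moreover have "elts (mk (code ` (S \<inter> T))) \<subseteq> elts U" "elts (mk (code ` (S \<inter> T))) \<subseteq> elts V"
      unfolding ST(3,6) elts_mk_codes[OF sub] elts_mk_codes[OF ST(1)] elts_mk_codes[OF ST(4)] by blast+
    ultimately show "\<exists>W\<in>elts (Fc G). elts W \<subseteq> elts U \<and> elts W \<subseteq> elts V" by blast
  qed
  show "\<forall>x. in_space \<mu>c x \<longrightarrow> (\<exists>U\<in>elts (Fc G). \<forall>z\<in>elts U. x \<in> elts z)"
  proof (intro allI impI)
    fix x assume "in_space \<mu>c x"
    then obtain y where y: "y \<in> space M" "x = c y" by (auto simp: in_space_iff)
    then have "\<forall>\<^sub>F z in G. y \<in> z" using G(1) by (simp add: covering_def)
    then have "\<forall>\<^sub>F z in G. x \<in> elts (code z)"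
      using covering_Fpow[OF G(1)]
      by eventually_elim (simp add: y(2) Fpow_def mem_code_iff[OF _ y(1)])
    then show "\<exists>U\<in>elts (Fc G). \<forall>z\<in>elts U. x \<in> elts z"
      using ex_mem_filter_code_iff[OF G(1), of "\<lambda>z. x \<in> elts z"] by blast
  qed
  show "\<forall>v d a b. test_data \<mu>c Pc v d \<and> b \<in> elts \<omega> \<and> a \<in> elts b \<and>
      packing (measure_le \<mu>c) \<mu>c Pc v d b \<longrightarrow>
      (\<exists>U\<in>elts (Fc G). \<forall>z\<in>elts U. packing (count_le z) \<mu>c Pc v d a)"
    unfolding ex_mem_filter_code_iff[OF G(1)] using G(2) converges_iff_packing[OF G(1)] by simp
qed

text \<open>
  The clauses of \<open>good_filter\<close> say exactly that the sets in \<open>y\<close> form a possibly improper fine filter that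
  satisfies the certificate condition on tests.
\<close>

lemma ex_filter_of_good_filter:
  assumes good: "good_filter \<mu>c Pc y"
  shows "\<exists>G. covering G \<and> converges_to_integral M \<alpha> P w G \<and> y = Fc G"
proof -
  let ?X = "Fpow (space M)"
  have nonempty: "\<exists>U. U \<in> elts y" by (rule good[unfolded good_filter_def, THEN conjunct1])
  have points: "\<forall>U\<in>elts y. \<forall>z\<in>elts U. finite_points \<mu>c z" by (rule good[unfolded good_filter_def, THEN conjunct2, THEN conjunct1])
  have upward: "\<forall>U\<in>elts y. \<forall>V. elts U \<subseteq> elts V \<and> (\<forall>z\<in>elts V. finite_points \<mu>c z) \<longrightarrow> V \<in> elts y"
    by (rule good[unfolded good_filter_def, THEN conjunct2, THEN conjunct2, THEN conjunct1])
  have meets: "\<forall>U\<in>elts y. \<forall>V\<in>elts y. \<exists>W\<in>elts y. elts W \<subseteq> elts U \<and> elts W \<subseteq> elts V"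
    by (rule good[unfolded good_filter_def, THEN conjunct2, THEN conjunct2, THEN conjunct2, THEN conjunct1])
  have fine: "\<forall>x. in_space \<mu>c x \<longrightarrow> (\<exists>U\<in>elts y. \<forall>z\<in>elts U. x \<in> elts z)"
    by (rule good[unfolded good_filter_def, THEN conjunct2, THEN conjunct2, THEN conjunct2, THEN conjunct2, THEN conjunct1])
  have tests: "\<forall>v d a b. test_data \<mu>c Pc v d \<and> b \<in> elts \<omega> \<and> a \<in> elts b \<and>
      packing (measure_le \<mu>c) \<mu>c Pc v d b \<longrightarrow>
      (\<exists>U\<in>elts y. \<forall>z\<in>elts U. packing (count_le z) \<mu>c Pc v d a)"
    by (rule good[unfolded good_filter_def, THEN conjunct2, THEN conjunct2, THEN conjunct2, THEN conjunct2, THEN conjunct2])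
  define ev where "ev Q \<longleftrightarrow> mk (code ` {z \<in> ?X. Q z}) \<in> elts y" for Q
  have up: "ev Q" if U: "U \<in> elts y" and Q: "\<And>z. z \<in> ?X \<Longrightarrow> code z \<in> elts U \<Longrightarrow> Q z" for U Q
  proof -
    have eq: "elts (mk (code ` {z \<in> ?X. Q z})) = code ` {z \<in> ?X. Q z}" by (rule elts_mk_codes) auto
    have "elts U \<subseteq> code ` {z \<in> ?X. Q z}"
    proof
      fix u assume u: "u \<in> elts U"
      then obtain z where "z \<in> ?X" "u = code z" using points U by (auto simp: finite_points_iff)
      then show "u \<in> code ` {z \<in> ?X. Q z}" using Q u by blast
    qed
    moreover have "\<forall>z\<in>code ` {z \<in> ?X. Q z}. finite_points \<mu>c z" by (auto simp: finite_points_iff)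
    ultimately show ?thesis
      unfolding ev_def using upward[rule_format, OF U, of "mk (code ` {z \<in> ?X. Q z})"] eq by simp
  qed
  have ev_code: "code z \<in> elts (mk (code ` {z \<in> ?X. Q z})) \<longleftrightarrow> Q z" if "z \<in> ?X" for z Q
  proof -
    have sub: "{z \<in> ?X. Q z} \<subseteq> ?X" by blast
    show ?thesis
      unfolding elts_mk_codes[OF sub] code_mem_codes_iff[OF sub that] using that by simp
  qed
  obtain U0 where U0: "U0 \<in> elts y" using nonempty by blast
  have filter: "is_filter ev"
  proof
    show "ev (\<lambda>z. True)" by (rule up[OF U0]) simp
    show "ev (\<lambda>z. Q z \<and> R z)" if QR: "ev Q" "ev R" for Q R
    proof -
      obtain W where W: "W \<in> elts y" "elts W \<subseteq> elts (mk (code ` {z \<in> ?X. Q z}))"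
        "elts W \<subseteq> elts (mk (code ` {z \<in> ?X. R z}))"
        using meets QR[unfolded ev_def] by meson
      show ?thesis
      proof (rule up[OF W(1)])
        fix z assume "z \<in> ?X" "code z \<in> elts W"
        then show "Q z \<and> R z" using ev_code[of z Q] ev_code[of z R] W(2,3) by blast
      qed
    qed
    show "ev R" if "\<forall>z. Q z \<longrightarrow> R z" "ev Q" for Q R
      by (rule up[OF that(2)[unfolded ev_def]]) (simp add: ev_code that(1))
  qed
  define G where "G = Abs_filter ev"
  have evG: "eventually Q G \<longleftrightarrow> ev Q" for Q
    unfolding G_def by (rule eventually_Abs_filter[OF filter])
  have cov: "covering G"
    unfolding covering_def le_principal evG
  proof (intro conjI ballI)
    show "ev (\<lambda>z. z \<in> ?X)" by (rule up[OF U0])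
    fix x assume x: "x \<in> space M"
    then obtain U where "U \<in> elts y" "\<forall>z\<in>elts U. c x \<in> elts z" using fine by (auto simp: in_space_iff)
    then show "ev (\<lambda>z. x \<in> z)"
      using mem_code_iff[OF _ x] by (intro up[of U]) (auto simp: Fpow_def)
  qed
  have "converges_to_integral M \<alpha> P w G"
    unfolding converges_iff_packing[OF cov] evG
  proof (intro allI impI)
    fix v d a b
    assume "test_data \<mu>c Pc v d \<and> b \<in> elts \<omega> \<and> a \<in> elts b \<and> packing (measure_le \<mu>c) \<mu>c Pc v d b"
    then obtain U where "U \<in> elts y" "\<forall>z\<in>elts U. packing (count_le z) \<mu>c Pc v d a"
      using tests by blast
    then show "ev (\<lambda>z. packing (count_le (code z)) \<mu>c Pc v d a)" by (intro up[of U]) auto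
  qed
  moreover have "elts y = elts (Fc G)"
  proof
    show "elts y \<subseteq> elts (Fc G)"
    proof
      fix U assume U: "U \<in> elts y"
      define S where "S = {z \<in> ?X. code z \<in> elts U}"
      have "elts U \<subseteq> code ` ?X" using points U by (auto simp: finite_points_iff)
      then have "elts U = code ` S" by (auto simp: S_def)
      then have "U = mk (code ` S)" by (metis mk_elts)
      moreover have "ev (\<lambda>z. z \<in> S)" by (rule up[OF U]) (simp add: S_def)
      ultimately show "U \<in> elts (Fc G)"
        using mk_codes_mem_filter_code_iff[of S G] evG by (auto simp: S_def)
    qed
    show "elts (Fc G) \<subseteq> elts y"
    proof
      fix U assume "U \<in> elts (Fc G)"
      then obtain S where S: "S \<subseteq> ?X" "ev (\<lambda>z. z \<in> S)" "U = mk (code ` S)"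
        unfolding elts_filter_code evG by blast
      have "{z \<in> ?X. z \<in> S} = S" using S(1) by blast
      then show "U \<in> elts y" using S(2,3) by (simp add: ev_def)
    qed
  qed
  ultimately show ?thesis using cov extensionality by blast
qed

text \<open>
  Inclusion of codes is the reverse of the order of filters, so that a least code belongs to a greatest
  filter.
\<close>

lemma least_good_filter_iff:
  assumes F: "covering F" "converges_to_integral M \<alpha> P w F"
    and least: "\<And>G. covering G \<Longrightarrow> converges_to_integral M \<alpha> P w G \<Longrightarrow> G \<le> F"
  shows "least_good_filter \<mu>c Pc y \<longleftrightarrow> y = Fc F"
proof -
  have mono: "elts (Fc G) \<subseteq> elts (Fc G') \<longleftrightarrow> G' \<le> G" if "covering G" "covering G'" for G G'
  proof
    assume sub: "elts (Fc G) \<subseteq> elts (Fc G')"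
    show "G' \<le> G"
    proof (rule filter_leI)
      fix Q assume "eventually Q G"
      then have "\<forall>\<^sub>F z in G. z \<in> {z \<in> Fpow (space M). Q z}"
        using covering_Fpow[OF that(1)] by eventually_elim simp
      then have "mk (code ` {z \<in> Fpow (space M). Q z}) \<in> elts (Fc G)"
        by (subst mk_codes_mem_filter_code_iff) auto
      then have "mk (code ` {z \<in> Fpow (space M). Q z}) \<in> elts (Fc G')" using sub by blast
      then have "\<forall>\<^sub>F z in G'. z \<in> {z \<in> Fpow (space M). Q z}"
        by (subst (asm) mk_codes_mem_filter_code_iff) auto
      then show "eventually Q G'" by eventually_elim simp
    qed
  next
    assume "G' \<le> G"
    then show "elts (Fc G) \<subseteq> elts (Fc G')"
      unfolding elts_filter_code using filter_leD by (intro image_mono) blast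
  qed
  show ?thesis
  proof
    assume y: "least_good_filter \<mu>c Pc y"
    then obtain G where G: "covering G" "converges_to_integral M \<alpha> P w G" "y = Fc G"
      using ex_filter_of_good_filter unfolding least_good_filter_def by blast
    have "elts (Fc G) \<subseteq> elts (Fc F)"
      using y good_filter_code[OF F] G(3) unfolding least_good_filter_def by blast
    then have "F \<le> G" using mono G(1) F(1) by blast
    then show "y = Fc F" using least[OF G(1,2)] G(3) by simp
  next
    assume y: "y = Fc F"
    have "elts y \<subseteq> elts y'" if "good_filter \<mu>c Pc y'" for y'
      using ex_filter_of_good_filter[OF that] least mono[OF F(1)] y by blast
    then show "least_good_filter \<mu>c Pc y"
      using good_filter_code[OF F] y by (simp add: least_good_filter_def)
  qed
qed

end

text \<open>
  Convergence and fineness pass to the supremum of all filters that have them; it is proper because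
  one of them is.
\<close>

lemma (in adapted_partition) ex_least_representing_filter:
  obtains F where "fine_filter (space M) F" "represents_integral M \<alpha> P w F"
    "covering F" "converges_to_integral M \<alpha> P w F"
    "\<And>G. covering G \<Longrightarrow> converges_to_integral M \<alpha> P w G \<Longrightarrow> G \<le> F"
proof -
  define \<G> where "\<G> = {G. covering G \<and> converges_to_integral M \<alpha> P w G}"
  define F where "F = Sup \<G>"
  have least: "G \<le> F" if "covering G" "converges_to_integral M \<alpha> P w G" for G
    using that by (auto simp: F_def \<G>_def intro: Sup_upper)
  have cov: "covering F"
    unfolding covering_def le_principal F_def eventually_Sup
    by (auto simp: \<G>_def covering_def le_principal)
  have conv: "converges_to_integral M \<alpha> P w F"
    unfolding converges_to_integral_def tendsto_def F_def eventually_Sup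
    by (auto simp: \<G>_def converges_to_integral_def tendsto_def)
  obtain G where "G \<noteq> bot" "covering G" "bounds_tests G" using ex_covering_bounds_tests by blast
  then have "F \<noteq> bot" using least converges_of_bounds_tests by (metis le_bot)
  then show ?thesis
    using cov conv least
    by (intro that[of F]) (auto simp: fine_filter_def covering_def represents_integral_iff)
qed

theorem theorem9:
  shows "\<exists>\<phi> :: set_fm. \<forall>M :: 'a measure. sigma_finite_measure M \<longrightarrow>
    (\<exists>(\<alpha> :: enat) (P :: nat \<Rightarrow> 'a set) (F :: 'a set filter) (w :: 'a \<Rightarrow> real).
        countable_partition (space M) \<alpha> P \<and>
        (\<forall>i. enat i < \<alpha> \<longrightarrow> w constant_on P i) \<and>
        fine_filter (space M) F \<and>
        filter_definable_by TYPE('v) \<phi> M \<alpha> P F \<and>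
        represents_integral M \<alpha> P w F \<and>
        (\<forall>G. fine_filter (space M) G \<and> represents_integral M \<alpha> P w G \<longrightarrow> G \<le> F) \<and>
        (emeasure M (space M) < \<infinity> \<longrightarrow>
           (0 < \<alpha> \<longrightarrow> (\<forall>x\<in>P 0. \<not> point_mass M x)) \<and>
           (\<forall>i. 0 < i \<and> enat i < \<alpha> \<longrightarrow> is_singleton (P i))))"
proof -
  obtain \<phi> where \<phi>: "\<And>E (e :: nat \<Rightarrow> 'v). set_universe E \<Longrightarrow>
      sat E e \<phi> \<longleftrightarrow> set_universe.least_good_filter E (e 1) (e 2) (e 0)"
    using expressible_least_good_filter unfolding expressible_def by metis
  show ?thesis
  proof (intro exI[of _ \<phi>] allI impI)
    fix M :: "'a measure" assume "sigma_finite_measure M"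
    then obtain \<alpha> P w where ad: "adapted_partition M \<alpha> P w"
      and const: "\<forall>i. enat i < \<alpha> \<longrightarrow> w constant_on P i"
      and points: "\<forall>x\<in>P 0. \<not> point_mass M x"
      and fin: "emeasure M (space M) < \<infinity> \<longrightarrow> (\<forall>i. 0 < i \<and> enat i < \<alpha> \<longrightarrow> is_singleton (P i))"
      using sigma_finite_measure.ex_adapted_partition by blast
    interpret adapted_partition M \<alpha> P w by (rule ad)
    obtain F where F: "fine_filter (space M) F" "represents_integral M \<alpha> P w F"
      "covering F" "converges_to_integral M \<alpha> P w F"
      "\<And>G. covering G \<Longrightarrow> converges_to_integral M \<alpha> P w G \<Longrightarrow> G \<le> F"
      using ex_least_representing_filter by blast
    have least: "G \<le> F" if "fine_filter (space M) G" "represents_integral M \<alpha> P w G" for G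
      using that by (intro F(5)) (auto simp: fine_filter_def covering_def represents_integral_iff)
    have "filter_definable_by TYPE('v) \<phi> M \<alpha> P F"
      unfolding filter_definable_by_def
    proof (intro allI impI)
      fix elts :: "'v \<Rightarrow> 'v set" and c :: "'a \<Rightarrow> 'v"
      assume U: "set_universe elts" "set_universe.universe_over elts c (space M)"
      interpret set_universe elts by (rule U(1))
      interpret coded_space elts M \<alpha> P w c by unfold_locales (rule U(2))
      show "filter_defined_by \<phi> c M \<alpha> P F"
        unfolding filter_defined_by_def fm_defines_def
      proof (intro allI impI)
        fix e :: "nat \<Rightarrow> 'v"
        assume e: "\<forall>i<length [\<mu>c, Pc]. e (Suc i) = [\<mu>c, Pc] ! i"
        have "e 1 = \<mu>c" "e 2 = Pc"
          using e[rule_format, of 0] e[rule_format, of 1] by (simp_all add: numeral_2_eq_2)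
        then show "sat elts e \<phi> \<longleftrightarrow> e 0 = Fc F"
          using \<phi>[OF U(1)] least_good_filter_iff[OF F(3,4,5)] by simp
      qed
    qed
    then show "\<exists>\<alpha> P F w.
        countable_partition (space M) \<alpha> P \<and>
        (\<forall>i. enat i < \<alpha> \<longrightarrow> w constant_on P i) \<and>
        fine_filter (space M) F \<and>
        filter_definable_by TYPE('v) \<phi> M \<alpha> P F \<and>
        represents_integral M \<alpha> P w F \<and>
        (\<forall>G. fine_filter (space M) G \<and> represents_integral M \<alpha> P w G \<longrightarrow> G \<le> F) \<and>
        (emeasure M (space M) < \<infinity> \<longrightarrow>
           (0 < \<alpha> \<longrightarrow> (\<forall>x\<in>P 0. \<not> point_mass M x)) \<and>
           (\<forall>i. 0 < i \<and> enat i < \<alpha> \<longrightarrow> is_singleton (P i)))"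
      using partition const F(1,2) least points fin
      by (intro exI[of _ \<alpha>] exI[of _ P] exI[of _ F] exI[of _ w]) simp
  qed
qed

end
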